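(* Let $L>0$, $D>0$, $b_1\in\mathbb R$, $b_2>0$, $p_0\in L^2(0,L)$. Let $U,\beta\ge0$, suppose $\alpha>0$, and take $k_0>0$. Let $(\mathscr H_\alpha,\mathcal S(t))$ be the dynamical system generated by the beam problem $$\begin{cases}(1-\alpha\partial_x^2)w_{tt}+D\partial_x^4w+k_0(1-\alpha\partial_x^2)w_t+(b_1-b_2\|w_x\|^2)w_{xx}=p_0(x)-\beta(w_t+Uw_x) & x\in(0,L),\ t>0,\\ w(t=0)=w_0,\quad w_t(t=0)=w_1,\\ w(0)=w_x(0)=0,\quad w_{xx}(L)=0,\\ -\alpha\partial_x[w_{tt}+k_0w_t]+D\partial_x^3w+(b_1-b_2\|w_x\|^2)w_x=0\ \text{ at } x=L.\end{cases}$$ Then $(\mathscr H_\alpha,\mathcal S(t))$ has a compact global attractor $\mathbf A\subset\mathscr H_\alpha$.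
   Context: $(\cdot,\cdot)$ and $\|\cdot\|$ are the inner product and norm of $L^2(0,L)$. $H^2_*=\{v\in H^2(0,L): v(0)=v_x(0)=0\}$ with inner product $(v,w)_{H^2_*}=D(v_{xx},w_{xx})$; $H^1_*=\{v\in H^1(0,L): v(0)=0\}$. For $\alpha>0$, $L_\alpha=H^1_*$ with norm $\|v\|_{L_\alpha}^2=\alpha\|v_x\|^2+\|v\|^2$, and $\mathscr H_\alpha=H^2_*\times L_\alpha$ with $\|(w_0,w_1)\|_{\mathscr H_\alpha}^2=D\|w_{0,xx}\|^2+\alpha\|w_{1,x}\|^2+\|w_1\|^2$. $C_w([0,T];X)$ denotes weakly continuous $X$-valued functions. Weak solution on $[0,T]$: $w\in H^1(0,T;L^2(0,L))$ with $w\in L^\infty(0,T;H^2_* )\cap C_w([0,T];H^2_* )$, $w_t\in L^\infty(0,T;L_\alpha)\cap C_w([0,T];L_\alpha)$; for every $\phi\in H^2_*$, $$\frac{d}{dt}\big[(w_t,\phi)+\alpha(w_{tx},\phi_x)\big]+(w,\phi)_{H^2_*}+(b_2\|w_x\|^2-b_1)(w_x,\phi_x)+k_0(w_t,\phi)+\alpha k_0(w_{tx},\phi_x)=(p_0,\phi)-\beta(w_t,\phi)-\beta U(w_x,\phi)$$ in $\mathscr D'(0,T)$; and $(w,\chi)_{H^2_*}|_{t\to0^+}=(w_0,\chi)_{H^2_*}$, $(w_t,\psi)|_{t\to0^+}=(w_1,\psi)$ for all $\chi\in H^2_*$, $\psi\in L^2(0,L)$. Strong solution on $[0,T]$: a weak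 solution with, in addition, $w\in L^\infty(0,T;W)$, where $W=\{v\in H^2_*\cap H^3(0,L): v_{xx}(L)=0\}$, $w_t\in L^\infty(0,T;H^2_* )$, and the right derivative $\frac{d^+}{dt^+}w_t$ is right-continuous and $L^\infty(0,T)$ with values in $H^1_*$. Dynamical system: for $\alpha>0$ the problem is semigroup well-posed, and $\mathcal S(t)$ denotes the resulting (nonlinear) semigroup of locally Lipschitz operators on $\mathscr H_\alpha$: for each $y_0=(w_0,w_1)\in\mathscr H_\alpha$, $\mathcal S(t)y_0=(w(t),w_t(t))$ belongs to $C([0,T];\mathscr H_\alpha)$, is a weak solution, and is a $C([0,T];\mathscr H_\alpha)$ limit of strong solutions, for every $T>0$; it is unique and depends continuously on $y_0$ in $C([0,T];\mathscr H_\alpha)$. A global attractor for a dynamical system $(H,S_t)$ on a complete metric space $H$ is a closed, bounded set $A\subset H$ which is fully invariant ($S_tA=A$ for all $t>0$) and uniformly attracting: for every bounded $B\subset H$, $\lim_{t\to+\infty}d_H\{S_tB\,|\,A\}=0$, where $d_H\{X|Y\}=\sup_{x\in X}\operatorname{dist}(x,Y)$ is the Hausdorff semidistance. *)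

theory Defs
  imports "HOL-Analysis.Analysis"
begin

text \<open>
  The base space is the interval \<open>(0,L)\<close> and the time horizon \<open>(0,T)\<close>, both with Lebesgue
  measure. As \<open>L\<close> is a variable, function spaces are sets of functions \<open>real \<Rightarrow> real\<close> (with a norm
  passed as an argument where one is needed), not types.
\<close>

section \<open>Distributional derivatives and Sobolev spaces\<close>

definition test_functions :: "real \<Rightarrow> real \<Rightarrow> (real \<Rightarrow> real) set" where
  "test_functions a b =
     {\<theta>. (\<forall>n x. ((deriv ^^ n) \<theta>) differentiable (at x)) \<and>
          compact (closure {x. \<theta> x \<noteq> 0}) \<and> closure {x. \<theta> x \<noteq> 0} \<subseteq> {a<..<b}}"

definition locally_integrable :: "real \<Rightarrow> real \<Rightarrow> (real \<Rightarrow> real) \<Rightarrow> bool" where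
  "locally_integrable a b f \<longleftrightarrow> (\<forall>K. compact K \<and> K \<subseteq> {a<..<b} \<longrightarrow> integrable (lebesgue_on K) f)"

text \<open>\<open>weak_deriv a b f g\<close>: \<open>f' = g\<close> in the sense of distributions on \<open>(a,b)\<close>.\<close>

definition weak_deriv :: "real \<Rightarrow> real \<Rightarrow> (real \<Rightarrow> real) \<Rightarrow> (real \<Rightarrow> real) \<Rightarrow> bool" where
  "weak_deriv a b f g \<longleftrightarrow> locally_integrable a b f \<and> locally_integrable a b g \<and>
     (\<forall>\<theta>\<in>test_functions a b.
        (LINT x|lebesgue_on {a<..<b}. f x * deriv \<theta> x) = - (LINT x|lebesgue_on {a<..<b}. g x * \<theta> x))"

definition L2 :: "real \<Rightarrow> (real \<Rightarrow> real) set" where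
  "L2 L = {f. f \<in> borel_measurable (lebesgue_on {0<..<L}) \<and>
              integrable (lebesgue_on {0<..<L}) (\<lambda>x. (f x)\<^sup>2)}"

definition L2_inner :: "real \<Rightarrow> (real \<Rightarrow> real) \<Rightarrow> (real \<Rightarrow> real) \<Rightarrow> real" where
  "L2_inner L f g = (LINT x|lebesgue_on {0<..<L}. f x * g x)"

definition L2_norm :: "real \<Rightarrow> (real \<Rightarrow> real) \<Rightarrow> real" where
  "L2_norm L f = sqrt (L2_inner L f f)"

text \<open>\<open>H^k(0,L)\<close>, by recursion on \<open>k\<close>; membership is invariant under a.e. modification.\<close>

primrec sobolev_H :: "real \<Rightarrow> nat \<Rightarrow> (real \<Rightarrow> real) set" where
  "sobolev_H L 0 = L2 L"
| "sobolev_H L (Suc k) = {f \<in> L2 L. \<exists>g\<in>sobolev_H L k. weak_deriv 0 L f g}"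

text \<open>A representative of the weak derivative, which is determined only almost everywhere.\<close>

definition dx :: "real \<Rightarrow> (real \<Rightarrow> real) \<Rightarrow> (real \<Rightarrow> real)" where
  "dx L f = (SOME g. weak_deriv 0 L f g)"

definition sobolev_norm :: "real \<Rightarrow> nat \<Rightarrow> (real \<Rightarrow> real) \<Rightarrow> real" where
  "sobolev_norm L k f = sqrt (\<Sum>i\<le>k. (L2_norm L ((dx L ^^ i) f))\<^sup>2)"

text \<open>
  The representative of a class in \<open>H^1(0,L)\<close> that is continuous on \<open>[0,L]\<close>, extended by \<open>0\<close>
  outside \<open>[0,L]\<close> to make it unique; boundary values are the values of this representative.
\<close>

definition cont_rep :: "real \<Rightarrow> (real \<Rightarrow> real) \<Rightarrow> (real \<Rightarrow> real)" where
  "cont_rep L f = (THE g. continuous_on {0..L} g \<and> (\<forall>x. x \<notin> {0..L} \<longrightarrow> g x = 0) \<and>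
                          (AE x in lebesgue_on {0<..<L}. f x = g x))"

text \<open>
  Elements of the following three spaces are identified with their continuous representatives, so
  that elements equal almost everywhere are equal and the phase space is a genuine metric space.
\<close>

definition H1_star :: "real \<Rightarrow> (real \<Rightarrow> real) set" where
  "H1_star L = {v \<in> sobolev_H L 1. cont_rep L v = v \<and> v 0 = 0}"

definition H2_star :: "real \<Rightarrow> (real \<Rightarrow> real) set" where
  "H2_star L = {v \<in> sobolev_H L 2. cont_rep L v = v \<and> v 0 = 0 \<and> cont_rep L (dx L v) 0 = 0}"

definition W_space :: "real \<Rightarrow> (real \<Rightarrow> real) set" where
  "W_space L = {v \<in> H2_star L \<inter> sobolev_H L 3. cont_rep L (dx L (dx L v)) L = 0}"

definition H2_star_inner :: "real \<Rightarrow> real \<Rightarrow> (real \<Rightarrow> real) \<Rightarrow> (real \<Rightarrow> real) \<Rightarrow> real" where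
  "H2_star_inner L D v w = D * L2_inner L (dx L (dx L v)) (dx L (dx L w))"

definition H2_star_norm :: "real \<Rightarrow> real \<Rightarrow> (real \<Rightarrow> real) \<Rightarrow> real" where
  "H2_star_norm L D v = sqrt (H2_star_inner L D v v)"

text \<open>\<open>L_\<alpha>\<close> is \<open>H1_star\<close> with this norm.\<close>

definition L_alpha_norm :: "real \<Rightarrow> real \<Rightarrow> (real \<Rightarrow> real) \<Rightarrow> real" where
  "L_alpha_norm L \<alpha> v = sqrt (\<alpha> * (L2_norm L (dx L v))\<^sup>2 + (L2_norm L v)\<^sup>2)"

type_synonym state = "(real \<Rightarrow> real) \<times> (real \<Rightarrow> real)"

definition phase_space :: "real \<Rightarrow> state set" where
  "phase_space L = H2_star L \<times> H1_star L"

definition phase_norm :: "real \<Rightarrow> real \<Rightarrow> real \<Rightarrow> state \<Rightarrow> real" where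
  "phase_norm L D \<alpha> y =
     sqrt (D * (L2_norm L (dx L (dx L (fst y))))\<^sup>2 + \<alpha> * (L2_norm L (dx L (snd y)))\<^sup>2
           + (L2_norm L (snd y))\<^sup>2)"

definition phase_dist :: "real \<Rightarrow> real \<Rightarrow> real \<Rightarrow> state \<Rightarrow> state \<Rightarrow> real" where
  "phase_dist L D \<alpha> y z = phase_norm L D \<alpha> (\<lambda>x. fst y x - fst z x, \<lambda>x. snd y x - snd z x)"


section \<open>Vector-valued functions of time\<close>

text \<open>
  \<open>X\<close> is a linear space of functions and \<open>N\<close> its norm (a seminorm on functions if elements of \<open>X\<close>
  are only determined almost everywhere). The notions mirror the library's Bochner integral, which
  is available only for Banach spaces that are types.
\<close>

definition simple_fun ::
    "real \<Rightarrow> (real \<Rightarrow> real) set \<Rightarrow> (real \<Rightarrow> real \<Rightarrow> real) \<Rightarrow> bool" where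
  "simple_fun T X s \<longleftrightarrow> simple_function (lebesgue_on {0<..<T}) s \<and> s ` {0<..<T} \<subseteq> X"

definition simple_integral :: "real \<Rightarrow> (real \<Rightarrow> real \<Rightarrow> real) \<Rightarrow> (real \<Rightarrow> real)" where
  "simple_integral T s =
     (\<lambda>x. \<Sum>y\<in>s ` {0<..<T}. measure lebesgue {t \<in> {0<..<T}. s t = y} * y x)"

definition strongly_measurable ::
    "real \<Rightarrow> (real \<Rightarrow> real) set \<Rightarrow> ((real \<Rightarrow> real) \<Rightarrow> real) \<Rightarrow> (real \<Rightarrow> real \<Rightarrow> real) \<Rightarrow> bool" where
  "strongly_measurable T X N u \<longleftrightarrow>
     (AE t in lebesgue_on {0<..<T}. u t \<in> X) \<and>
     (\<exists>s. (\<forall>n. simple_fun T X (s n)) \<and>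
          (AE t in lebesgue_on {0<..<T}. (\<lambda>n. N (\<lambda>x. u t x - s n t x)) \<longlonglongrightarrow> 0))"

definition bochner_integral_is ::
    "real \<Rightarrow> (real \<Rightarrow> real) set \<Rightarrow> ((real \<Rightarrow> real) \<Rightarrow> real) \<Rightarrow> (real \<Rightarrow> real \<Rightarrow> real)
      \<Rightarrow> (real \<Rightarrow> real) \<Rightarrow> bool" where
  "bochner_integral_is T X N u I \<longleftrightarrow> strongly_measurable T X N u \<and> I \<in> X \<and>
     (\<exists>s. (\<forall>n. simple_fun T X (s n)) \<and>
          (\<lambda>n. \<integral>\<^sup>+ t. ennreal (N (\<lambda>x. u t x - s n t x)) \<partial>lebesgue_on {0<..<T}) \<longlonglongrightarrow> 0 \<and>
          (\<lambda>n. N (\<lambda>x. simple_integral T (s n) x - I x)) \<longlonglongrightarrow> 0)"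

definition Linf_in ::
    "real \<Rightarrow> (real \<Rightarrow> real) set \<Rightarrow> ((real \<Rightarrow> real) \<Rightarrow> real) \<Rightarrow> (real \<Rightarrow> real \<Rightarrow> real) \<Rightarrow> bool" where
  "Linf_in T X N u \<longleftrightarrow> strongly_measurable T X N u \<and>
     (\<exists>C. AE t in lebesgue_on {0<..<T}. N (u t) \<le> C)"

definition L2_in ::
    "real \<Rightarrow> (real \<Rightarrow> real) set \<Rightarrow> ((real \<Rightarrow> real) \<Rightarrow> real) \<Rightarrow> (real \<Rightarrow> real \<Rightarrow> real) \<Rightarrow> bool" where
  "L2_in T X N u \<longleftrightarrow> strongly_measurable T X N u \<and>
     (\<integral>\<^sup>+ t. ennreal ((N (u t))\<^sup>2) \<partial>lebesgue_on {0<..<T}) < \<infinity>"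

text \<open>\<open>u \<in> H^1(0,T;X)\<close> with weak time derivative \<open>u'\<close>.\<close>

definition H1_in_with_deriv ::
    "real \<Rightarrow> (real \<Rightarrow> real) set \<Rightarrow> ((real \<Rightarrow> real) \<Rightarrow> real) \<Rightarrow> (real \<Rightarrow> real \<Rightarrow> real)
      \<Rightarrow> (real \<Rightarrow> real \<Rightarrow> real) \<Rightarrow> bool" where
  "H1_in_with_deriv T X N u u' \<longleftrightarrow> L2_in T X N u \<and> L2_in T X N u' \<and>
     (\<forall>\<theta>\<in>test_functions 0 T. \<exists>I.
        bochner_integral_is T X N (\<lambda>t x. deriv \<theta> t * u t x) I \<and>
        bochner_integral_is T X N (\<lambda>t x. - (\<theta> t * u' t x)) I)"

definition bounded_functional ::
    "(real \<Rightarrow> real) set \<Rightarrow> ((real \<Rightarrow> real) \<Rightarrow> real) \<Rightarrow> ((real \<Rightarrow> real) \<Rightarrow> real) \<Rightarrow> bool" where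
  "bounded_functional X N F \<longleftrightarrow>
     (\<forall>u\<in>X. \<forall>v\<in>X. \<forall>a b. F (\<lambda>x. a * u x + b * v x) = a * F u + b * F v) \<and>
     (\<exists>C. \<forall>u\<in>X. \<bar>F u\<bar> \<le> C * N u)"

text \<open>\<open>u \<in> C_w([0,T];X)\<close>.\<close>

definition weakly_continuous ::
    "real \<Rightarrow> (real \<Rightarrow> real) set \<Rightarrow> ((real \<Rightarrow> real) \<Rightarrow> real) \<Rightarrow> (real \<Rightarrow> real \<Rightarrow> real) \<Rightarrow> bool" where
  "weakly_continuous T X N u \<longleftrightarrow> (\<forall>t\<in>{0..T}. u t \<in> X) \<and>
     (\<forall>F. bounded_functional X N F \<longrightarrow> continuous_on {0..T} (\<lambda>t. F (u t)))"


section \<open>Solutions of the beam problem\<close>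

text \<open>
  \<open>v\<close> is the time derivative \<open>w_t\<close>, in its weakly continuous representative. The variational
  identity is written as \<open>d/dt [...] = right-hand side - remaining terms\<close> in the sense of
  distributions on \<open>(0,T)\<close>.
\<close>

definition weak_solution ::
    "real \<Rightarrow> real \<Rightarrow> real \<Rightarrow> real \<Rightarrow> (real \<Rightarrow> real) \<Rightarrow> real \<Rightarrow> real \<Rightarrow> real \<Rightarrow> real \<Rightarrow> real
      \<Rightarrow> state \<Rightarrow> (real \<Rightarrow> real \<Rightarrow> real) \<Rightarrow> (real \<Rightarrow> real \<Rightarrow> real) \<Rightarrow> bool" where
  "weak_solution L D b1 b2 p0 U \<beta> \<alpha> k0 T y0 w v \<longleftrightarrow>
     H1_in_with_deriv T (L2 L) (L2_norm L) w v \<and>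
     Linf_in T (H2_star L) (H2_star_norm L D) w \<and>
     weakly_continuous T (H2_star L) (H2_star_norm L D) w \<and>
     Linf_in T (H1_star L) (L_alpha_norm L \<alpha>) v \<and>
     weakly_continuous T (H1_star L) (L_alpha_norm L \<alpha>) v \<and>
     (\<forall>\<phi>\<in>H2_star L.
        weak_deriv 0 T
          (\<lambda>t. L2_inner L (v t) \<phi> + \<alpha> * L2_inner L (dx L (v t)) (dx L \<phi>))
          (\<lambda>t. (L2_inner L p0 \<phi> - \<beta> * L2_inner L (v t) \<phi> - \<beta> * U * L2_inner L (dx L (w t)) \<phi>)
               - (H2_star_inner L D (w t) \<phi>
                  + (b2 * (L2_norm L (dx L (w t)))\<^sup>2 - b1) * L2_inner L (dx L (w t)) (dx L \<phi>)
                  + k0 * L2_inner L (v t) \<phi>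
                  + \<alpha> * k0 * L2_inner L (dx L (v t)) (dx L \<phi>)))) \<and>
     (\<forall>\<eta>\<in>H2_star L.
        ((\<lambda>t. H2_star_inner L D (w t) \<eta>) \<longlongrightarrow> H2_star_inner L D (fst y0) \<eta>) (at_right 0)) \<and>
     (\<forall>\<psi>\<in>L2 L. ((\<lambda>t. L2_inner L (v t) \<psi>) \<longlongrightarrow> L2_inner L (snd y0) \<psi>) (at_right 0))"

text \<open>
  \<open>a\<close> is the right derivative of \<open>w_t\<close>. The norm \<open>L_alpha_norm\<close> (for \<open>\<alpha> > 0\<close>) induces the usual
  topology of \<open>H1_star\<close>; the norm of \<open>W_space\<close> is that of \<open>H^3(0,L)\<close>.
\<close>

definition strong_solution ::
    "real \<Rightarrow> real \<Rightarrow> real \<Rightarrow> real \<Rightarrow> (real \<Rightarrow> real) \<Rightarrow> real \<Rightarrow> real \<Rightarrow> real \<Rightarrow> real \<Rightarrow> real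
      \<Rightarrow> state \<Rightarrow> (real \<Rightarrow> real \<Rightarrow> real) \<Rightarrow> (real \<Rightarrow> real \<Rightarrow> real) \<Rightarrow> bool" where
  "strong_solution L D b1 b2 p0 U \<beta> \<alpha> k0 T y0 w v \<longleftrightarrow>
     weak_solution L D b1 b2 p0 U \<beta> \<alpha> k0 T y0 w v \<and>
     Linf_in T (W_space L) (sobolev_norm L 3) w \<and>
     Linf_in T (H2_star L) (H2_star_norm L D) v \<and>
     (\<exists>a. (\<forall>t\<in>{0..<T}. a t \<in> H1_star L \<and>
             ((\<lambda>h. L_alpha_norm L \<alpha> (\<lambda>x. (v (t + h) x - v t x) / h - a t x)) \<longlongrightarrow> 0) (at_right 0) \<and>
             ((\<lambda>s. L_alpha_norm L \<alpha> (\<lambda>x. a s x - a t x)) \<longlongrightarrow> 0) (at_right t)) \<and>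
          Linf_in T (H1_star L) (L_alpha_norm L \<alpha>) a)"

definition continuous_in_phase_space ::
    "real \<Rightarrow> real \<Rightarrow> real \<Rightarrow> real \<Rightarrow> (real \<Rightarrow> state) \<Rightarrow> bool" where
  "continuous_in_phase_space L D \<alpha> T y \<longleftrightarrow>
     continuous_map (top_of_set {0..T})
       (Metric_space.mtopology (phase_space L) (phase_dist L D \<alpha>)) y"

text \<open>
  The solutions provided by the semigroup: continuous weak solutions that are limits in
  \<open>C([0,T]; phase space)\<close> of strong solutions (with their own initial data).
\<close>

definition generalized_solution ::
    "real \<Rightarrow> real \<Rightarrow> real \<Rightarrow> real \<Rightarrow> (real \<Rightarrow> real) \<Rightarrow> real \<Rightarrow> real \<Rightarrow> real \<Rightarrow> real \<Rightarrow> real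
      \<Rightarrow> state \<Rightarrow> (real \<Rightarrow> state) \<Rightarrow> bool" where
  "generalized_solution L D b1 b2 p0 U \<beta> \<alpha> k0 T y0 y \<longleftrightarrow>
     continuous_in_phase_space L D \<alpha> T y \<and>
     weak_solution L D b1 b2 p0 U \<beta> \<alpha> k0 T y0 (\<lambda>t. fst (y t)) (\<lambda>t. snd (y t)) \<and>
     (\<exists>z z0. (\<forall>n. z0 n \<in> phase_space L \<and>
                 continuous_in_phase_space L D \<alpha> T (z n) \<and>
                 strong_solution L D b1 b2 p0 U \<beta> \<alpha> k0 T (z0 n)
                   (\<lambda>t. fst (z n t)) (\<lambda>t. snd (z n t))) \<and>
             (\<forall>\<epsilon>>0. \<forall>\<^sub>F n in sequentially. \<forall>t\<in>{0..T}. phase_dist L D \<alpha> (z n t) (y t) < \<epsilon>))"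

definition locally_Lipschitz_op :: "'a set \<Rightarrow> ('a \<Rightarrow> 'a \<Rightarrow> real) \<Rightarrow> ('a \<Rightarrow> 'a) \<Rightarrow> bool" where
  "locally_Lipschitz_op M d F \<longleftrightarrow>
     (\<forall>y\<in>M. \<exists>r>0. \<exists>C. \<forall>z1\<in>M. \<forall>z2\<in>M. d y z1 < r \<and> d y z2 < r \<longrightarrow> d (F z1) (F z2) \<le> C * d z1 z2)"

definition semigroup_on :: "'a set \<Rightarrow> (real \<Rightarrow> 'a \<Rightarrow> 'a) \<Rightarrow> bool" where
  "semigroup_on M S \<longleftrightarrow>
     (\<forall>t\<ge>0. S t ` M \<subseteq> M) \<and> (\<forall>y\<in>M. S 0 y = y) \<and>
     (\<forall>s\<ge>0. \<forall>t\<ge>0. \<forall>y\<in>M. S (s + t) y = S s (S t y))"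

text \<open>\<open>S\<close> is the semigroup on the phase space generated by the beam problem.\<close>

definition beam_dynamical_system ::
    "real \<Rightarrow> real \<Rightarrow> real \<Rightarrow> real \<Rightarrow> (real \<Rightarrow> real) \<Rightarrow> real \<Rightarrow> real \<Rightarrow> real \<Rightarrow> real
      \<Rightarrow> (real \<Rightarrow> state \<Rightarrow> state) \<Rightarrow> bool" where
  "beam_dynamical_system L D b1 b2 p0 U \<beta> \<alpha> k0 S \<longleftrightarrow>
     semigroup_on (phase_space L) S \<and>
     (\<forall>t\<ge>0. locally_Lipschitz_op (phase_space L) (phase_dist L D \<alpha>) (S t)) \<and>
     (\<forall>T>0. \<forall>y0\<in>phase_space L.
        generalized_solution L D b1 b2 p0 U \<beta> \<alpha> k0 T y0 (\<lambda>t. S t y0) \<and>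
        (\<forall>y. generalized_solution L D b1 b2 p0 U \<beta> \<alpha> k0 T y0 y \<longrightarrow> (\<forall>t\<in>{0..T}. y t = S t y0)) \<and>
        (\<forall>\<epsilon>>0. \<exists>\<delta>>0. \<forall>z0\<in>phase_space L. phase_dist L D \<alpha> y0 z0 < \<delta> \<longrightarrow>
           (\<forall>t\<in>{0..T}. phase_dist L D \<alpha> (S t y0) (S t z0) < \<epsilon>)))"


section \<open>Global attractors\<close>

text \<open>In \<open>ennreal\<close> the supremum over the empty set is \<open>0\<close> and the distance to it is \<open>\<infinity>\<close>.\<close>

definition hausdorff_semidist :: "('a \<Rightarrow> 'a \<Rightarrow> real) \<Rightarrow> 'a set \<Rightarrow> 'a set \<Rightarrow> ennreal" where
  "hausdorff_semidist d X Y = (SUP x\<in>X. INF y\<in>Y. ennreal (d x y))"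

definition global_attractor ::
    "'a set \<Rightarrow> ('a \<Rightarrow> 'a \<Rightarrow> real) \<Rightarrow> (real \<Rightarrow> 'a \<Rightarrow> 'a) \<Rightarrow> 'a set \<Rightarrow> bool" where
  "global_attractor M d S A \<longleftrightarrow>
     A \<subseteq> M \<and> closedin (Metric_space.mtopology M d) A \<and> Metric_space.mbounded M d A \<and>
     (\<forall>t>0. S t ` A = A) \<and>
     (\<forall>B\<subseteq>M. Metric_space.mbounded M d B \<longrightarrow>
        ((\<lambda>t. hausdorff_semidist d (S t ` B) A) \<longlongrightarrow> 0) at_top)"

end

theory Submission
  imports Defs
begin

text \<open>
  Put \<open>p = w_xx\<close>, \<open>q = v_x\<close> and let \<open>J\<close> be integration from the clamped end, a compact operator on
  \<open>L^2(0,L)\<close>. Then \<open>w_x = J p\<close>, \<open>w = J (J p)\<close>, \<open>v = J q\<close>, and the phase space becomes a closed subspace of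
  a product of \<open>L^2\<close> spaces. Averaging in time yields the energy identity for every weak solution that
  is continuous in the phase space, so strong solutions are not needed. The energy plus \<open>k0/4\<close> times the
  pairing \<open>(v, w)\<close> is a Lyapunov function: its quartic term in \<open>w_x\<close> absorbs the non-conservative term
  \<open>\<beta> U w_x\<close>, which gives a bounded absorbing set. For the difference of two bounded trajectories the same
  function decays exponentially up to a multiple of \<open>sup \<parallel>w_x\<parallel>\<^sup>2\<close>. Trajectories are Lipschitz
  in time for this norm and \<open>J\<close> is compact, so by an Ascoli argument the image of the absorbing set after a
  long time is covered by finitely many sets of small diameter. This forces a compact global attractor.
\<close>

text \<open>The estimates look for no smoothing by a single map S(T): compactness comes from lower
  order terms alone, which is why every remainder is expressed through \<open>norm (J p)\<close>,
  the norm of w_x. The second obstacle is regularity. Admissible test functions lie in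
  \<open>H2_star\<close>, whereas the velocity is only in \<open>H1_star\<close>, so the equation
  cannot be tested with it directly. A time mean of the velocity is a difference quotient of w,
  hence admissible, and continuity in the phase space lets the mean pass to the limit. Moreover a
  weak solution satisfies w_t = v only in L^2; the injectivity of \<open>J\<close> on functions
  supported in (0,L) raises this to the slopes, where the energy argument needs it. In the
  coordinates \<open>p\<close> and \<open>q\<close> the conditions at the clamped end and the choice
  of representatives for weak derivatives disappear into \<open>J\<close>, and the remaining
  analysis takes place in an abstract Hilbert space.\<close>

section \<open>Global attractors in metric spaces\<close>

context Metric_space
begin

text \<open>Orbit points that start in \<open>B0\<close> and are observed at times tending to
  infinity eventually lie in each of the finitely covered images of \<open>B0\<close>. Such a
  sequence is totally bounded, and completeness gives a convergent subsequence. Compactness,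
  invariance and attraction of the omega-limit set \<open>A\<close> of \<open>B0\<close> are all
  read off from this.\<close>

lemma finite_small_cover_imp_compact_attractor:
  assumes complete: mcomplete and sg: "semigroup_on M S"
    and cont: "\<And>t. 0 \<le> t \<Longrightarrow> continuous_map mtopology mtopology (S t)"
    and B0: "B0 \<subseteq> M"
    and absorb: "\<And>B. mbounded B \<Longrightarrow> \<exists>T\<ge>0. \<forall>t\<ge>T. S t ` B \<subseteq> B0" and "mbounded B0"
    and cover: "\<And>e. 0 < e \<Longrightarrow> \<exists>T\<ge>0. \<exists>\<U>. finite \<U> \<and> S T ` B0 \<subseteq> \<Union>\<U> \<and>
                  (\<forall>V\<in>\<U>. \<forall>x\<in>V. \<forall>y\<in>V. d x y \<le> e)"
  shows "\<exists>A. global_attractor M d S A \<and> compactin mtopology A"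
proof -
  define A where "A = {x. \<exists>\<tau> \<xi>. filterlim \<tau> at_top sequentially \<and> range \<tau> \<subseteq> {0..} \<and> range \<xi> \<subseteq> B0 \<and>
       limitin mtopology (\<lambda>n. S (\<tau> n) (\<xi> n)) x sequentially}"
  have AM: "A \<subseteq> M" unfolding A_def using limitin_mspace by blast
  have SM: "S t x \<in> M" if "0 \<le> t" "x \<in> M" for t x
    using sg that unfolding semigroup_on_def by blast
  have Sadd: "S (s + t) x = S s (S t x)" if "0 \<le> s" "0 \<le> t" "x \<in> M" for s t x
    using sg that unfolding semigroup_on_def by blast
  obtain T0 where T0: "0 \<le> T0" "\<And>t. T0 \<le> t \<Longrightarrow> S t ` B0 \<subseteq> B0"
    using absorb[OF \<open>mbounded B0\<close>] by blast
  \<comment> \<open>Asymptotic compactness. The limit is returned as a point of \<open>A\<close>, as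
    the three parts below need it.\<close>
  have AC: "\<exists>r x. strict_mono r \<and> x \<in> A \<and> limitin mtopology (\<lambda>n. S (\<tau> (r n)) (\<xi> (r n))) x sequentially"
    if \<tau>: "filterlim \<tau> at_top sequentially" "range \<tau> \<subseteq> {0..}" and \<xi>: "range \<xi> \<subseteq> B0" for \<tau> :: "nat \<Rightarrow> real" and \<xi>
  proof -
    define \<sigma> where "\<sigma> n = S (\<tau> n) (\<xi> n)" for n
    have \<sigma>M: "range \<sigma> \<subseteq> M" using SM \<tau>(2) \<xi> B0 by (auto simp: \<sigma>_def subset_eq)
    have "mtotally_bounded (range \<sigma>)"
      unfolding mtotally_bounded_def
    proof (intro allI impI)
      fix e :: real assume "0 < e"
      then obtain T \<U> where T: "0 \<le> T" and \<U>: "finite \<U>" "S T ` B0 \<subseteq> \<Union>\<U>"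
        and small: "\<And>V x y. V \<in> \<U> \<Longrightarrow> x \<in> V \<Longrightarrow> y \<in> V \<Longrightarrow> d x y \<le> e/2"
        using cover[of "e/2"] by auto
      have "\<forall>\<^sub>F n in sequentially. T + T0 \<le> \<tau> n"
        using \<tau>(1) by (simp add: filterlim_at_top)
      then obtain n0 where n0: "\<And>n. n0 \<le> n \<Longrightarrow> T + T0 \<le> \<tau> n"
        by (auto simp: eventually_sequentially)
      have late: "\<sigma> n \<in> \<Union>\<U>" if "n0 \<le> n" for n
      proof -
        \<comment> \<open>Undoing the last \<open>T\<close> units of time leaves a time of at least
          \<open>T0\<close>, at which the orbit is already in \<open>B0\<close>.\<close>
        have "S (\<tau> n - T) (\<xi> n) \<in> B0" using T0(2)[of "\<tau> n - T"] n0[OF that] \<xi> by (force simp: image_subset_iff)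
        moreover have "\<sigma> n = S T (S (\<tau> n - T) (\<xi> n))"
          using Sadd[of T "\<tau> n - T" "\<xi> n"] n0[OF that] T T0(1) \<xi> B0 by (auto simp: \<sigma>_def subset_eq)
        ultimately show ?thesis using \<U>(2) by auto
      qed
      \<comment> \<open>\<open>mtotally_bounded\<close> wants the centres in the sequence itself, so
        each cell that is met is represented by one of its points; \<open>e/2\<close> turns the
        bound for cells into a strict one.\<close>
      define pick where "pick V = (SOME x. x \<in> V \<inter> range \<sigma>)" for V
      have pick: "pick V \<in> V \<inter> range \<sigma>" if "V \<inter> range \<sigma> \<noteq> {}" for V
        unfolding pick_def using that by (rule some_in_eq[THEN iffD2])
      define K where "K = \<sigma> ` {..<n0} \<union> pick ` {V \<in> \<U>. V \<inter> range \<sigma> \<noteq> {}}"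
      have "finite K" using \<U>(1) by (simp add: K_def)
      moreover have "K \<subseteq> range \<sigma>" using pick by (auto simp: K_def)
      moreover have "range \<sigma> \<subseteq> (\<Union>x\<in>K. mball x e)"
      proof clarify
        fix n
        show "\<sigma> n \<in> (\<Union>x\<in>K. mball x e)"
        proof (cases "n < n0")
          case True
          then have "\<sigma> n \<in> K" by (auto simp: K_def)
          moreover have "\<sigma> n \<in> mball (\<sigma> n) e" using \<sigma>M \<open>0 < e\<close> by (intro centre_in_mball_iff[THEN iffD2]) auto
          ultimately show ?thesis by blast
        next
          case False
          then obtain V where V: "V \<in> \<U>" "\<sigma> n \<in> V" using late[of n] by auto
          then have "V \<inter> range \<sigma> \<noteq> {}" by auto
          with V pick have "pick V \<in> K" "d (pick V) (\<sigma> n) \<le> e/2" "pick V \<in> range \<sigma>"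
            using small[of V "pick V" "\<sigma> n"] by (auto simp: K_def)
          moreover from this have "\<sigma> n \<in> mball (pick V) e"
            using \<sigma>M \<open>0 < e\<close> unfolding in_mball by (intro conjI) (blast, blast, linarith)
          ultimately show ?thesis by blast
        qed
      qed
      ultimately show "\<exists>K. finite K \<and> K \<subseteq> range \<sigma> \<and> range \<sigma> \<subseteq> (\<Union>x\<in>K. mball x e)" by blast
    qed
    then obtain r where r: "strict_mono r" "MCauchy (\<sigma> \<circ> r)"
      unfolding mtotally_bounded_sequentially by blast
    then obtain x where x: "limitin mtopology (\<sigma> \<circ> r) x sequentially"
      using complete unfolding mcomplete_def by blast
    have "filterlim (\<tau> \<circ> r) at_top sequentially"
      using filterlim_compose[OF \<tau>(1) filterlim_subseq[OF r(1)]] by (simp add: o_def)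
    then have "x \<in> A" unfolding A_def using x \<tau>(2) \<xi>
      by (intro CollectI exI[of _ "\<tau> \<circ> r"] exI[of _ "\<xi> \<circ> r"]) (auto simp: \<sigma>_def o_def)
    then show ?thesis using r(1) x by (auto simp: \<sigma>_def o_def)
  qed
  have "compactin mtopology A"
    unfolding compactin_sequentially
  proof (intro conjI AM allI impI)
    fix a :: "nat \<Rightarrow> 'a" assume a: "range a \<subseteq> A"
    \<comment> \<open>The limit point \<open>a n\<close> is replaced by an orbit point at a time of
      at least \<open>n\<close> and a distance below 1/(n+1), so that \<open>AC\<close> applies to a
      diagonal sequence.\<close>
    have "\<exists>t x. real n \<le> t \<and> x \<in> B0 \<and> d (S t x) (a n) < 1 / real (Suc n)" for n
    proof -
      have "a n \<in> A" using a by auto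
      then obtain \<tau> \<xi> where \<tau>: "filterlim \<tau> at_top sequentially" and \<xi>: "range \<xi> \<subseteq> B0"
        and lim: "limitin mtopology (\<lambda>n. S (\<tau> n) (\<xi> n)) (a n) sequentially"
        unfolding A_def by blast
      have "\<forall>\<^sub>F k in sequentially. real n \<le> \<tau> k" using \<tau> by (simp add: filterlim_at_top)
      moreover have "\<forall>\<^sub>F k in sequentially. S (\<tau> k) (\<xi> k) \<in> M \<and> d (S (\<tau> k) (\<xi> k)) (a n) < 1 / real (Suc n)"
        using lim unfolding limitin_metric by (meson divide_pos_pos of_nat_0_less_iff zero_less_Suc zero_less_one)
      ultimately have "\<forall>\<^sub>F k in sequentially. real n \<le> \<tau> k \<and> d (S (\<tau> k) (\<xi> k)) (a n) < 1 / real (Suc n)"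
        by eventually_elim auto
      then obtain k where "real n \<le> \<tau> k" "d (S (\<tau> k) (\<xi> k)) (a n) < 1 / real (Suc n)"
        by (auto simp: eventually_sequentially)
      then show ?thesis using \<xi> by blast
    qed
    then obtain \<tau> \<xi> where \<tau>: "\<And>n. real n \<le> \<tau> n" and \<xi>: "\<And>n. \<xi> n \<in> B0"
      and close: "\<And>n. d (S (\<tau> n) (\<xi> n)) (a n) < 1 / real (Suc n)" by metis
    have "filterlim \<tau> at_top sequentially"
      by (rule filterlim_at_top_mono[OF filterlim_real_sequentially]) (simp add: \<tau>)
    moreover have \<tau>0: "0 \<le> \<tau> n" for n using \<tau>[of n] by (meson of_nat_0_le_iff order_trans)
    ultimately obtain r x where r: "strict_mono r" and x: "x \<in> A"
      and lim: "limitin mtopology (\<lambda>n. S (\<tau> (r n)) (\<xi> (r n))) x sequentially"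
      using AC[of \<tau> \<xi>] \<xi> by auto
    have "limitin mtopology (a \<circ> r) x sequentially"
      unfolding limitin_metric
    proof (intro conjI allI impI)
      show "x \<in> M" using x AM by auto
      fix e :: real assume e: "0 < e"
      have "(\<lambda>n. 1 / real (Suc (r n))) \<longlonglongrightarrow> 0"
        using LIMSEQ_subseq_LIMSEQ[OF LIMSEQ_Suc[OF lim_1_over_n[where 'a=real]] r] by (simp add: o_def)
      then have "\<forall>\<^sub>F n in sequentially. 1 / real (Suc (r n)) < e/2"
        by (rule order_tendstoD) (use e in simp)
      moreover have "\<forall>\<^sub>F n in sequentially. S (\<tau> (r n)) (\<xi> (r n)) \<in> M \<and> d (S (\<tau> (r n)) (\<xi> (r n))) x < e/2"
        using lim e unfolding limitin_metric by (meson half_gt_zero)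
      ultimately show "\<forall>\<^sub>F n in sequentially. (a \<circ> r) n \<in> M \<and> d ((a \<circ> r) n) x < e"
      proof eventually_elim
        case (elim n)
        have aM: "a (r n) \<in> M" using a AM by auto
        have "d (a (r n)) x \<le> d (a (r n)) (S (\<tau> (r n)) (\<xi> (r n))) + d (S (\<tau> (r n)) (\<xi> (r n))) x"
          using triangle aM elim \<open>x \<in> M\<close> by blast
        then show ?case using elim close[of "r n"] aM by (simp add: commute)
      qed
    qed
    then show "\<exists>l r. l \<in> A \<and> strict_mono r \<and> limitin mtopology (a \<circ> r) l sequentially"
      using r x by blast
  qed
  moreover have "S t ` A = A" if t: "0 < t" for t
  proof
    have St: "limitin mtopology (\<lambda>n. S t (f n)) (S t x) sequentially"
      if "limitin mtopology f x sequentially" for f x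
      using continuous_map_limit[OF cont that] t by (simp add: o_def)
    show "S t ` A \<subseteq> A"
    proof clarify
      fix x assume "x \<in> A"
      then obtain \<tau> \<xi> where \<tau>: "filterlim \<tau> at_top sequentially" "range \<tau> \<subseteq> {0..}" and \<xi>: "range \<xi> \<subseteq> B0"
        and lim: "limitin mtopology (\<lambda>n. S (\<tau> n) (\<xi> n)) x sequentially"
        unfolding A_def by blast
      have "S (t + \<tau> n) (\<xi> n) = S t (S (\<tau> n) (\<xi> n))" for n
        using Sadd[of t "\<tau> n" "\<xi> n"] t \<tau>(2) \<xi> B0 by (auto simp: subset_eq)
      then have "limitin mtopology (\<lambda>n. S (t + \<tau> n) (\<xi> n)) (S t x) sequentially"
        using St[OF lim] by simp
      moreover have "filterlim (\<lambda>n. t + \<tau> n) at_top sequentially"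
        by (rule filterlim_tendsto_add_at_top[OF tendsto_const \<tau>(1)])
      ultimately show "S t x \<in> A" unfolding A_def using \<tau>(2) \<xi> t
        by (intro CollectI exI[of _ "\<lambda>n. t + \<tau> n"] exI[of _ \<xi>]) (auto simp: subset_eq)
    qed
    show "A \<subseteq> S t ` A"
    proof
      fix x assume "x \<in> A"
      then obtain \<tau> \<xi> where \<tau>: "filterlim \<tau> at_top sequentially" "range \<tau> \<subseteq> {0..}" and \<xi>: "range \<xi> \<subseteq> B0"
        and lim: "limitin mtopology (\<lambda>n. S (\<tau> n) (\<xi> n)) x sequentially"
        unfolding A_def by blast
      \<comment> \<open>Stopping the orbits \<open>t\<close> earlier gives a sequence whose limit
        point is a preimage of \<open>x\<close>; \<open>max\<close> keeps the first few times
        nonnegative.\<close>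
      define \<tau>' where "\<tau>' n = max 0 (\<tau> n - t)" for n
      have "filterlim (\<lambda>n. - t + \<tau> n) at_top sequentially"
        by (rule filterlim_tendsto_add_at_top[OF tendsto_const \<tau>(1)])
      then have "filterlim \<tau>' at_top sequentially"
        by (rule filterlim_at_top_mono) (simp add: \<tau>'_def)
      moreover have "range \<tau>' \<subseteq> {0..}" by (auto simp: \<tau>'_def)
      ultimately obtain r y where r: "strict_mono r" and y: "y \<in> A"
        and lim': "limitin mtopology (\<lambda>n. S (\<tau>' (r n)) (\<xi> (r n))) y sequentially"
        using AC \<xi> by blast
      have "limitin mtopology (\<lambda>n. S (\<tau> (r n)) (\<xi> (r n))) (S t y) sequentially"
      proof (rule limitin_transform_eventually[OF _ St[OF lim']])
        have "filterlim (\<lambda>n. \<tau> (r n)) at_top sequentially"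
          using filterlim_compose[OF \<tau>(1) filterlim_subseq[OF r]] by simp
        then have "\<forall>\<^sub>F n in sequentially. t \<le> \<tau> (r n)" by (simp add: filterlim_at_top)
        then show "\<forall>\<^sub>F n in sequentially. S t (S (\<tau>' (r n)) (\<xi> (r n))) = S (\<tau> (r n)) (\<xi> (r n))"
        proof eventually_elim
          case (elim n)
          have "\<xi> (r n) \<in> M" using \<xi> B0 by auto
          then show ?case using Sadd[of t "\<tau>' (r n)" "\<xi> (r n)"] t elim by (simp add: \<tau>'_def)
        qed
      qed
      moreover have "limitin mtopology (\<lambda>n. S (\<tau> (r n)) (\<xi> (r n))) x sequentially"
        using limitin_subsequence[OF r lim] by (simp add: o_def)
      ultimately have "S t y = x" using limitin_metric_unique by (metis trivial_limit_sequentially)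
      then show "x \<in> S t ` A" using y by blast
    qed
  qed
  moreover have "((\<lambda>t. hausdorff_semidist d (S t ` B) A) \<longlongrightarrow> 0) at_top" if B: "mbounded B" for B
  proof -
    have BM: "B \<subseteq> M" using B mbounded_subset_mspace by blast
    obtain TB where TB: "0 \<le> TB" "\<And>t. TB \<le> t \<Longrightarrow> S t ` B \<subseteq> B0"
      using absorb[OF B] by blast
    have attr: "\<exists>T. \<forall>t\<ge>T. \<forall>x\<in>B. \<exists>a\<in>A. d (S t x) a < e" if e: "0 < e" for e
    proof (rule ccontr)
      assume "\<nexists>T. \<forall>t\<ge>T. \<forall>x\<in>B. \<exists>a\<in>A. d (S t x) a < e"
      \<comment> \<open>Points that stay away from \<open>A\<close> would form a sequence to which
        \<open>AC\<close> applies, once the first \<open>TB\<close> units of time have carried them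
        into \<open>B0\<close>.\<close>
      then have "\<forall>n. \<exists>t x. real n + TB \<le> t \<and> x \<in> B \<and> (\<forall>a\<in>A. e \<le> d (S t x) a)"
        by (meson not_le)
      then obtain \<tau> \<xi> where \<tau>: "\<And>n. real n + TB \<le> \<tau> n" and \<xi>: "\<And>n. \<xi> n \<in> B"
        and far: "\<And>n a. a \<in> A \<Longrightarrow> e \<le> d (S (\<tau> n) (\<xi> n)) a" by metis
      have \<tau>n: "real n \<le> \<tau> n - TB" for n using \<tau>[of n] by simp
      have "filterlim (\<lambda>n. \<tau> n - TB) at_top sequentially"
        by (rule filterlim_at_top_mono[OF filterlim_real_sequentially]) (simp add: \<tau>n)
      moreover have \<tau>0: "0 \<le> \<tau> n - TB" for n using \<tau>n[of n] by (meson of_nat_0_le_iff order_trans)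
      then have "range (\<lambda>n. \<tau> n - TB) \<subseteq> {0..}" by (simp only: image_subset_iff) simp
      moreover have "S TB (\<xi> n) \<in> B0" for n using TB(2)[of TB] \<xi>[of n] by (auto simp: image_subset_iff)
      ultimately obtain r x where "strict_mono r" and x: "x \<in> A"
        and lim: "limitin mtopology (\<lambda>n. S (\<tau> (r n) - TB) (S TB (\<xi> (r n)))) x sequentially"
        using AC[of "\<lambda>n. \<tau> n - TB" "\<lambda>n. S TB (\<xi> n)"] by blast
      have "S (\<tau> n - TB) (S TB (\<xi> n)) = S (\<tau> n) (\<xi> n)" for n
        using Sadd[of "\<tau> n - TB" TB "\<xi> n"] TB(1) \<tau>0[of n] \<xi>[of n] BM by auto
      then have "\<forall>\<^sub>F n in sequentially. S (\<tau> (r n)) (\<xi> (r n)) \<in> M \<and> d (S (\<tau> (r n)) (\<xi> (r n))) x < e"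
        using lim e unfolding limitin_metric by simp
      then obtain n where "d (S (\<tau> (r n)) (\<xi> (r n))) x < e" by (auto simp: eventually_sequentially)
      then show False using far[OF x, of "r n"] by simp
    qed
    have le: "\<forall>\<^sub>F t in at_top. hausdorff_semidist d (S t ` B) A \<le> ennreal e" if e: "0 < e" for e
    proof -
      obtain T where T: "\<And>t x. T \<le> t \<Longrightarrow> x \<in> B \<Longrightarrow> \<exists>a\<in>A. d (S t x) a < e"
        using attr[OF e] by blast
      have "hausdorff_semidist d (S t ` B) A \<le> ennreal e" if "T \<le> t" for t
        unfolding hausdorff_semidist_def
      proof (rule SUP_least, clarify)
        fix x assume "x \<in> B"
        then obtain a where "a \<in> A" "d (S t x) a < e" using T \<open>T \<le> t\<close> by blast
        then show "(INF y\<in>A. ennreal (d (S t x) y)) \<le> ennreal e"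
          by (intro INF_lower2[of a]) (auto intro: ennreal_leI)
      qed
      then show ?thesis by (auto simp: eventually_at_top_linorder)
    qed
    show ?thesis
    proof (rule order_tendstoI)
      fix e :: ennreal assume "0 < e"
      then obtain e' where "0 < e'" "ennreal e' < e"
      proof (cases e)
        case (real r)
        then have "0 < r" using \<open>0 < e\<close> by simp
        then show ?thesis using that[of "r/2"] real by (simp add: ennreal_lessI)
      \<comment> \<open>For infinite \<open>e\<close> any finite value lies below.\<close>
      qed (use that[of 1] in simp)
      then show "\<forall>\<^sub>F t in at_top. hausdorff_semidist d (S t ` B) A < e"
        using le[of e'] by (auto elim!: eventually_mono)
    qed simp
  qed
  ultimately show ?thesis
    unfolding global_attractor_def using AM
    by (auto intro!: exI[of _ A] compactin_imp_mbounded compactin_imp_closedin Hausdorff_space_mtopology)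
qed

end

section \<open>Energy and virial identities\<close>

text \<open>The base point is positive because the curves are only known to be continuous on the
  open half-line.\<close>

lemma antiderivative_open_interval:
  fixes f :: "real \<Rightarrow> 'a::banach"
  assumes "continuous_on {0<..} f" "0 < c"
  obtains F where "\<And>s. c < s \<Longrightarrow> (F has_vector_derivative f s) (at s)"
proof
  fix s assume s: "c < s"
  have "((\<lambda>s. integral {c..s} f) has_vector_derivative f s) (at s within {c..s+1})"
    using assms s by (intro integral_has_vector_derivative continuous_on_subset[OF assms(1)]) auto
  then show "((\<lambda>s. integral {c..s} f) has_vector_derivative f s) (at s)"
    using s by (simp add: at_within_Icc_at)
qed

text \<open>The limit is joint in the base point \<open>s\<close> and the step \<open>h\<close>;
  this uniformity near \<open>t\<close> is what allows the derivative of the averaged energy to pass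
  to the limit in \<open>energy\<close>. It rests on a mean value bound where \<open>g\<close> stays
  within \<open>e/2\<close> of \<open>g t\<close>.\<close>

lemma difference_quotient_tendsto:
  fixes f :: "real \<Rightarrow> 'a::real_normed_vector"
  assumes "\<And>s. a < s \<Longrightarrow> (f has_vector_derivative g s) (at s)" "isCont g t" "a < t"
  shows "((\<lambda>(s, h). (f (s + h) - f s) /\<^sub>R h) \<longlongrightarrow> g t) (nhds t \<times>\<^sub>F at_right 0)"
proof (rule tendstoI)
  fix e :: real assume e: "e > 0"
  obtain d where d: "d > 0" "\<And>r. \<bar>r - t\<bar> < d \<Longrightarrow> norm (g r - g t) < e/2"
    using assms(2) e unfolding continuous_at_eps_delta dist_norm real_norm_def by (meson half_gt_zero)
  \<comment> \<open>If \<open>s\<close> is within \<open>k\<close> of \<open>t\<close> and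
    \<open>h\<close> is below \<open>k\<close>, then all of \<open>[s, s+h]\<close> is within
    \<open>2 * k\<close> of \<open>t\<close>, hence inside the \<open>d\<close>-ball and to the
    right of \<open>a\<close>.\<close>
  define k where "k = min (d/2) ((t - a)/2)"
  have k: "k > 0" "2 * k \<le> d" "2 * k \<le> t - a" using d assms(3) by (auto simp: k_def min_def)
  have A: "\<forall>\<^sub>F s in nhds t. \<bar>s - t\<bar> < k"
    using k by (auto simp: eventually_nhds_metric dist_real_def)
  have B: "\<forall>\<^sub>F h in at_right 0. 0 < h \<and> h < k"
    using k eventually_at_right[of 0] by (auto simp: eventually_at_right_field)
  have "\<forall>\<^sub>F x in nhds t \<times>\<^sub>F at_right 0. \<bar>fst x - t\<bar> < k \<and> (0 < snd x \<and> snd x < k)"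
    by (rule eventually_prodI[OF A B])
  then show "\<forall>\<^sub>F x in nhds t \<times>\<^sub>F at_right 0.
     dist (case x of (s, h) \<Rightarrow> (f (s + h) - f s) /\<^sub>R h) (g t) < e"
  proof (eventually_elim)
    case (elim x)
    obtain s h where x: "x = (s, h)" by fastforce
    from elim have sh: "\<bar>s - t\<bar> < k" "0 < h" "h < k" by (auto simp: x)
    let ?S = "{t - 2 * k<..<t + 2 * k}"
    have "norm (f (s + h) - f s - ((s + h) - s) *\<^sub>R g t) \<le> norm ((s + h) - s) * (e/2)"
    proof (rule vector_differentiable_bound_linearization[of ?S])
      show "(f has_vector_derivative g r) (at r within ?S)" if "r \<in> ?S" for r
        by (rule has_vector_derivative_at_within, rule assms(1))
           (use that k in auto)
      show "norm (g r - g t) \<le> e/2" if "r \<in> ?S" for r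
        using that k by (intro less_imp_le d(2)) auto
      show "closed_segment s (s + h) \<subseteq> ?S"
        using sh by (auto simp: closed_segment_eq_real_ivl abs_less_iff)
    qed (use k in auto)
    then have "norm (f (s + h) - f s - h *\<^sub>R g t) \<le> h * (e/2)" using sh by simp
    then have "norm ((f (s + h) - f s - h *\<^sub>R g t) /\<^sub>R h) \<le> e/2"
      using sh by (simp add: divide_simps mult.commute)
    also have "(f (s + h) - f s - h *\<^sub>R g t) /\<^sub>R h = (f (s + h) - f s) /\<^sub>R h - g t"
      using sh by (simp add: algebra_simps)
    finally show ?case using e by (simp add: x dist_norm)
  qed
qed

lemma has_vector_derivative_imp_quotient:
  assumes "(f has_vector_derivative f') (at t)"
  shows "((\<lambda>s. (f s - f t) /\<^sub>R (s - t)) \<longlongrightarrow> f') (at t)"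
proof (rule Lim_null[THEN iffD2], rule tendsto_norm_zero_cancel)
  have "((\<lambda>y. norm (f y - f t - (y - t) *\<^sub>R f') / norm (y - t)) \<longlongrightarrow> 0) (at t)"
    using assms by (simp add: has_vector_derivative_def has_derivative_iff_norm)
  then show "((\<lambda>s. norm ((f s - f t) /\<^sub>R (s - t) - f')) \<longlongrightarrow> 0) (at t)"
  proof (rule Lim_transform_eventually)
    have "norm (f y - f t - (y - t) *\<^sub>R f') / norm (y - t) = norm ((f y - f t) /\<^sub>R (y - t) - f')"
      if "y \<noteq> t" for y
    proof -
      have "(f y - f t) /\<^sub>R (y - t) - f' = (f y - f t - (y - t) *\<^sub>R f') /\<^sub>R (y - t)"
        using that by (simp add: scaleR_diff_right)
      then show ?thesis by (simp add: divide_inverse mult.commute)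
    qed
    then show "\<forall>\<^sub>F y in at t. norm (f y - f t - (y - t) *\<^sub>R f') / norm (y - t) = norm ((f y - f t) /\<^sub>R (y - t) - f')"
      by (auto simp: eventually_at_filter)
  qed
qed

text \<open>A product rule for a factor \<open>k\<close> that is merely continuous: the other factor
  vanishes at \<open>t\<close>, so no derivative of \<open>k\<close> enters.\<close>

lemma has_real_derivative_diff_inner:
  fixes f k :: "real \<Rightarrow> 'a::real_inner"
  assumes "(f has_vector_derivative f') (at t)" "isCont k t"
  shows "((\<lambda>s. (f s - f t) \<bullet> k s) has_real_derivative f' \<bullet> k t) (at t)"
proof -
  have "((\<lambda>s. (f s - f t) /\<^sub>R (s - t)) \<longlongrightarrow> f') (at t)"
    by (rule has_vector_derivative_imp_quotient[OF assms(1)])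
  from tendsto_inner[OF this assms(2)[unfolded isCont_def]]
  show ?thesis
    by (simp add: has_field_derivative_iff divide_inverse mult.commute)
qed

text \<open>The forcings \<open>g1\<close>, paired with the displacement of the test function, and
  \<open>g2\<close>, paired with its slope, are left open, so that a single trajectory and the
  difference of two are both instances.\<close>

locale energy_setting =
  fixes J :: "'a::{real_inner,banach} \<Rightarrow> 'a" and \<alpha> D :: real
    and p q g1 g2 :: "real \<Rightarrow> 'a"
  assumes bl: "bounded_linear J"
    and cont: "continuous_on {0<..} p" "continuous_on {0<..} q"
              "continuous_on {0<..} g1" "continuous_on {0<..} g2"
    and Jp: "\<And>t. 0 < t \<Longrightarrow> ((\<lambda>t. J (p t)) has_vector_derivative q t) (at t)"
    and eqn: "\<And>t \<phi>. 0 < t \<Longrightarrow>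
      ((\<lambda>t. J (q t) \<bullet> J (J \<phi>) + \<alpha> * (q t \<bullet> J \<phi>)) has_real_derivative
         g1 t \<bullet> J (J \<phi>) + g2 t \<bullet> J \<phi> - D * (p t \<bullet> \<phi>)) (at t)"
begin

text \<open>Integration in time removes every derivative from the identity. In this form
  \<open>\<phi>\<close> may be chosen after \<open>r\<close> and \<open>s\<close>, which is how
  \<open>p\<close> itself becomes a test function.\<close>

lemma integrated_equation:
  assumes "0 < c"
    and A: "\<And>s. c < s \<Longrightarrow> (A has_vector_derivative p s) (at s)"
    and G1: "\<And>s. c < s \<Longrightarrow> (G1 has_vector_derivative g1 s) (at s)"
    and G2: "\<And>s. c < s \<Longrightarrow> (G2 has_vector_derivative g2 s) (at s)"
    and "c < r" "c < s"
  shows "J (q s - q r) \<bullet> J (J \<phi>) + \<alpha> * ((q s - q r) \<bullet> J \<phi>)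
       = (G1 s - G1 r) \<bullet> J (J \<phi>) + (G2 s - G2 r) \<bullet> J \<phi> - D * ((A s - A r) \<bullet> \<phi>)"
proof -
  interpret J: bounded_linear J by (rule bl)
  let ?f = "\<lambda>s. (J (q s) \<bullet> J (J \<phi>) + \<alpha> * (q s \<bullet> J \<phi>)) - (G1 s \<bullet> J (J \<phi>) + G2 s \<bullet> J \<phi> - D * (A s \<bullet> \<phi>))"
  have inner: "((\<lambda>s. X s \<bullet> y) has_real_derivative x \<bullet> y) (at s)"
    if "(X has_vector_derivative x) (at s)" for X :: "real \<Rightarrow> 'a" and x y s
    using bounded_linear.has_vector_derivative[OF bounded_linear_inner_left that]
    by (simp add: has_real_derivative_iff_has_vector_derivative)
  have "(?f has_real_derivative 0) (at s)" if "s \<in> {c<..}" for s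
  proof -
    have "0 < s" "c < s" using that assms(1) by auto
    show ?thesis
      by (rule derivative_eq_intros inner A G1 G2 eqn refl \<open>0 < s\<close> \<open>c < s\<close>)+ simp
  qed
  then have "\<exists>k. \<forall>s\<in>{c<..}. ?f s = k"
    by (intro has_field_derivative_zero_constant) (auto intro: has_field_derivative_at_within)
  then have "?f s = ?f r" using assms by auto
  then show ?thesis by (simp add: J.diff inner_diff_left algebra_simps)
qed

lemma isCont_curves:
  assumes "0 < t"
  shows "isCont p t" "isCont q t" "isCont g1 t" "isCont g2 t"
  using cont assms by (auto simp: continuous_on_eq_continuous_at)

text \<open>The equation is tested with w. As \<open>p\<close> need not be differentiable, it is
  inserted as \<open>\<phi> = p s\<close> into the identity integrated from \<open>t\<close> to
  \<open>s\<close>, where \<open>p s\<close> itself multiplies only an increment that vanishes at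
  \<open>s = t\<close>.\<close>

lemma virial:
  assumes "0 < t"
  shows "((\<lambda>t. J (q t) \<bullet> J (J (p t)) + \<alpha> * (q t \<bullet> J (p t))) has_real_derivative
     g1 t \<bullet> J (J (p t)) + g2 t \<bullet> J (p t) - D * (p t \<bullet> p t) + J (q t) \<bullet> J (q t) + \<alpha> * (q t \<bullet> q t)) (at t)"
proof -
  interpret J: bounded_linear J by (rule bl)
  define c where "c = t / 2"
  have c: "0 < c" "c < t" using assms by (auto simp: c_def)
  obtain A where A: "\<And>s. c < s \<Longrightarrow> (A has_vector_derivative p s) (at s)"
    using antiderivative_open_interval[OF cont(1) c(1)] by blast
  obtain G1 where G1: "\<And>s. c < s \<Longrightarrow> (G1 has_vector_derivative g1 s) (at s)"
    using antiderivative_open_interval[OF cont(3) c(1)] by blast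
  obtain G2 where G2: "\<And>s. c < s \<Longrightarrow> (G2 has_vector_derivative g2 s) (at s)"
    using antiderivative_open_interval[OF cont(4) c(1)] by blast
  note ic = isCont_curves[OF assms]
  note id = integrated_equation[OF c(1) A G1 G2 c(2)]
  have u: "((\<lambda>s. J (p s)) has_vector_derivative q t) (at t)" by (rule Jp[OF assms])
  have Ju: "((\<lambda>s. J (J (p s))) has_vector_derivative J (q t)) (at t)"
    by (rule J.has_vector_derivative[OF u])
  have inner: "((\<lambda>s. y \<bullet> X s) has_real_derivative y \<bullet> x) (at s)"
    if "(X has_vector_derivative x) (at s)" for X :: "real \<Rightarrow> 'a" and x y s
    using bounded_linear.has_vector_derivative[OF bounded_linear_inner_right that]
    by (simp add: has_real_derivative_iff_has_vector_derivative)
  have cu: "isCont (\<lambda>s. J (p s)) t" "isCont (\<lambda>s. J (J (p s))) t"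
    by (intro J.isCont ic)+
  \<comment> \<open>For \<open>s > c\<close> this function is the pairing itself: the integrated
    identity replaces the contribution of the increment \<open>q s - q t\<close>.\<close>
  have "((\<lambda>s. (G1 s - G1 t) \<bullet> J (J (p s)) + (G2 s - G2 t) \<bullet> J (p s) - D * ((A s - A t) \<bullet> p s)
         + (J (q t) \<bullet> J (J (p s)) + \<alpha> * (q t \<bullet> J (p s)))) has_real_derivative
     g1 t \<bullet> J (J (p t)) + g2 t \<bullet> J (p t) - D * (p t \<bullet> p t) + (J (q t) \<bullet> J (q t) + \<alpha> * (q t \<bullet> q t))) (at t)"
    by (rule derivative_eq_intros refl inner u Ju has_real_derivative_diff_inner A G1 G2 c cu ic)+
       (simp add: algebra_simps)
  then have "((\<lambda>s. J (q s) \<bullet> J (J (p s)) + \<alpha> * (q s \<bullet> J (p s))) has_real_derivative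
     g1 t \<bullet> J (J (p t)) + g2 t \<bullet> J (p t) - D * (p t \<bullet> p t) + (J (q t) \<bullet> J (q t) + \<alpha> * (q t \<bullet> q t))) (at t)"
  proof (rule has_field_derivative_transform_within_open[of _ _ _ "{c<..}"])
    show "(G1 s - G1 t) \<bullet> J (J (p s)) + (G2 s - G2 t) \<bullet> J (p s) - D * ((A s - A t) \<bullet> p s)
         + (J (q t) \<bullet> J (J (p s)) + \<alpha> * (q t \<bullet> J (p s))) = J (q s) \<bullet> J (J (p s)) + \<alpha> * (q s \<bullet> J (p s))"
      if "s \<in> {c<..}" for s
      using that by (subst id[symmetric]) (simp_all add: J.diff inner_diff_left algebra_simps)
  qed (use c in auto)
  then show ?thesis by (simp add: algebra_simps)
qed

text \<open>The energy \<open>eh h\<close> of the time means is differentiable, because means of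
  continuous curves are. Its derivative converges jointly as \<open>(s, h)\<close> tends to
  \<open>(t, 0)\<close>, while \<open>eh h\<close> tends to \<open>e\<close> pointwise; the mean
  value inequality for \<open>eh h\<close> survives the limit and yields the derivative of
  \<open>e\<close>.\<close>

lemma energy:
  assumes "0 < t"
  shows "((\<lambda>t. J (q t) \<bullet> J (q t) + \<alpha> * (q t \<bullet> q t) + D * (p t \<bullet> p t)) has_real_derivative
     2 * (g1 t \<bullet> J (q t) + g2 t \<bullet> q t)) (at t)"
proof -
  interpret J: bounded_linear J by (rule bl)
  define c where "c = t / 2"
  have c: "0 < c" "c < t" using assms by (auto simp: c_def)
  obtain A where A: "\<And>s. c < s \<Longrightarrow> (A has_vector_derivative p s) (at s)"
    using antiderivative_open_interval[OF cont(1) c(1)] by blast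
  obtain G1 where G1: "\<And>s. c < s \<Longrightarrow> (G1 has_vector_derivative g1 s) (at s)"
    using antiderivative_open_interval[OF cont(3) c(1)] by blast
  obtain G2 where G2: "\<And>s. c < s \<Longrightarrow> (G2 has_vector_derivative g2 s) (at s)"
    using antiderivative_open_interval[OF cont(4) c(1)] by blast
  obtain Q where Q: "\<And>s. c < s \<Longrightarrow> (Q has_vector_derivative q s) (at s)"
    using antiderivative_open_interval[OF cont(2) c(1)] by blast
  define u where "u = (\<lambda>s. J (p s))"
  have u: "(u has_vector_derivative q s) (at s)" if "c < s" for s
    unfolding u_def using Jp c(1) that by simp
  (* dq A s h and dq u s h are the means of p and q over [s, s + h]. As dq u = J (dq p), the mean
     velocity is an admissible test function, which q itself is not. *)
  define dq where "dq f s h = (f (s + h) - f s) /\<^sub>R h" for f :: "real \<Rightarrow> 'a" and s h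
  note ic = isCont_curves[OF assms]
  define e where "e s = J (q s) \<bullet> J (q s) + \<alpha> * (q s \<bullet> q s) + D * (p s \<bullet> p s)" for s
  define eh where "eh h s = J (dq u s h) \<bullet> J (dq u s h) + \<alpha> * (dq u s h \<bullet> dq u s h) + D * (dq A s h \<bullet> dq A s h)" for h s
  define eh' where "eh' = (\<lambda>(s, h). 2 * (dq G1 s h \<bullet> J (dq u s h) + dq G2 s h \<bullet> dq u s h))"
  let ?c = "2 * (g1 t \<bullet> J (q t) + g2 t \<bullet> q t)"
  have lim: "((\<lambda>(s, h). dq f s h) \<longlongrightarrow> g t) (nhds t \<times>\<^sub>F at_right 0)"
    if "\<And>s. c < s \<Longrightarrow> (f has_vector_derivative g s) (at s)" "isCont g t" for f g
    unfolding dq_def by (rule difference_quotient_tendsto[OF that c(2)])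
  have eh'_lim: "(eh' \<longlongrightarrow> ?c) (nhds t \<times>\<^sub>F at_right 0)"
  proof -
    note l = lim[OF G1 ic(3)] lim[OF G2 ic(4)] lim[OF u ic(2)]
    show ?thesis unfolding eh'_def case_prod_unfold
      by (intro tendsto_intros J.tendsto l[unfolded case_prod_unfold])
  qed
  have deriv: "(eh h has_real_derivative eh' (s, h)) (at s)" if s: "c < s" and h: "0 < h" for s h
  proof -
    have dqd: "((\<lambda>s. dq f s h) has_vector_derivative dq g s h) (at s)"
      if f: "\<And>s. c < s \<Longrightarrow> (f has_vector_derivative g s) (at s)" for f g
    proof -
      have "c < s + h" using s h by simp
      have "((\<lambda>s. f (s + h)) has_vector_derivative g (s + h)) (at s)"
        using vector_diff_chain_at[of "\<lambda>s. s + h" 1 s f "g (s + h)"] f[OF \<open>c < s + h\<close>]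
        by (simp add: o_def has_vector_derivative_add_const)
      then show ?thesis unfolding dq_def
        by (intro bounded_linear.has_vector_derivative[OF bounded_linear_scaleR_right] has_vector_derivative_diff f s)
    qed
    have inner: "((\<lambda>s. X s \<bullet> X s) has_real_derivative 2 * (x \<bullet> X s)) (at s)"
      if "(X has_vector_derivative x) (at s)" for X :: "real \<Rightarrow> 'a" and x
      using bounded_bilinear.has_vector_derivative[OF bounded_bilinear_inner that that]
      by (simp add: has_real_derivative_iff_has_vector_derivative inner_commute)
    have "(eh h has_real_derivative 2 * (J (dq q s h) \<bullet> J (dq u s h)) + \<alpha> * (2 * (dq q s h \<bullet> dq u s h))
            + D * (2 * (dq p s h \<bullet> dq A s h))) (at s)"
      unfolding eh_def by (intro DERIV_add DERIV_cmult inner J.has_vector_derivative dqd u A)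
    moreover have "2 * (J (dq q s h) \<bullet> J (dq u s h)) + \<alpha> * (2 * (dq q s h \<bullet> dq u s h))
            + D * (2 * (dq p s h \<bullet> dq A s h)) = eh' (s, h)"
    proof -
      have "c < s + h" using s h by simp
      \<comment> \<open>The test function is the increment of \<open>p\<close> over
        \<open>[s, s+h]\<close>, whose image under \<open>J\<close> is \<open>h\<close> times the
        mean velocity. Every term then carries the factor \<open>h * h\<close>.\<close>
      note id = integrated_equation[OF c(1) A G1 G2 s this, of "p (s+h) - p s"]
      have dp: "J (dq p s h) = dq u s h" by (simp add: dq_def u_def J.scaleR J.diff)
      have Jp': "J (p (s+h) - p s) = h *\<^sub>R dq u s h" using h by (simp add: dq_def u_def J.diff)
      have *: "f (s+h) - f s = h *\<^sub>R dq f s h" for f using h by (simp add: dq_def)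
      have "h * h * (J (dq q s h) \<bullet> J (dq u s h) + \<alpha> * (dq q s h \<bullet> dq u s h))
         = h * h * (dq G1 s h \<bullet> J (dq u s h) + dq G2 s h \<bullet> dq u s h - D * (dq A s h \<bullet> dq p s h))"
        using id unfolding Jp' * by (simp add: J.scaleR algebra_simps dp)
      then have "J (dq q s h) \<bullet> J (dq u s h) + \<alpha> * (dq q s h \<bullet> dq u s h)
         = dq G1 s h \<bullet> J (dq u s h) + dq G2 s h \<bullet> dq u s h - D * (dq A s h \<bullet> dq p s h)"
        using h by simp
      then show ?thesis by (simp add: eh'_def inner_commute algebra_simps)
    qed
    ultimately show ?thesis by simp
  qed
  have ptlim: "((\<lambda>h. dq f s h) \<longlongrightarrow> g s) (at_right 0)"
    if "(f has_vector_derivative g s) (at s)" for f g s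
  proof -
    have "((\<lambda>r. (f r - f s) /\<^sub>R (r - s)) \<longlongrightarrow> g s) (at s)"
      by (rule has_vector_derivative_imp_quotient[OF that])
    then have "((\<lambda>h. dq f s h) \<longlongrightarrow> g s) (at 0)"
      unfolding dq_def by (subst (asm) LIM_offset_zero_iff) (auto simp: add.commute)
    then show ?thesis by (rule tendsto_within_subset) auto
  qed
  have ehlim: "((\<lambda>h. eh h s) \<longlongrightarrow> e s) (at_right 0)" if "c < s" for s
    unfolding eh_def e_def by (intro tendsto_intros J.tendsto ptlim[where f=u and g=q, OF u[OF that]]
        ptlim[where f=A and g=p, OF A[OF that]])
  have "(e has_derivative (\<lambda>x. ?c * x)) (at t)"
    unfolding has_derivative_at_alt
  proof (intro conjI allI impI bounded_linear_mult_right)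
    fix \<epsilon> :: real assume \<epsilon>: "\<epsilon> > 0"
    have "\<forall>\<^sub>F x in nhds t \<times>\<^sub>F at_right 0. dist (eh' x) ?c < \<epsilon>"
      using tendstoD[OF eh'_lim \<epsilon>] .
    \<comment> \<open>The product filter provides one neighbourhood of \<open>t\<close> that serves
      every small \<open>h\<close>.\<close>
    then obtain P R where P: "\<forall>\<^sub>F s in nhds t. P s" and R: "\<forall>\<^sub>F h in at_right 0. R h"
      and PR: "\<And>s h. P s \<Longrightarrow> R h \<Longrightarrow> dist (eh' (s, h)) ?c < \<epsilon>"
      unfolding eventually_prod_filter by auto
    have "\<forall>\<^sub>F s in nhds t. c < s" using eventually_nhds_in_open[of "{c<..}" t] c by simp
    with P have "\<forall>\<^sub>F s in nhds t. P s \<and> c < s" by eventually_elim auto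
    then obtain \<delta> where \<delta>: "\<delta> > 0" "\<And>s. \<bar>s - t\<bar> < \<delta> \<Longrightarrow> P s \<and> c < s"
      by (auto simp: eventually_nhds_metric dist_real_def)
    show "\<exists>d>0. \<forall>y. norm (y - t) < d \<longrightarrow> norm (e y - e t - ?c * (y - t)) \<le> \<epsilon> * norm (y - t)"
    proof (intro exI[of _ \<delta>] conjI \<delta>(1) allI impI)
      fix y assume "norm (y - t) < \<delta>"
      then have y: "\<bar>y - t\<bar> < \<delta>" by simp
      have bound: "norm (eh h y - eh h t - ?c * (y - t)) \<le> \<epsilon> * norm (y - t)" if "R h" "0 < h" for h
      proof -
        let ?S = "{t - \<delta><..<t + \<delta>}"
        have "norm ((eh h y - ?c * y) - (eh h t - ?c * t)) \<le> \<epsilon> * norm (y - t)"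
        proof (rule field_differentiable_bound[of ?S "\<lambda>s. eh h s - ?c * s" "\<lambda>s. eh' (s, h) - ?c"])
          fix s assume "s \<in> ?S"
          then have "\<bar>s - t\<bar> < \<delta>" by auto
          then have s: "P s" "c < s" using \<delta>(2) by auto
          show "((\<lambda>s. eh h s - ?c * s) has_field_derivative eh' (s, h) - ?c) (at s within ?S)"
            by (rule derivative_eq_intros deriv[OF s(2) that(2), THEN has_field_derivative_at_within] refl)+ simp
          show "norm (eh' (s, h) - ?c) \<le> \<epsilon>" using PR[OF s(1) that(1)] by (simp add: dist_norm)
        qed (use y in auto)
        then show ?thesis by (simp add: algebra_simps)
      qed
      have "((\<lambda>h. norm (eh h y - eh h t - ?c * (y - t))) \<longlongrightarrow> norm (e y - e t - ?c * (y - t))) (at_right 0)"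
        using \<delta>(2)[OF y] c by (intro tendsto_intros ehlim) auto
      moreover have "\<forall>\<^sub>F h in at_right 0. norm (eh h y - eh h t - ?c * (y - t)) \<le> \<epsilon> * norm (y - t)"
        using R eventually_at_right_less[of 0] by eventually_elim (rule bound)
      ultimately show "norm (e y - e t - ?c * (y - t)) \<le> \<epsilon> * norm (y - t)"
        by (rule tendsto_upperbound) simp
    qed
  qed
  then show ?thesis unfolding has_field_derivative_def e_def .
qed

end

section \<open>Dissipativity and quasi-stability\<close>

lemma gronwall_dissipative:
  fixes f f' :: "real \<Rightarrow> real"
  assumes "0 < \<gamma>" "0 \<le> K" "0 \<le> T" and cont: "continuous_on {0..T} f"
    and d: "\<And>t. 0 < t \<Longrightarrow> t < T \<Longrightarrow> (f has_real_derivative f' t) (at t)"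
    and le: "\<And>t. 0 < t \<Longrightarrow> t < T \<Longrightarrow> f' t \<le> - \<gamma> * f t + K"
  shows "f T \<le> exp (- \<gamma> * T) * f 0 + K / \<gamma>"
proof -
  \<comment> \<open>The integrating factor times the deviation from the equilibrium value
    \<open>K / \<gamma>\<close>; it cannot increase.\<close>
  define g where "g t = exp (\<gamma> * t) * (f t - K / \<gamma>)" for t
  have "g T \<le> g 0"
  proof (cases "T = 0")
    case False
    show ?thesis
    proof (rule DERIV_nonpos_imp_decreasing_open[of 0 T g])
      show "\<exists>y. (g has_real_derivative y) (at t) \<and> y \<le> 0" if "0 < t" "t < T" for t
      proof (intro exI conjI)
        show "(g has_real_derivative exp (\<gamma> * t) * \<gamma> * (f t - K / \<gamma>) + exp (\<gamma> * t) * f' t) (at t)"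
          unfolding g_def by (rule derivative_eq_intros d[OF that] refl)+ (simp add: algebra_simps)
        have "\<gamma> * (f t - K / \<gamma>) + f' t \<le> 0"
          using le[OF that] assms(1) by (simp add: algebra_simps)
        then have "exp (\<gamma> * t) * (\<gamma> * (f t - K / \<gamma>) + f' t) \<le> 0"
          by (simp add: mult_nonneg_nonpos)
        then show "exp (\<gamma> * t) * \<gamma> * (f t - K / \<gamma>) + exp (\<gamma> * t) * f' t \<le> 0"
          by (simp only: distrib_left mult.assoc)
      qed
      show "continuous_on {0..T} g" unfolding g_def by (intro continuous_intros cont)
    qed (use assms in auto)
  qed simp
  then have "exp (- \<gamma> * T) * g T \<le> exp (- \<gamma> * T) * g 0" by simp
  moreover have "exp (- \<gamma> * T) * g T = f T - K / \<gamma>"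
    by (simp add: g_def mult.assoc[symmetric] exp_add[symmetric])
  moreover have "exp (- \<gamma> * T) * g 0 = exp (- \<gamma> * T) * f 0 - exp (- \<gamma> * T) * (K / \<gamma>)"
    by (simp add: g_def algebra_simps)
  moreover have "0 \<le> exp (- \<gamma> * T) * (K / \<gamma>)" using assms by simp
  ultimately show ?thesis by linarith
qed

lemma young: "x * y \<le> c * x\<^sup>2 + y\<^sup>2 / (4 * c)" if "0 < c" for x y c :: real
proof -
  have "0 \<le> (2 * c * x - y)\<^sup>2 / (4 * c)" using that by simp
  also have "\<dots> = c * x\<^sup>2 + y\<^sup>2 / (4 * c) - x * y"
    using that by (simp add: power2_eq_square field_simps)
  finally show ?thesis by simp
qed

lemma quartic_dominates:
  fixes a b c :: real
  assumes "0 < a"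
  obtains K where "0 \<le> K" "\<And>y. b * y\<^sup>2 + c * y \<le> a * y ^ 4 + K"
proof
  \<comment> \<open>Young with weight 1 turns \<open>c * y\<close> into
    \<open>y\<^sup>2 + c\<^sup>2 / 4\<close>, hence \<open>b + 1\<close> in place of
    \<open>b\<close>; Young with weight \<open>a\<close> then bounds the quadratic term by the
    quartic one.\<close>
  show "0 \<le> (b + 1)\<^sup>2 / (4 * a) + c\<^sup>2 / 4" using assms by simp
  show "b * y\<^sup>2 + c * y \<le> a * y ^ 4 + ((b + 1)\<^sup>2 / (4 * a) + c\<^sup>2 / 4)" for y
    using young[of 1 y c] young[OF assms, of "y\<^sup>2" "b + 1"]
    by (simp add: algebra_simps)
qed

text \<open>
  \<open>p\<close>, \<open>q\<close>, \<open>P0\<close> stand for \<open>w_xx\<close>, \<open>v_x\<close>, \<open>p0\<close>, and the \<open>\<phi>\<close> in \<open>trajectory\<close> is the second derivative of the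
  test function, so that \<open>kin q\<close>, \<open>en p q\<close> and \<open>pairing p q\<close> are \<open>\<parallel>v\<parallel>\<^sup>2\<close> in \<open>L_\<alpha>\<close>, the squared
  phase space norm and the inner product of \<open>v\<close> and \<open>w\<close> in \<open>L_\<alpha>\<close>.
\<close>

locale beam_operator =
  fixes J :: "'a::{real_inner,banach} \<Rightarrow> 'a" and D b1 b2 \<beta> U \<alpha> k0 :: real and P0 :: 'a
  assumes bl: "bounded_linear J"
    and pos: "0 < D" "0 < b2" "0 < \<alpha>" "0 < k0" "0 \<le> \<beta>"
begin

sublocale J: bounded_linear J by (rule bl)

definition trajectory :: "(real \<Rightarrow> 'a) \<Rightarrow> (real \<Rightarrow> 'a) \<Rightarrow> bool" where
  "trajectory p q \<longleftrightarrow> continuous_on {0..} p \<and> continuous_on {0..} q \<and>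
     (\<forall>t>0. ((\<lambda>t. J (p t)) has_vector_derivative q t) (at t)) \<and>
     (\<forall>t>0. \<forall>\<phi>. ((\<lambda>t. J (q t) \<bullet> J (J \<phi>) + \<alpha> * (q t \<bullet> J \<phi>)) has_real_derivative
        (P0 \<bullet> J (J \<phi>) - \<beta> * (J (q t) \<bullet> J (J \<phi>)) - \<beta> * U * (J (p t) \<bullet> J (J \<phi>)))
        - (D * (p t \<bullet> \<phi>) + (b2 * (norm (J (p t)))\<^sup>2 - b1) * (J (p t) \<bullet> J \<phi>)
           + k0 * (J (q t) \<bullet> J (J \<phi>)) + \<alpha> * k0 * (q t \<bullet> J \<phi>))) (at t))"

definition kin :: "'a \<Rightarrow> real" where "kin q = J q \<bullet> J q + \<alpha> * (q \<bullet> q)"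

definition en :: "'a \<Rightarrow> 'a \<Rightarrow> real" where "en p q = kin q + D * (p \<bullet> p)"

definition pairing :: "'a \<Rightarrow> 'a \<Rightarrow> real" where "pairing p q = J q \<bullet> J (J p) + \<alpha> * (q \<bullet> J p)"

lemma kin_nonneg: "0 \<le> kin q" using pos by (simp add: kin_def)

lemma en_nonneg: "0 \<le> en p q" using pos by (simp add: en_def kin_nonneg)

lemma norm_le_sqrt_kin: "norm (J q) \<le> sqrt (kin q)" "norm q \<le> sqrt (kin q) / sqrt \<alpha>"
proof -
  show "norm (J q) \<le> sqrt (kin q)"
    using pos by (simp add: kin_def norm_eq_sqrt_inner)
  have "sqrt \<alpha> * norm q = sqrt (\<alpha> * (q \<bullet> q))"
    by (simp add: norm_eq_sqrt_inner real_sqrt_mult)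
  also have "\<dots> \<le> sqrt (kin q)" by (simp add: kin_def)
  finally show "norm q \<le> sqrt (kin q) / sqrt \<alpha>"
    using pos by (simp add: field_simps)
qed

definition \<kappa> where "\<kappa> = onorm J"

lemma \<kappa>: "0 \<le> \<kappa>" "norm (J x) \<le> \<kappa> * norm x"
  unfolding \<kappa>_def by (auto intro: onorm_pos_le onorm bl)

text \<open>Besides the kinetic energy only \<open>norm (J p)\<close> appears on the right, never
  \<open>norm p\<close>: these terms are of lower order and will be controlled by the compactness of
  \<open>J\<close>.\<close>

lemma bounds:
  "\<bar>J q \<bullet> J (J p)\<bar> \<le> sqrt (kin q) * (\<kappa> * norm (J p))"
  "\<bar>J p \<bullet> J q\<bar> \<le> sqrt (kin q) * norm (J p)"
  "\<bar>J p \<bullet> J (J p)\<bar> \<le> \<kappa> * (norm (J p))\<^sup>2"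
  "\<bar>\<alpha> * (q \<bullet> J p)\<bar> \<le> sqrt \<alpha> * (sqrt (kin q) * norm (J p))"
proof -
  show "\<bar>J q \<bullet> J (J p)\<bar> \<le> sqrt (kin q) * (\<kappa> * norm (J p))"
    by (rule order_trans[OF Cauchy_Schwarz_ineq2])
       (intro mult_mono norm_le_sqrt_kin \<kappa> real_sqrt_ge_zero kin_nonneg norm_ge_zero)
  show "\<bar>J p \<bullet> J q\<bar> \<le> sqrt (kin q) * norm (J p)"
    by (subst inner_commute, rule order_trans[OF Cauchy_Schwarz_ineq2])
       (intro mult_mono norm_le_sqrt_kin \<kappa> real_sqrt_ge_zero kin_nonneg norm_ge_zero order_refl)
  have "\<bar>J p \<bullet> J (J p)\<bar> \<le> norm (J p) * (\<kappa> * norm (J p))"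
    by (rule order_trans[OF Cauchy_Schwarz_ineq2])
       (intro mult_mono \<kappa> norm_ge_zero order_refl)
  then show "\<bar>J p \<bullet> J (J p)\<bar> \<le> \<kappa> * (norm (J p))\<^sup>2"
    by (simp add: power2_eq_square algebra_simps)
  have "\<bar>q \<bullet> J p\<bar> \<le> (sqrt (kin q) / sqrt \<alpha>) * norm (J p)"
    by (rule order_trans[OF Cauchy_Schwarz_ineq2])
       (intro mult_mono norm_le_sqrt_kin kin_nonneg real_sqrt_ge_zero divide_nonneg_nonneg norm_ge_zero order_refl
         less_imp_le[OF pos(3)])
  then have "\<alpha> * \<bar>q \<bullet> J p\<bar> \<le> \<alpha> * ((sqrt (kin q) / sqrt \<alpha>) * norm (J p))"
    using pos by (intro mult_left_mono) auto
  also have "\<dots> = (sqrt \<alpha> * sqrt \<alpha>) * ((sqrt (kin q) / sqrt \<alpha>) * norm (J p))"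
    using pos by simp
  also have "\<dots> = sqrt \<alpha> * (sqrt (kin q) * norm (J p))"
    using pos by (simp add: field_simps del: real_sqrt_mult_self)
  finally show "\<bar>\<alpha> * (q \<bullet> J p)\<bar> \<le> sqrt \<alpha> * (sqrt (kin q) * norm (J p))"
    using pos by (simp add: abs_mult)
qed

lemma trajectory_continuous:
  assumes "trajectory p q" "S \<subseteq> {0..}"
  shows "continuous_on S p" "continuous_on S q"
  using assms continuous_on_subset unfolding trajectory_def by blast+

lemma trajectory_energy_setting:
  assumes "trajectory p q"
  shows "energy_setting J \<alpha> D p q (\<lambda>t. P0 - (\<beta> + k0) *\<^sub>R J (q t) - (\<beta> * U) *\<^sub>R J (p t))
    (\<lambda>t. - (b2 * (norm (J (p t)))\<^sup>2 - b1) *\<^sub>R J (p t) - (\<alpha> * k0) *\<^sub>R q t)"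
proof (rule energy_setting.intro)
  show "bounded_linear J" by (rule bl)
  show "continuous_on {0<..} p" "continuous_on {0<..} q"
    using trajectory_continuous[OF assms, of "{0<..}"] by (auto simp: subset_eq)
  note c = this
  show "continuous_on {0<..} (\<lambda>t. P0 - (\<beta> + k0) *\<^sub>R J (q t) - (\<beta> * U) *\<^sub>R J (p t))"
    "continuous_on {0<..} (\<lambda>t. - (b2 * (norm (J (p t)))\<^sup>2 - b1) *\<^sub>R J (p t) - (\<alpha> * k0) *\<^sub>R q t)"
    by (intro continuous_intros J.continuous_on c)+
  show "((\<lambda>t. J (p t)) has_vector_derivative q t) (at t)" if "0 < t" for t
    using assms that by (simp add: trajectory_def)
  fix t :: real and \<phi> assume "0 < t"
  then have "((\<lambda>t. J (q t) \<bullet> J (J \<phi>) + \<alpha> * (q t \<bullet> J \<phi>)) has_real_derivative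
        (P0 \<bullet> J (J \<phi>) - \<beta> * (J (q t) \<bullet> J (J \<phi>)) - \<beta> * U * (J (p t) \<bullet> J (J \<phi>)))
        - (D * (p t \<bullet> \<phi>) + (b2 * (norm (J (p t)))\<^sup>2 - b1) * (J (p t) \<bullet> J \<phi>)
           + k0 * (J (q t) \<bullet> J (J \<phi>)) + \<alpha> * k0 * (q t \<bullet> J \<phi>))) (at t)"
    using assms by (simp add: trajectory_def)
  then show "((\<lambda>t. J (q t) \<bullet> J (J \<phi>) + \<alpha> * (q t \<bullet> J \<phi>)) has_real_derivative
     (P0 - (\<beta> + k0) *\<^sub>R J (q t) - (\<beta> * U) *\<^sub>R J (p t)) \<bullet> J (J \<phi>) +
     (- (b2 * (norm (J (p t)))\<^sup>2 - b1) *\<^sub>R J (p t) - (\<alpha> * k0) *\<^sub>R q t) \<bullet> J \<phi> - D * (p t \<bullet> \<phi>)) (at t)"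
    by (rule DERIV_cong) (simp add: inner_diff_left inner_left_distrib algebra_simps)
qed

text \<open>\<open>cross\<close> bounds the pairing of v and w, \<open>drag\<close> the damping
  terms tested with w, and \<open>wind\<close> is the strength of the non-conservative flow
  term.\<close>

definition cross where "cross = \<kappa> + sqrt \<alpha>"
definition drag where "drag = (\<beta> + k0) * \<kappa> + k0 * sqrt \<alpha>"
definition wind where "wind = \<bar>\<beta> * U\<bar>"

text \<open>Makes a Lyapunov function comparable to the energy: the pairing costs a prescribed
  fraction \<eta> of the kinetic energy and otherwise only a lower order term.\<close>

lemma pairing_young:
  assumes "0 < \<eta>"
  shows "\<bar>\<epsilon> * pairing p q\<bar> \<le> \<eta> * kin q + \<epsilon>\<^sup>2 * cross\<^sup>2 / (4 * \<eta>) * (norm (J p))\<^sup>2"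
proof -
  have "\<bar>pairing p q\<bar> \<le> cross * (sqrt (kin q) * norm (J p))"
    using bounds(1)[of q p] bounds(4)[of q p] unfolding pairing_def cross_def
    by (simp add: algebra_simps)
  then have "\<bar>\<epsilon> * pairing p q\<bar> \<le> \<bar>\<epsilon>\<bar> * (cross * (sqrt (kin q) * norm (J p)))"
    unfolding abs_mult by (rule mult_left_mono) simp
  also have "\<dots> \<le> \<eta> * kin q + \<epsilon>\<^sup>2 * cross\<^sup>2 / (4 * \<eta>) * (norm (J p))\<^sup>2"
    using young[OF assms, of "sqrt (kin q)" "\<bar>\<epsilon>\<bar> * cross * norm (J p)"] kin_nonneg[of q]
    by (simp add: power_mult_distrib algebra_simps)
  finally show ?thesis .
qed

text \<open>The linear velocity and flow terms as they enter the energy identity (first) and the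
  virial identity (second). In the first the \<beta>-damping has a good sign and is dropped.\<close>

lemma damping:
  "- (\<beta> + k0) * (J q \<bullet> J q) - \<beta> * U * (J p \<bullet> J q) - \<alpha> * k0 * (q \<bullet> q)
     \<le> - k0 * kin q + wind * (sqrt (kin q) * norm (J p))"
  "- (\<beta> + k0) * (J q \<bullet> J (J p)) - \<beta> * U * (J p \<bullet> J (J p)) - k0 * (\<alpha> * (q \<bullet> J p))
     \<le> drag * (sqrt (kin q) * norm (J p)) + wind * \<kappa> * (norm (J p))\<^sup>2"
proof -
  have wind: "\<bar>\<beta> * U * x\<bar> \<le> wind * y" if "\<bar>x\<bar> \<le> y" for x y
    unfolding wind_def abs_mult[of "\<beta> * U"] using that by (rule mult_left_mono) simp
  have "0 \<le> \<beta> * (J q \<bullet> J q)" using pos by simp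
  then show "- (\<beta> + k0) * (J q \<bullet> J q) - \<beta> * U * (J p \<bullet> J q) - \<alpha> * k0 * (q \<bullet> q)
     \<le> - k0 * kin q + wind * (sqrt (kin q) * norm (J p))"
    using wind[OF bounds(2)[of p q]] unfolding kin_def by (simp add: algebra_simps)
  have "\<bar>(\<beta> + k0) * (J q \<bullet> J (J p))\<bar> \<le> (\<beta> + k0) * (sqrt (kin q) * (\<kappa> * norm (J p)))"
    "\<bar>k0 * (\<alpha> * (q \<bullet> J p))\<bar> \<le> k0 * (sqrt \<alpha> * (sqrt (kin q) * norm (J p)))"
    using bounds(1)[of q p] bounds(4)[of q p] pos by (simp_all add: abs_mult[of "\<beta> + k0"] abs_mult[of k0])
  then show "- (\<beta> + k0) * (J q \<bullet> J (J p)) - \<beta> * U * (J p \<bullet> J (J p)) - k0 * (\<alpha> * (q \<bullet> J p))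
     \<le> drag * (sqrt (kin q) * norm (J p)) + wind * \<kappa> * (norm (J p))\<^sup>2"
    using wind[OF bounds(3)[of p]] unfolding drag_def by (simp add: algebra_simps)
qed

text \<open>\<open>E\<close> is an energy rate, \<open>F\<close> a virial rate, \<open>N\<close> and
  \<open>P\<close> are the kinetic and elastic parts of \<open>en\<close>, and \<open>y\<close> is
  the norm of w_x. Of the loss \<open>k0 * N\<close>, one quarter absorbs the cross term of
  \<open>E\<close>. Two quarters pay for \<open>F\<close> with its weight \<open>k0 / 4\<close>,
  namely for its own \<open>N\<close> and for the \<open>N\<close> that Young produces. The last
  quarter remains as decay, matching \<open>k0 / 4 * P\<close>; this is the origin of the
  weight.\<close>

lemma lyapunov_step:
  fixes N P y E F r B c :: real
  assumes "0 \<le> N" "E \<le> - k0 * N + B * (sqrt N * y)" "F \<le> N - P + c * (sqrt N * y) + r"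
  shows "E + k0 / 4 * F \<le> - (k0 / 4) * (N + P) + (B\<^sup>2 / k0 + k0 / 4 * (c\<^sup>2 / 4)) * y\<^sup>2 + k0 / 4 * r"
proof -
  have "B * (sqrt N * y) \<le> k0 / 4 * N + B\<^sup>2 / k0 * y\<^sup>2"
    using young[of "k0 / 4" "sqrt N" "B * y"] pos assms(1) by (simp add: power_mult_distrib algebra_simps)
  moreover have "c * (sqrt N * y) \<le> N + c\<^sup>2 / 4 * y\<^sup>2"
    using young[of 1 "sqrt N" "c * y"] assms(1) by (simp add: power_mult_distrib algebra_simps)
  then have "k0 / 4 * F \<le> k0 / 4 * (2 * N - P + c\<^sup>2 / 4 * y\<^sup>2 + r)"
    using assms(3) pos by (intro mult_left_mono) auto
  ultimately show ?thesis using assms(2) by (simp add: algebra_simps add_divide_distrib)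
qed

text \<open>Only \<open>C\<close> depends on the bound \<open>R\<close> for the initial energy. The
  uniform \<open>K\<close> is what yields an absorbing set.\<close>

lemma dissipative:
  obtains \<gamma> K where "0 < \<gamma>"
    "\<And>R. \<exists>C. \<forall>p q. trajectory p q \<and> en (p 0) (q 0) \<le> R \<longrightarrow>
         (\<forall>t\<ge>0. en (p t) (q t) \<le> C * exp (- \<gamma> * t) + K)"
proof -
  define a where "a = norm P0 * \<kappa>"
  define \<epsilon> where "\<epsilon> = k0 / 4"
  have \<epsilon>: "0 < \<epsilon>" using pos by (simp add: \<epsilon>_def)
  \<comment> \<open>\<open>M3\<close> and \<open>M6\<close> come from \<open>pairing_young\<close>
    with weights 1/2 and 1/4, for the upper and the lower bound of \<Lambda>; \<open>M4\<close>
    collects all quadratic terms of the rate.\<close>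
  define M3 where "M3 = \<bar>b1\<bar> / 2 + \<epsilon>\<^sup>2 * cross\<^sup>2 / 2"
  define M6 where "M6 = \<bar>b1\<bar> / 2 + \<epsilon>\<^sup>2 * cross\<^sup>2"
  define M4 where "M4 = (wind\<^sup>2 / k0 + \<epsilon> * (drag\<^sup>2 / 4)) + \<epsilon> * (\<bar>b1\<bar> + wind * \<kappa>) + \<epsilon> * M3"
  have a: "0 \<le> a" using \<kappa> by (simp add: a_def)
  \<comment> \<open>The virial identity yields \<open>- \<epsilon> * b2 * y ^ 4\<close>. A quarter
    of it is spent on the quartic part of \<open>\<epsilon> * \<Lambda>\<close>, so three quarters
    are available here.\<close>
  obtain K1 where K1: "0 \<le> K1" "\<And>y. M4 * y\<^sup>2 + (2 * \<epsilon> * a) * y \<le> (3/4 * \<epsilon> * b2) * y ^ 4 + K1"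
    using quartic_dominates[of "3/4 * \<epsilon> * b2" M4 "2 * \<epsilon> * a"] \<epsilon> pos by auto
  obtain K2 where K2: "0 \<le> K2" "\<And>y. M6 * y\<^sup>2 + a * y \<le> (b2 / 4) * y ^ 4 + K2"
    using quartic_dominates[of "b2 / 4" M6 a] pos by auto
  \<comment> \<open>The stretching and load potentials cancel the conservative forces in the energy
    identity, so that \<open>E'\<close> below contains only damping and flow terms.\<close>
  define \<Lambda> where "\<Lambda> p q = en p q / 2 + b2 / 4 * (norm (J p)) ^ 4 - b1 / 2 * (norm (J p))\<^sup>2
      - P0 \<bullet> J (J p) + \<epsilon> * pairing p q" for p q
  have P0: "\<bar>P0 \<bullet> J (J p)\<bar> \<le> a * norm (J p)" for p
  proof -
    have "\<bar>P0 \<bullet> J (J p)\<bar> \<le> norm P0 * (\<kappa> * norm (J p))"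
      by (rule order_trans[OF Cauchy_Schwarz_ineq2]) (intro mult_mono \<kappa> norm_ge_zero order_refl)
    then show ?thesis by (simp add: a_def)
  qed
  have b1y: "\<bar>b1 / 2 * y\<^sup>2\<bar> \<le> \<bar>b1\<bar> / 2 * y\<^sup>2" for y by (simp add: abs_mult)
  have upper: "\<Lambda> p q \<le> kin q + D * (p \<bullet> p) / 2 + b2 / 4 * (norm (J p)) ^ 4 + M3 * (norm (J p))\<^sup>2 + a * norm (J p)" for p q
    using pairing_young[of "1/2" \<epsilon> p q] P0[of p] b1y[of "norm (J p)"]
    unfolding \<Lambda>_def en_def M3_def by (simp add: algebra_simps add_divide_distrib)
  have lower: "en p q / 4 - K2 \<le> \<Lambda> p q" for p q
  proof -
    have "0 \<le> D * (p \<bullet> p)" using pos by simp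
    then show ?thesis using pairing_young[of "1/4" \<epsilon> p q] P0[of p] b1y[of "norm (J p)"] K2(2)[of "norm (J p)"]
      unfolding \<Lambda>_def en_def M6_def by (simp add: algebra_simps add_divide_distrib)
  qed
  have decay: "\<Lambda> (p t) (q t) \<le> exp (- \<epsilon> * t) * \<Lambda> (p 0) (q 0) + K1 / \<epsilon>" if tr: "trajectory p q" and "0 \<le> t" for p q t
  proof -
    interpret energy_setting J \<alpha> D p q "\<lambda>t. P0 - (\<beta> + k0) *\<^sub>R J (q t) - (\<beta> * U) *\<^sub>R J (p t)"
      "\<lambda>t. - (b2 * (norm (J (p t)))\<^sup>2 - b1) *\<^sub>R J (p t) - (\<alpha> * k0) *\<^sub>R q t"
      by (rule trajectory_energy_setting[OF tr])
    define E' where "E' t = - (\<beta> + k0) * (J (q t) \<bullet> J (q t)) - \<beta> * U * (J (p t) \<bullet> J (q t)) - \<alpha> * k0 * (q t \<bullet> q t)" for t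
    define \<Phi>' where "\<Phi>' t = P0 \<bullet> J (J (p t)) - (\<beta> + k0) * (J (q t) \<bullet> J (J (p t))) - \<beta> * U * (J (p t) \<bullet> J (J (p t)))
      - (b2 * (norm (J (p t)))\<^sup>2 - b1) * (norm (J (p t)))\<^sup>2 - k0 * (\<alpha> * (q t \<bullet> J (p t))) - D * (p t \<bullet> p t) + kin (q t)" for t
    have "((\<lambda>t. \<Lambda> (p t) (q t)) has_real_derivative E' t + \<epsilon> * \<Phi>' t) (at t)" if t: "0 < t" for t
    proof -
      have inner: "((\<lambda>s. X s \<bullet> X s) has_real_derivative 2 * (x \<bullet> X s)) (at s)"
        if "(X has_vector_derivative x) (at s)" for X :: "real \<Rightarrow> 'a" and x s
        using bounded_bilinear.has_vector_derivative[OF bounded_bilinear_inner that that]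
        by (simp add: has_real_derivative_iff_has_vector_derivative inner_commute)
      have innr: "((\<lambda>s. y \<bullet> X s) has_real_derivative y \<bullet> x) (at s)"
        if "(X has_vector_derivative x) (at s)" for X :: "real \<Rightarrow> 'a" and x y s
        using bounded_linear.has_vector_derivative[OF bounded_linear_inner_right that]
        by (simp add: has_real_derivative_iff_has_vector_derivative)
      have n4: "(norm x) ^ 4 = (x \<bullet> x)\<^sup>2" for x :: 'a
        by (simp add: power2_norm_eq_inner[symmetric])
      show ?thesis
        unfolding \<Lambda>_def en_def kin_def pairing_def n4 power2_norm_eq_inner
        by (rule energy[OF t] virial[OF t] inner[OF Jp[OF t]] innr
            J.has_vector_derivative[OF Jp[OF t]] Jp[OF t] refl DERIV_cdivide derivative_eq_intros)+
           (simp add: E'_def \<Phi>'_def kin_def power2_norm_eq_inner inner_diff_left inner_commute algebra_simps add_divide_distrib diff_divide_distrib)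
    qed
    moreover have "E' t + \<epsilon> * \<Phi>' t \<le> - \<epsilon> * \<Lambda> (p t) (q t) + K1" for t
    proof -
      define y where "y = norm (J (p t))"
      let ?r = "(\<bar>b1\<bar> + wind * \<kappa>) * y\<^sup>2 + a * y - b2 * y ^ 4"
      have "b1 * y\<^sup>2 \<le> \<bar>b1\<bar> * y\<^sup>2" by (simp add: mult_right_mono)
      then have "\<Phi>' t \<le> kin (q t) - D * (p t \<bullet> p t) + drag * (sqrt (kin (q t)) * y) + ?r"
        using damping(2)[of "q t" "p t"] P0[of "p t"] unfolding \<Phi>'_def y_def[symmetric]
        by (simp add: algebra_simps power2_eq_square power4_eq_xxxx)
      from lyapunov_step[OF kin_nonneg damping(1)[of "q t" "p t", folded E'_def y_def] this]
      have 1: "E' t + \<epsilon> * \<Phi>' t \<le> - \<epsilon> * (kin (q t) + D * (p t \<bullet> p t))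
          + (wind\<^sup>2 / k0 + \<epsilon> * (drag\<^sup>2 / 4)) * y\<^sup>2 + \<epsilon> * ?r" by (simp add: \<epsilon>_def)
      have 2: "\<epsilon> * \<Lambda> (p t) (q t) \<le> \<epsilon> * (kin (q t) + D * (p t \<bullet> p t) / 2 + b2 / 4 * y ^ 4 + M3 * y\<^sup>2 + a * y)"
        using upper[of "p t" "q t"] \<epsilon> unfolding y_def by (intro mult_left_mono) auto
      have "0 \<le> \<epsilon> * (D * (p t \<bullet> p t))" using pos \<epsilon> by simp
      then show ?thesis using 1 2 K1(2)[of y] unfolding M4_def by (simp add: algebra_simps)
    qed
    moreover have "continuous_on {0..t} (\<lambda>t. \<Lambda> (p t) (q t))"
      unfolding \<Lambda>_def en_def kin_def pairing_def
      using trajectory_continuous[OF tr, of "{0..t}"]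
      by (intro continuous_intros J.continuous_on; auto)
    ultimately show ?thesis using \<epsilon> K1 \<open>0 \<le> t\<close>
      by (intro gronwall_dissipative[where f' = "\<lambda>t. E' t + \<epsilon> * \<Phi>' t"]) auto
  qed
  show ?thesis
  proof
    show "0 < \<epsilon>" by (rule \<epsilon>)
    fix R
    \<comment> \<open>Bounds \<open>norm (J (p 0))\<close> through the initial energy, so that
      \<open>C\<close> depends on \<open>R\<close> alone.\<close>
    define Y where "Y = \<kappa> * sqrt (\<bar>R\<bar> / D)"
    have Y: "0 \<le> Y" using \<kappa> pos by (simp add: Y_def)
    define C where "C = R + R + b2 / 4 * Y ^ 4 + M3 * Y\<^sup>2 + a * Y"
    show "\<exists>C. \<forall>p q. trajectory p q \<and> en (p 0) (q 0) \<le> R \<longrightarrow>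
         (\<forall>t\<ge>0. en (p t) (q t) \<le> C * exp (- \<epsilon> * t) + (4 * (K1 / \<epsilon>) + 4 * K2))"
    proof (intro exI[of _ "4 * C"] allI impI, elim conjE)
      fix p q and t :: real assume tr: "trajectory p q" and R: "en (p 0) (q 0) \<le> R" and t: "0 \<le> t"
      have k: "kin (q 0) \<le> R" and pp: "D * (p 0 \<bullet> p 0) \<le> R" and "0 \<le> R"
        using R kin_nonneg[of "q 0"] mult_nonneg_nonneg[OF less_imp_le[OF pos(1)] inner_ge_zero[of "p 0"]]
        unfolding en_def by linarith+
      have "norm (p 0) \<le> sqrt (\<bar>R\<bar> / D)"
        using pp pos \<open>0 \<le> R\<close> by (simp add: norm_eq_sqrt_inner field_simps)
      then have y: "norm (J (p 0)) \<le> Y"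
        using \<kappa>(2)[of "p 0"] mult_left_mono[OF _ \<kappa>(1)] unfolding Y_def by (meson order_trans)
      have "0 \<le> M3" by (simp add: M3_def)
      then have "b2 / 4 * (norm (J (p 0))) ^ 4 \<le> b2 / 4 * Y ^ 4" "M3 * (norm (J (p 0)))\<^sup>2 \<le> M3 * Y\<^sup>2"
        "a * norm (J (p 0)) \<le> a * Y"
        using y a pos by (auto intro!: mult_left_mono power_mono)
      moreover have "D * (p 0 \<bullet> p 0) / 2 \<le> R" using pp \<open>0 \<le> R\<close> by linarith
      ultimately have "\<Lambda> (p 0) (q 0) \<le> C"
        using upper[of "p 0" "q 0"] k unfolding C_def by linarith
      then have "exp (- \<epsilon> * t) * \<Lambda> (p 0) (q 0) \<le> C * exp (- \<epsilon> * t)"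
        by (simp add: mult.commute[of C] mult_left_mono del: mult_minus_left)
      then show "en (p t) (q t) \<le> 4 * C * exp (- \<epsilon> * t) + (4 * (K1 / \<epsilon>) + 4 * K2)"
        using decay[OF tr t] lower[of "p t" "q t"] unfolding mult.assoc by linarith
    qed
  qed
qed

text \<open>Splitting off \<open>u1 - u2\<close> leaves one summand with the square of
  \<open>norm u1\<close> and a difference of squares, which counts twice; hence the factor 3. This
  is the local Lipschitz bound for the stretching force.\<close>

lemma cubic_difference:
  fixes u1 u2 :: 'a
  assumes "norm u1 \<le> R" "norm u2 \<le> R"
  shows "norm (- (b2 * (norm u1)\<^sup>2 - b1) *\<^sub>R u1 + (b2 * (norm u2)\<^sup>2 - b1) *\<^sub>R u2)
    \<le> (\<bar>b1\<bar> + 3 * b2 * R\<^sup>2) * norm (u1 - u2)"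
proof -
  have R: "0 \<le> R" using assms(1) norm_ge_zero order_trans by blast
  have "- (b2 * (norm u1)\<^sup>2 - b1) *\<^sub>R u1 + (b2 * (norm u2)\<^sup>2 - b1) *\<^sub>R u2
    = b1 *\<^sub>R (u1 - u2) - (b2 * (norm u1)\<^sup>2) *\<^sub>R (u1 - u2) - (b2 * ((norm u1)\<^sup>2 - (norm u2)\<^sup>2)) *\<^sub>R u2"
    by (simp add: algebra_simps)
  also have "norm \<dots> \<le> norm (b1 *\<^sub>R (u1 - u2)) + norm ((b2 * (norm u1)\<^sup>2) *\<^sub>R (u1 - u2))
     + norm ((b2 * ((norm u1)\<^sup>2 - (norm u2)\<^sup>2)) *\<^sub>R u2)"
    by (smt (verit) norm_triangle_ineq4)
  also have "\<dots> \<le> \<bar>b1\<bar> * norm (u1 - u2) + b2 * R\<^sup>2 * norm (u1 - u2) + b2 * (2 * R * norm (u1 - u2)) * R"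
  proof (intro add_mono)
    show "norm ((b2 * (norm u1)\<^sup>2) *\<^sub>R (u1 - u2)) \<le> b2 * R\<^sup>2 * norm (u1 - u2)"
      using pos assms by (auto intro!: mult_right_mono power_mono)
    have "\<bar>(norm u1)\<^sup>2 - (norm u2)\<^sup>2\<bar> = (norm u1 + norm u2) * \<bar>norm u1 - norm u2\<bar>"
      by (simp add: power2_eq_square square_diff_square_factored abs_mult)
    also have "\<dots> \<le> 2 * R * norm (u1 - u2)"
      using assms R by (intro mult_mono norm_triangle_ineq3) auto
    finally show "norm ((b2 * ((norm u1)\<^sup>2 - (norm u2)\<^sup>2)) *\<^sub>R u2) \<le> b2 * (2 * R * norm (u1 - u2)) * R"
      using pos assms(2) R unfolding norm_scaleR abs_mult
      by (intro mult_mono mult_nonneg_nonneg) auto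
  qed simp
  finally show ?thesis by (simp add: algebra_simps power2_eq_square)
qed

text \<open>The difference of two trajectories solves the same kind of system without load, with a
  forcing \<open>n\<close> that is Lipschitz in the difference of the slopes. A difference has no
  quartic term to absorb quadratic ones, so the lower order terms stay on the right as a multiple of
  \<open>\<delta>\<^sup>2\<close>.\<close>

lemma quasi_stable:
  obtains \<gamma> C where "0 < \<gamma>" "0 \<le> C"
    "\<And>p1 q1 p2 q2 T \<delta>. \<lbrakk>trajectory p1 q1; trajectory p2 q2; 0 \<le> T;
       \<And>t. t \<in> {0..T} \<Longrightarrow> norm (J (p1 t)) \<le> R; \<And>t. t \<in> {0..T} \<Longrightarrow> norm (J (p2 t)) \<le> R;
       \<And>t. t \<in> {0..T} \<Longrightarrow> norm (J (p1 t) - J (p2 t)) \<le> \<delta>\<rbrakk> \<Longrightarrow>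
       en (p1 T - p2 T) (q1 T - q2 T) \<le> 4 * exp (- \<gamma> * T) * en (p1 0 - p2 0) (q1 0 - q2 0) + C * \<delta>\<^sup>2"
proof -
  define \<nu> where "\<nu> = \<bar>b1\<bar> + 3 * b2 * R\<^sup>2"
  define B where "B = wind + \<nu> / sqrt \<alpha>"
  define \<epsilon> where "\<epsilon> = k0 / 4"
  have \<epsilon>: "0 < \<epsilon>" using pos by (simp add: \<epsilon>_def)
  define M3 where "M3 = \<epsilon>\<^sup>2 * cross\<^sup>2 / 2"
  define M6 where "M6 = \<epsilon>\<^sup>2 * cross\<^sup>2"
  define M4 where "M4 = (B\<^sup>2 / k0 + \<epsilon> * (drag\<^sup>2 / 4)) + \<epsilon> * (wind * \<kappa> + \<nu>) + \<epsilon> * M3"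
  have nn: "0 \<le> \<nu>" "0 \<le> M3" "0 \<le> M6"
    using pos by (simp_all add: \<nu>_def M3_def M6_def)
  have M4: "0 \<le> M4" using nn pos \<epsilon> \<kappa> by (simp add: M4_def wind_def)
  define \<Lambda> where "\<Lambda> p q = en p q / 2 + \<epsilon> * pairing p q" for p q
  have upper: "\<Lambda> p q \<le> kin q + D * (p \<bullet> p) / 2 + M3 * (norm (J p))\<^sup>2" for p q
    using pairing_young[of "1/2" \<epsilon> p q]
    unfolding \<Lambda>_def en_def M3_def by (simp add: algebra_simps add_divide_distrib)
  have lower: "en p q / 4 - M6 * (norm (J p))\<^sup>2 \<le> \<Lambda> p q" for p q
  proof -
    have "0 \<le> D * (p \<bullet> p)" using pos by simp
    then show ?thesis using pairing_young[of "1/4" \<epsilon> p q]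
      unfolding \<Lambda>_def en_def M6_def by (simp add: algebra_simps add_divide_distrib)
  qed
  show ?thesis
  proof
    show "0 < \<epsilon>" by (rule \<epsilon>)
    \<comment> \<open>The three summands stem from \<Lambda> at time 0, from Gronwall and from
      \<Lambda> at time \<open>T\<close>; the factor 4 undoes \<open>en p q / 4\<close> in the lower
      bound.\<close>
    show "0 \<le> 4 * M3 + 4 * (M4 / \<epsilon>) + 4 * M6" using nn M4 \<epsilon> by simp
    fix p1 q1 p2 q2 :: "real \<Rightarrow> 'a" and T \<delta> :: real
    assume tr: "trajectory p1 q1" "trajectory p2 q2" and T: "0 \<le> T"
      and R1: "\<And>t. t \<in> {0..T} \<Longrightarrow> norm (J (p1 t)) \<le> R" and R2: "\<And>t. t \<in> {0..T} \<Longrightarrow> norm (J (p2 t)) \<le> R"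
      and d: "\<And>t. t \<in> {0..T} \<Longrightarrow> norm (J (p1 t) - J (p2 t)) \<le> \<delta>"
    interpret e1: energy_setting J \<alpha> D p1 q1 "\<lambda>t. P0 - (\<beta> + k0) *\<^sub>R J (q1 t) - (\<beta> * U) *\<^sub>R J (p1 t)"
      "\<lambda>t. - (b2 * (norm (J (p1 t)))\<^sup>2 - b1) *\<^sub>R J (p1 t) - (\<alpha> * k0) *\<^sub>R q1 t"
      by (rule trajectory_energy_setting[OF tr(1)])
    interpret e2: energy_setting J \<alpha> D p2 q2 "\<lambda>t. P0 - (\<beta> + k0) *\<^sub>R J (q2 t) - (\<beta> * U) *\<^sub>R J (p2 t)"
      "\<lambda>t. - (b2 * (norm (J (p2 t)))\<^sup>2 - b1) *\<^sub>R J (p2 t) - (\<alpha> * k0) *\<^sub>R q2 t"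
      by (rule trajectory_energy_setting[OF tr(2)])
    define p where "p t = p1 t - p2 t" for t
    define q where "q t = q1 t - q2 t" for t
    define n where "n t = - (b2 * (norm (J (p1 t)))\<^sup>2 - b1) *\<^sub>R J (p1 t) + (b2 * (norm (J (p2 t)))\<^sup>2 - b1) *\<^sub>R J (p2 t)" for t
    interpret energy_setting J \<alpha> D p q "\<lambda>t. - (\<beta> + k0) *\<^sub>R J (q t) - (\<beta> * U) *\<^sub>R J (p t)"
      "\<lambda>t. n t - (\<alpha> * k0) *\<^sub>R q t"
    proof (rule energy_setting.intro)
      show c: "continuous_on {0<..} p" "continuous_on {0<..} q"
        unfolding p_def q_def by (intro continuous_intros e1.cont e2.cont)+
      show "continuous_on {0<..} (\<lambda>t. - (\<beta> + k0) *\<^sub>R J (q t) - (\<beta> * U) *\<^sub>R J (p t))"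
        "continuous_on {0<..} (\<lambda>t. n t - (\<alpha> * k0) *\<^sub>R q t)"
        unfolding n_def by (intro continuous_intros J.continuous_on c e1.cont e2.cont)+
      show "((\<lambda>t. J (p t)) has_vector_derivative q t) (at t)" if "0 < t" for t
        unfolding p_def q_def J.diff by (intro derivative_intros e1.Jp e2.Jp that)
      fix t :: real and \<phi> assume t: "0 < t"
      show "((\<lambda>t. J (q t) \<bullet> J (J \<phi>) + \<alpha> * (q t \<bullet> J \<phi>)) has_real_derivative
        (- (\<beta> + k0) *\<^sub>R J (q t) - (\<beta> * U) *\<^sub>R J (p t)) \<bullet> J (J \<phi>) + (n t - (\<alpha> * k0) *\<^sub>R q t) \<bullet> J \<phi> - D * (p t \<bullet> \<phi>)) (at t)"
        using DERIV_diff[OF e1.eqn[OF t, of \<phi>] e2.eqn[OF t, of \<phi>]]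
        by (simp add: p_def q_def n_def J.diff inner_diff_left inner_add_left algebra_simps)
    qed (rule bl)
    define E' where "E' t = - (\<beta> + k0) * (J (q t) \<bullet> J (q t)) - \<beta> * U * (J (p t) \<bullet> J (q t)) + n t \<bullet> q t - \<alpha> * k0 * (q t \<bullet> q t)" for t
    define \<Phi>' where "\<Phi>' t = - (\<beta> + k0) * (J (q t) \<bullet> J (J (p t))) - \<beta> * U * (J (p t) \<bullet> J (J (p t)))
      + n t \<bullet> J (p t) - k0 * (\<alpha> * (q t \<bullet> J (p t))) - D * (p t \<bullet> p t) + kin (q t)" for t
    have "((\<lambda>t. \<Lambda> (p t) (q t)) has_real_derivative E' t + \<epsilon> * \<Phi>' t) (at t)" if t: "0 < t" for t
      unfolding \<Lambda>_def en_def kin_def pairing_def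
      by (rule energy[OF t] virial[OF t] refl DERIV_cdivide derivative_eq_intros)+
         (simp add: E'_def \<Phi>'_def kin_def inner_diff_left inner_add_left inner_commute algebra_simps add_divide_distrib diff_divide_distrib)
    moreover have "E' t + \<epsilon> * \<Phi>' t \<le> - \<epsilon> * \<Lambda> (p t) (q t) + M4 * \<delta>\<^sup>2" if t: "0 < t" "t < T" for t
    proof -
      define y where "y = norm (J (p t))"
      have y0: "0 \<le> y" by (simp add: y_def)
      have y\<delta>: "y\<^sup>2 \<le> \<delta>\<^sup>2" using d[of t] t y0 by (intro power_mono) (auto simp: y_def p_def J.diff)
      have nt: "norm (n t) \<le> \<nu> * y"
        unfolding n_def \<nu>_def y_def p_def J.diff using cubic_difference R1 R2 t by simp
      have "n t \<bullet> q t \<le> norm (n t) * norm (q t)" by (rule norm_cauchy_schwarz)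
      also have "\<dots> \<le> \<nu> * y * (sqrt (kin (q t)) / sqrt \<alpha>)"
        using nt norm_le_sqrt_kin(2)[of "q t"] nn y0 by (intro mult_mono) auto
      finally have E: "E' t \<le> - k0 * kin (q t) + B * (sqrt (kin (q t)) * y)"
        using damping(1)[of "q t" "p t", folded y_def] unfolding E'_def B_def by (simp add: algebra_simps)
      have "n t \<bullet> J (p t) \<le> norm (n t) * y" unfolding y_def by (rule norm_cauchy_schwarz)
      also have "\<dots> \<le> \<nu> * y * y" using nt y0 by (rule mult_right_mono)
      finally have "\<Phi>' t \<le> kin (q t) - D * (p t \<bullet> p t) + drag * (sqrt (kin (q t)) * y) + (wind * \<kappa> + \<nu>) * y\<^sup>2"
        using damping(2)[of "q t" "p t", folded y_def] unfolding \<Phi>'_def by (simp add: power2_eq_square algebra_simps)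
      from lyapunov_step[OF kin_nonneg E this]
      have 1: "E' t + \<epsilon> * \<Phi>' t \<le> - \<epsilon> * (kin (q t) + D * (p t \<bullet> p t))
          + (B\<^sup>2 / k0 + \<epsilon> * (drag\<^sup>2 / 4)) * y\<^sup>2 + \<epsilon> * ((wind * \<kappa> + \<nu>) * y\<^sup>2)" by (simp add: \<epsilon>_def)
      have 2: "\<epsilon> * \<Lambda> (p t) (q t) \<le> \<epsilon> * (kin (q t) + D * (p t \<bullet> p t) / 2 + M3 * y\<^sup>2)"
        using upper[of "p t" "q t"] \<epsilon> unfolding y_def by (intro mult_left_mono) auto
      have "0 \<le> \<epsilon> * (D * (p t \<bullet> p t))" using pos \<epsilon> by simp
      then have "E' t + \<epsilon> * \<Phi>' t \<le> - \<epsilon> * \<Lambda> (p t) (q t) + M4 * y\<^sup>2"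
        using 1 2 unfolding M4_def by (simp add: algebra_simps)
      also have "M4 * y\<^sup>2 \<le> M4 * \<delta>\<^sup>2" using y\<delta> M4 by (rule mult_left_mono)
      finally show ?thesis by simp
    qed
    moreover have "continuous_on {0..T} (\<lambda>t. \<Lambda> (p t) (q t))"
      unfolding \<Lambda>_def en_def kin_def pairing_def p_def q_def
      using trajectory_continuous[OF tr(1), of "{0..T}"] trajectory_continuous[OF tr(2), of "{0..T}"]
      by (intro continuous_intros J.continuous_on; auto)
    ultimately have decay: "\<Lambda> (p T) (q T) \<le> exp (- \<epsilon> * T) * \<Lambda> (p 0) (q 0) + M4 * \<delta>\<^sup>2 / \<epsilon>"
      using \<epsilon> M4 T by (intro gronwall_dissipative[where f' = "\<lambda>t. E' t + \<epsilon> * \<Phi>' t"]) auto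
    have y\<delta>: "(norm (J (p t)))\<^sup>2 \<le> \<delta>\<^sup>2" if "t \<in> {0..T}" for t
      using d[OF that] by (intro power_mono) (auto simp: p_def J.diff)
    have D: "0 \<le> D * (p 0 \<bullet> p 0)" using pos by simp
    have "\<Lambda> (p 0) (q 0) \<le> en (p 0) (q 0) + M3 * \<delta>\<^sup>2"
      using upper[of "p 0" "q 0"] D mult_left_mono[OF y\<delta>[of 0] nn(2)] T by (simp add: en_def)
    then have "exp (- \<epsilon> * T) * \<Lambda> (p 0) (q 0) \<le> exp (- \<epsilon> * T) * (en (p 0) (q 0) + M3 * \<delta>\<^sup>2)"
      by (intro mult_left_mono) auto
    also have "\<dots> \<le> exp (- \<epsilon> * T) * en (p 0) (q 0) + 1 * (M3 * \<delta>\<^sup>2)"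
      unfolding distrib_left using nn \<epsilon> T by (intro add_left_mono mult_right_mono) auto
    finally have 0: "exp (- \<epsilon> * T) * \<Lambda> (p 0) (q 0) \<le> exp (- \<epsilon> * T) * en (p 0) (q 0) + M3 * \<delta>\<^sup>2" by simp
    have "M6 * (norm (J (p T)))\<^sup>2 \<le> M6 * \<delta>\<^sup>2" using y\<delta>[of T] nn T by (intro mult_left_mono) auto
    then have "en (p T) (q T) \<le> 4 * exp (- \<epsilon> * T) * en (p 0) (q 0) + 4 * (M3 * \<delta>\<^sup>2) + 4 * (M4 * \<delta>\<^sup>2 / \<epsilon>) + 4 * (M6 * \<delta>\<^sup>2)"
      using decay 0 lower[of "p T" "q T"] by linarith
    then show "en (p1 T - p2 T) (q1 T - q2 T) \<le> 4 * exp (- \<epsilon> * T) * en (p1 0 - p2 0) (q1 0 - q2 0)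
         + (4 * M3 + 4 * (M4 / \<epsilon>) + 4 * M6) * \<delta>\<^sup>2"
      by (simp add: p_def q_def algebra_simps)
  qed
qed

lemma norm_le_en:
  assumes "en p q \<le> R"
  shows "norm p \<le> sqrt (R / D)" "norm q \<le> sqrt (R / \<alpha>)"
proof -
  have "0 \<le> J q \<bullet> J q" "0 \<le> \<alpha> * (q \<bullet> q)" "0 \<le> D * (p \<bullet> p)" using pos by auto
  then have "D * (p \<bullet> p) \<le> R" "\<alpha> * (q \<bullet> q) \<le> R" using assms unfolding en_def kin_def by linarith+
  then show "norm p \<le> sqrt (R / D)" "norm q \<le> sqrt (R / \<alpha>)"
    using pos by (simp_all add: norm_eq_sqrt_inner field_simps)
qed

lemma en_diff_le: "en (p1 - p2) (q1 - q2) \<le> 2 * en p1 q1 + 2 * en p2 q2"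
proof -
  have *: "(x - y) \<bullet> (x - y) \<le> 2 * (x \<bullet> x) + 2 * (y \<bullet> y)" for x y :: 'a
    using inner_ge_zero[of "x + y"]
    by (simp add: inner_diff_left inner_diff_right inner_add_left inner_add_right inner_commute algebra_simps)
  show ?thesis using *[of "J q1" "J q2"] mult_left_mono[OF *[of q1 q2], of \<alpha>] mult_left_mono[OF *[of p1 p2], of D] pos
    unfolding en_def kin_def J.diff by (simp add: algebra_simps)
qed

text \<open>Equicontinuity in time for the Ascoli argument: the slope w_x moves with velocity v_x,
  whose norm the energy bounds.\<close>

lemma trajectory_Lipschitz:
  assumes tr: "trajectory p q" and st: "0 \<le> s" "s \<le> t" and q: "\<And>r. s < r \<Longrightarrow> r < t \<Longrightarrow> norm (q r) \<le> K"
  shows "norm (J (p t) - J (p s)) \<le> K * (t - s)"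
proof (cases "s = t")
  case False
  then have "s < t" using st by simp
  moreover have "continuous_on {s..t} (\<lambda>t. J (p t))"
    using st by (intro J.continuous_on trajectory_continuous[OF tr]) auto
  moreover have "((\<lambda>t. J (p t)) has_derivative (\<lambda>y. y *\<^sub>R q r)) (at r)" if "s < r" "r < t" for r
    using tr that st unfolding trajectory_def has_vector_derivative_def by auto
  ultimately obtain r where r: "r \<in> {s<..<t}" "norm (J (p t) - J (p s)) \<le> norm ((t - s) *\<^sub>R q r)"
    using mvt_general[of s t "\<lambda>t. J (p t)" "\<lambda>r y. y *\<^sub>R q r"] by blast
  note r(2)
  also have "norm ((t - s) *\<^sub>R q r) \<le> (t - s) * K"
    using q[of r] r st by (auto intro: mult_left_mono)
  finally show ?thesis by (simp add: mult.commute)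
qed simp

text \<open>
  Ascoli's argument: two trajectories that visit the same cells of a fine partition at all nodes of a
  fine time grid have uniformly close \<open>J p\<close>.
\<close>

lemma finite_trajectory_classes:
  assumes compact: "\<And>R e. 0 < e \<Longrightarrow> \<exists>\<U>. finite \<U> \<and> cball 0 R \<subseteq> \<Union>\<U> \<and>
      (\<forall>V\<in>\<U>. \<forall>f\<in>V. \<forall>g\<in>V. norm (J f - J g) \<le> e)"
    and "0 < e"
  obtains T \<V> where "0 \<le> T" "finite \<V>"
    "\<And>p q. trajectory p q \<Longrightarrow> (\<And>t. 0 \<le> t \<Longrightarrow> en (p t) (q t) \<le> R) \<Longrightarrow> (p, q) \<in> \<Union>\<V>"
    "\<And>V p1 q1 p2 q2. V \<in> \<V> \<Longrightarrow> (p1, q1) \<in> V \<Longrightarrow> (p2, q2) \<in> V \<Longrightarrow> en (p1 T - p2 T) (q1 T - q2 T) \<le> e"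
proof (cases "R < 0")
  case True
  \<comment> \<open>No trajectory has negative energy, so the empty family will do.\<close>
  show ?thesis
    by (rule that[of 0 "{}"]) (use True en_nonneg in \<open>auto dest: meta_spec[of _ 0] simp: not_le[symmetric] intro: order_trans\<close>)
next
  case False
  define \<rho> where "\<rho> = sqrt (R / D)"
  define \<sigma> where "\<sigma> = sqrt (R / \<alpha>)"
  have \<sigma>0: "0 \<le> \<sigma>" using False pos by (simp add: \<sigma>_def)
  obtain \<gamma> C where \<gamma>: "0 < \<gamma>" and C: "0 \<le> C" and qs:
    "\<And>p1 q1 p2 q2 T \<delta>. \<lbrakk>trajectory p1 q1; trajectory p2 q2; 0 \<le> T;
       \<And>t. t \<in> {0..T} \<Longrightarrow> norm (J (p1 t)) \<le> \<kappa> * \<rho>; \<And>t. t \<in> {0..T} \<Longrightarrow> norm (J (p2 t)) \<le> \<kappa> * \<rho>;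
       \<And>t. t \<in> {0..T} \<Longrightarrow> norm (J (p1 t) - J (p2 t)) \<le> \<delta>\<rbrakk> \<Longrightarrow>
       en (p1 T - p2 T) (q1 T - q2 T) \<le> 4 * exp (- \<gamma> * T) * en (p1 0 - p2 0) (q1 0 - q2 0) + C * \<delta>\<^sup>2"
    using quasi_stable[of "\<kappa> * \<rho>"] by metis
  \<comment> \<open>By \<open>en_diff_le\<close> two trajectories start at an energy distance of at
    most \<open>4 * R\<close>; a long time brings its share below \<open>e / 2\<close>.\<close>
  have "((\<lambda>T. 4 * exp (- \<gamma> * T) * (4 * R)) \<longlongrightarrow> 4 * 0 * (4 * R)) at_top"
    by (intro tendsto_intros filterlim_compose[OF exp_at_bot]
          filterlim_tendsto_neg_mult_at_bot[OF tendsto_const _ filterlim_ident])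
       (use \<gamma> in auto)
  then have "\<forall>\<^sub>F T in at_top. 4 * exp (- \<gamma> * T) * (4 * R) < e / 2"
    by (rule order_tendstoD) (use \<open>0 < e\<close> in simp)
  moreover have "\<forall>\<^sub>F T in at_top. 0 < (T::real)" by (rule eventually_gt_at_top)
  ultimately have "\<forall>\<^sub>F T in at_top. 4 * exp (- \<gamma> * T) * (4 * R) < e / 2 \<and> 0 < T"
    by (rule eventually_conj)
  then obtain T where T: "4 * exp (- \<gamma> * T) * (4 * R) < e / 2" "0 < T"
    using eventually_happens'[OF trivial_limit_at_top_linorder] by blast
  \<comment> \<open>Chosen such that \<open>C * \<delta>\<^sup>2\<close> is at most
    \<open>e / 2\<close>; \<open>C + 1\<close> avoids a division by zero.\<close>
  define \<delta> where "\<delta> = sqrt (e / (2 * (C + 1)))"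
  have \<delta>: "0 < \<delta>" using \<open>0 < e\<close> C by (simp add: \<delta>_def)
  have "C * \<delta>\<^sup>2 \<le> (C + 1) * \<delta>\<^sup>2" by (simp add: mult_right_mono)
  also have "\<dots> = e / 2" using \<open>0 < e\<close> C by (simp add: \<delta>_def field_simps)
  finally have C\<delta>: "C * \<delta>\<^sup>2 \<le> e / 2" .
  \<comment> \<open>So many nodes that \<open>J p\<close> moves by at most
    \<open>\<delta> / 3\<close> from one to the next.\<close>
  obtain N :: nat where N: "3 * \<sigma> * T / \<delta> < real N" using reals_Archimedean2 by blast
  have N0: "0 < real N" using N \<sigma>0 T \<delta> by (smt (verit) divide_nonneg_pos mult_nonneg_nonneg)
  have mesh: "\<sigma> * (T / real N) \<le> \<delta> / 3" using N N0 \<delta> by (simp add: field_simps)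
  obtain \<U> where \<U>: "finite \<U>" "cball 0 \<rho> \<subseteq> \<Union>\<U>"
     and small: "\<And>V f g. V \<in> \<U> \<Longrightarrow> f \<in> V \<Longrightarrow> g \<in> V \<Longrightarrow> norm (J f - J g) \<le> \<delta> / 3"
    using compact[of "\<delta> / 3" \<rho>] \<delta> by fastforce
  define node where "node j = T * real j / real N" for j
  define Tr where "Tr = {(p, q). trajectory p q \<and> (\<forall>t\<ge>0. en (p t) (q t) \<le> R)}"
  \<comment> \<open>A cell is indexed by a list of partition sets, one for each of the
    \<open>N + 1\<close> nodes from 0 to \<open>T\<close>.\<close>
  define cell where "cell Vs = {(p, q) \<in> Tr. \<forall>j<Suc N. p (node j) \<in> Vs ! j}" for Vs
  define \<V> where "\<V> = cell ` {Vs. set Vs \<subseteq> \<U> \<and> length Vs = Suc N}"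
  have node0: "0 \<le> node j" for j using T N0 by (simp add: node_def)
  show ?thesis
  proof
    show "0 \<le> T" using T by simp
    show "finite \<V>" unfolding \<V>_def by (intro finite_imageI finite_lists_length_eq \<U>)
    show "(p, q) \<in> \<Union>\<V>" if tr: "trajectory p q" and R: "\<And>t. 0 \<le> t \<Longrightarrow> en (p t) (q t) \<le> R" for p q
    proof -
      have "\<exists>V\<in>\<U>. p (node j) \<in> V" for j
        using norm_le_en(1)[OF R[OF node0[of j]]] \<U>(2) by (auto simp: \<rho>_def subset_eq)
      then obtain v where v: "\<And>j. v j \<in> \<U>" "\<And>j. p (node j) \<in> v j" by metis
      have "(p, q) \<in> cell (map v [0..<Suc N])"
        using tr R v(2) unfolding cell_def Tr_def by (auto simp del: upt_Suc)
      moreover have "map v [0..<Suc N] \<in> {Vs. set Vs \<subseteq> \<U> \<and> length Vs = Suc N}" using v(1) by auto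
      ultimately show ?thesis unfolding \<V>_def by blast
    qed
    fix V p1 q1 p2 q2 assume V: "V \<in> \<V>" and 1: "(p1, q1) \<in> V" and 2: "(p2, q2) \<in> V"
    then obtain Vs where Vs: "set Vs \<subseteq> \<U>" "length Vs = Suc N" and V: "V = cell Vs"
      unfolding \<V>_def by blast
    have tr: "trajectory p1 q1" "trajectory p2 q2"
      and R: "\<And>t. 0 \<le> t \<Longrightarrow> en (p1 t) (q1 t) \<le> R" "\<And>t. 0 \<le> t \<Longrightarrow> en (p2 t) (q2 t) \<le> R"
      and at_node: "\<And>j. j < Suc N \<Longrightarrow> p1 (node j) \<in> Vs ! j" "\<And>j. j < Suc N \<Longrightarrow> p2 (node j) \<in> Vs ! j"
      using 1 2 unfolding V cell_def Tr_def by auto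
    have Jb: "norm (J x) \<le> \<kappa> * \<rho>" if "en x y \<le> R" for x y
      using \<kappa>(2)[of x] mult_left_mono[OF norm_le_en(1)[OF that] \<kappa>(1)] unfolding \<rho>_def by linarith
    have close: "norm (J (p1 t) - J (p2 t)) \<le> \<delta>" if t: "t \<in> {0..T}" for t
    proof -
      \<comment> \<open>The last node not after \<open>t\<close>; for \<open>t = T\<close> it is the
        node \<open>N\<close>.\<close>
      define j where "j = nat \<lfloor>t * real N / T\<rfloor>"
      have tN: "0 \<le> t * real N / T" using t T N0 by simp
      have j1: "real j \<le> t * real N / T" "t * real N / T < real j + 1"
        using tN unfolding j_def by linarith+
      have "t < T * (real j + 1) / real N" "node j \<le> t"
        using j1 T N0 unfolding node_def by (simp_all add: field_simps)
      then have jt: "node j \<le> t" "t - node j \<le> T / real N"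
        unfolding node_def distrib_left add_divide_distrib by simp_all
      have "real j \<le> real N" using j1(1) t T N0 by (smt (verit) atLeastAtMost_iff divide_le_eq mult.commute mult_left_mono)
      then have jN: "j < Suc N" by simp
      have L: "norm (J (p t) - J (p (node j))) \<le> \<delta> / 3"
        if "trajectory p q" "\<And>t. 0 \<le> t \<Longrightarrow> en (p t) (q t) \<le> R" for p q
      proof -
        have "norm (J (p t) - J (p (node j))) \<le> \<sigma> * (t - node j)"
        proof (rule trajectory_Lipschitz[OF that(1) node0 jt(1)])
          fix r assume "node j < r"
          then have "0 \<le> r" using node0[of j] by simp
          then show "norm (q r) \<le> \<sigma>" unfolding \<sigma>_def by (rule norm_le_en(2)[OF that(2)])
        qed
        also have "\<dots> \<le> \<sigma> * (T / real N)" using jt \<sigma>0 by (intro mult_left_mono)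
        also note mesh
        finally show ?thesis .
      qed
      have "Vs ! j \<in> \<U>" using Vs jN by (auto simp: subset_eq)
      then have "norm (J (p1 (node j)) - J (p2 (node j))) \<le> \<delta> / 3"
        using small at_node jN by blast
      \<comment> \<open>From \<open>t\<close> to the node on each trajectory and across one cell in
        between: three times \<open>\<delta> / 3\<close>.\<close>
      moreover have "norm (a - d) \<le> norm (a - b) + norm (b - c) + norm (d - c)" for a b c d :: 'a
        using norm_triangle_ineq4[of "(a - b) + (b - c)" "d - c"] norm_triangle_ineq[of "a - b" "b - c"]
        by simp
      note this[of "J (p1 t)" "J (p2 t)" "J (p1 (node j))" "J (p2 (node j))"]
      ultimately show ?thesis using L[OF tr(1) R(1)] L[OF tr(2) R(2)] by linarith
    qed
    have "en (p1 T - p2 T) (q1 T - q2 T) \<le> 4 * exp (- \<gamma> * T) * en (p1 0 - p2 0) (q1 0 - q2 0) + C * \<delta>\<^sup>2"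
      by (rule qs[OF tr]) (use T Jb[OF R(1)] Jb[OF R(2)] close in auto)
    also have "\<dots> \<le> 4 * exp (- \<gamma> * T) * (4 * R) + e / 2"
    proof (intro add_mono C\<delta> mult_left_mono)
      show "en (p1 0 - p2 0) (q1 0 - q2 0) \<le> 4 * R"
        using en_diff_le[of "p1 0" "p2 0" "q1 0" "q2 0"] R(1)[of 0] R(2)[of 0] by simp
    qed simp
    also have "\<dots> \<le> e" using T(1) by simp
    finally show "en (p1 T - p2 T) (q1 T - q2 T) \<le> e" .
  qed
qed

end

section \<open>Test functions and weak derivatives\<close>

definition smooth :: "(real \<Rightarrow> real) \<Rightarrow> bool" where
  "smooth f \<longleftrightarrow> (\<forall>n x. ((deriv ^^ n) f) differentiable (at x))"

text \<open>Exhibiting a class that is closed under differentiation replaces an induction over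
  explicit formulas for the n-th derivative.\<close>

lemma smooth_coinduct:
  assumes "f \<in> F" and step: "\<And>f. f \<in> F \<Longrightarrow> \<exists>f'\<in>F. \<forall>x. (f has_real_derivative f' x) (at x)"
  shows "smooth f"
proof -
  have d: "deriv f \<in> F \<and> (\<forall>x. f differentiable (at x))" if "f \<in> F" for f
  proof -
    from step[OF that] obtain f' where f': "f' \<in> F" "\<And>x. (f has_real_derivative f' x) (at x)" by blast
    then have "deriv f = f'" by (intro ext DERIV_imp_deriv)
    then show ?thesis using f' by (auto simp: real_differentiable_def)
  qed
  have "(deriv ^^ n) f \<in> F" for n by (induction n) (use assms(1) d in auto)
  then show ?thesis using d by (auto simp: smooth_def)
qed

lemma smooth_has_derivative: "smooth f \<Longrightarrow> (f has_real_derivative deriv f x) (at x)"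
  unfolding smooth_def by (metis DERIV_deriv_iff_real_differentiable funpow_0)

lemma smooth_deriv: "smooth f \<Longrightarrow> smooth (deriv f)"
  unfolding smooth_def by (metis funpow_Suc_right o_apply)

lemma smooth_continuous: "smooth f \<Longrightarrow> continuous_on S f"
  by (meson smooth_has_derivative DERIV_continuous_on has_field_derivative_at_within)

lemma smooth_antiderivative:
  assumes "\<And>x. (f has_real_derivative g x) (at x)" "smooth g"
  shows "smooth f"
proof (rule smooth_coinduct[of f "insert f {h. smooth h}"])
  fix h assume "h \<in> insert f {h. smooth h}"
  then show "\<exists>f'\<in>insert f {h. smooth h}. \<forall>x. (h has_real_derivative f' x) (at x)"
    using assms smooth_deriv smooth_has_derivative by blast
qed simp

lemma smooth_lincomb:
  assumes "smooth f" "smooth g"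
  shows "smooth (\<lambda>x. a * f x + b * g x)"
proof (rule smooth_coinduct[of _ "{\<lambda>x. a * f x + b * g x |f g. smooth f \<and> smooth g}"])
  fix h assume "h \<in> {\<lambda>x. a * f x + b * g x |f g. smooth f \<and> smooth g}"
  then obtain f g where h: "h = (\<lambda>x. a * f x + b * g x)" and "smooth f" "smooth g" by blast
  then have "(h has_real_derivative (a * deriv f x + b * deriv g x)) (at x)" for x
    unfolding h by (intro DERIV_add DERIV_cmult smooth_has_derivative)
  moreover have "smooth (deriv f)" "smooth (deriv g)" using \<open>smooth f\<close> \<open>smooth g\<close> smooth_deriv by auto
  ultimately show "\<exists>f'\<in>{\<lambda>x. a * f x + b * g x |f g. smooth f \<and> smooth g}. \<forall>x. (h has_real_derivative f' x) (at x)"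
    by (intro bexI[of _ "\<lambda>x. a * deriv f x + b * deriv g x"]) auto
qed (use assms in blast)

lemma smooth_affine:
  assumes "smooth f"
  shows "smooth (\<lambda>x. f (a * x + b))"
proof (rule smooth_coinduct[of _ "{\<lambda>x. c * f (a * x + b) |c f. smooth f}"])
  fix h assume "h \<in> {\<lambda>x. c * f (a * x + b) |c f. smooth f}"
  then obtain c f where h: "h = (\<lambda>x. c * f (a * x + b))" and "smooth f" by blast
  have "((\<lambda>x. f (a * x + b)) has_real_derivative (deriv f (a * x + b) * a)) (at x)" for x
    by (rule DERIV_chain2[of f _ "\<lambda>x. a * x + b"]) (auto intro!: derivative_eq_intros smooth_has_derivative \<open>smooth f\<close>)
  then have "(h has_real_derivative ((c * a) * deriv f (a * x + b))) (at x)" for x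
    unfolding h using DERIV_cmult by (metis mult.assoc mult.commute)
  then show "\<exists>f'\<in>{\<lambda>x. c * f (a * x + b) |c f. smooth f}. \<forall>x. (h has_real_derivative f' x) (at x)"
    using smooth_deriv[OF \<open>smooth f\<close>] by (intro bexI[of _ "\<lambda>x. (c * a) * deriv f (a * x + b)"]) auto
next
  show "(\<lambda>x. f (a * x + b)) \<in> {\<lambda>x. c * f (a * x + b) |c f. smooth f}"
    using assms by (auto intro!: exI[of _ 1] exI[of _ f])
qed

text \<open>Products alone are not closed under differentiation; finite sums of products
  are.\<close>

inductive_set product_sums :: "(real \<Rightarrow> real) set" where
  prod: "smooth f \<Longrightarrow> smooth g \<Longrightarrow> (\<lambda>x. f x * g x) \<in> product_sums"
| add: "f \<in> product_sums \<Longrightarrow> g \<in> product_sums \<Longrightarrow> (\<lambda>x. f x + g x) \<in> product_sums"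

lemma smooth_mult:
  assumes "smooth f" "smooth g"
  shows "smooth (\<lambda>x. f x * g x)"
proof (rule smooth_coinduct[of _ product_sums])
  show "\<exists>f'\<in>product_sums. \<forall>x. (f has_real_derivative f' x) (at x)" if "f \<in> product_sums" for f
    using that
  proof induction
    case (prod f g)
    then have "(\<lambda>x. deriv f x * g x + f x * deriv g x) \<in> product_sums"
      by (intro product_sums.intros smooth_deriv)
    moreover have "((\<lambda>x. f x * g x) has_real_derivative (deriv f x * g x + f x * deriv g x)) (at x)" for x
      using DERIV_mult[OF prod[THEN smooth_has_derivative]] by (simp add: algebra_simps)
    ultimately show ?case by (intro bexI[of _ "\<lambda>x. deriv f x * g x + f x * deriv g x"] allI)
  next
    case (add f g)
    then obtain f' g' where "f' \<in> product_sums" "g' \<in> product_sums"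
      "\<And>x. (f has_real_derivative f' x) (at x)" "\<And>x. (g has_real_derivative g' x) (at x)" by blast
    then show ?case by (intro bexI[of _ "\<lambda>x. f' x + g' x"] allI product_sums.add DERIV_add)
  qed
qed (use assms in \<open>auto intro: product_sums.intros\<close>)

definition flat :: "real \<Rightarrow> real" where
  "flat x = (if 0 < x then exp (- (1 / x)) else 0)"

lemma poly_exp_tendsto_0: "((\<lambda>y. poly P y * exp (- y)) \<longlongrightarrow> (0::real)) at_top"
proof -
  have "((\<lambda>y. \<Sum>i\<le>degree P. coeff P i * (y ^ i / exp y)) \<longlongrightarrow> (\<Sum>i\<le>degree P. coeff P i * 0)) at_top"
    by (intro tendsto_sum tendsto_mult tendsto_const tendsto_power_div_exp_0)
  then show ?thesis
    by (simp add: poly_altdef sum_distrib_right exp_minus divide_inverse mult.assoc)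
qed

text \<open>Polynomials in 1/x times exp(-1/x), extended by 0 to the left half-line, form a class
  closed under differentiation.\<close>

lemma smooth_flat: "smooth flat"
proof (rule smooth_coinduct[of _ "range (\<lambda>P x. if 0 < x then poly P (1 / x) * exp (- (1 / x)) else 0)"])
  show "flat \<in> range (\<lambda>P x. if 0 < x then poly P (1 / x) * exp (- (1 / x)) else 0)"
    by (intro image_eqI[of _ _ "[:1:]"]) (auto simp: flat_def)
  fix f assume "f \<in> range (\<lambda>P x. if 0 < x then poly P (1 / x) * exp (- (1 / x)) else (0::real))"
  then obtain P where f: "f = (\<lambda>x. if 0 < x then poly P (1 / x) * exp (- (1 / x)) else 0)" by blast
  \<comment> \<open>By the chain rule the polynomial and the exponential both bring out a factor
    \<open>1 / x\<^sup>2\<close>, with opposite signs.\<close>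
  define Q where "Q = [:0, 0, 1:] * (P - pderiv P)"
  let ?f' = "\<lambda>x. if 0 < x then poly Q (1 / x) * exp (- (1 / x)) else 0"
  have "(f has_real_derivative ?f' x) (at x)" for x
  proof -
    consider "0 < x" | "x < 0" | "x = 0" by linarith
    then show ?thesis
    proof cases
      case 1
      have d: "((\<lambda>x. poly P (1 / x) * exp (- (1 / x))) has_real_derivative poly Q (1 / x) * exp (- (1 / x))) (at x)"
      proof -
        have inv: "((\<lambda>x. 1 / x) has_real_derivative - (1 / x\<^sup>2)) (at x)"
          using 1 by (auto intro!: derivative_eq_intros simp: power2_eq_square)
        have e: "((\<lambda>x. exp (- (1 / x))) has_real_derivative exp (- (1 / x)) * (1 / x\<^sup>2)) (at x)"
          using DERIV_chain2[OF DERIV_exp DERIV_minus[OF inv]] by simp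
        show ?thesis
          by (rule DERIV_cong[OF DERIV_mult[OF DERIV_chain2[OF poly_DERIV inv] e]])
             (simp add: Q_def algebra_simps power2_eq_square)
      qed
      have "(f has_real_derivative poly Q (1 / x) * exp (- (1 / x))) (at x)"
        by (rule has_field_derivative_transform_within_open[OF d, of "{0<..}"]) (use 1 in \<open>auto simp: f\<close>)
      then show ?thesis using 1 by simp
    next
      case 2
      have "(f has_real_derivative 0) (at x)"
        by (rule has_field_derivative_transform_within_open[OF DERIV_const, of "{..<0}"]) (use 2 in \<open>auto simp: f\<close>)
      then show ?thesis using 2 by simp
    next
      case 3
      \<comment> \<open>At 0 the difference quotient contributes one more power of
        \<open>1 / y\<close>, and the exponential still wins.\<close>
      have "((\<lambda>y. f y / y) \<longlongrightarrow> 0) (at_right 0)"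
      proof (rule Lim_transform_eventually)
        show "((\<lambda>y. poly (pCons 0 P) (inverse y) * exp (- inverse y)) \<longlongrightarrow> 0) (at_right 0)"
          by (rule filterlim_compose[OF poly_exp_tendsto_0 filterlim_inverse_at_top_right])
        show "\<forall>\<^sub>F y in at_right 0. poly (pCons 0 P) (inverse y) * exp (- inverse y) = f y / y"
          using eventually_at_right_less[of 0] by eventually_elim (simp add: f divide_inverse)
      qed
      moreover have "((\<lambda>y. f y / y) \<longlongrightarrow> 0) (at_left 0)"
        by (rule Lim_transform_eventually[of "\<lambda>_. 0"])
           (auto simp: f eventually_at_filter)
      ultimately have "((\<lambda>y. f y / y) \<longlongrightarrow> 0) (at 0)" by (simp add: filterlim_split_at)
      then show ?thesis using 3 by (simp add: has_field_derivative_iff f)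
    qed
  qed
  then have "\<forall>x. (f has_real_derivative ?f' x) (at x)" by blast
  moreover have "?f' \<in> range (\<lambda>P x. if 0 < x then poly P (1 / x) * exp (- (1 / x)) else (0::real))"
    by (rule rangeI)
  ultimately show "\<exists>f'\<in>range (\<lambda>P x. if 0 < x then poly P (1 / x) * exp (- (1 / x)) else 0).
     \<forall>x. (f has_real_derivative f' x) (at x)" by (rule bexI)
qed

lemma test_functions_iff:
  "\<theta> \<in> test_functions a b \<longleftrightarrow> smooth \<theta> \<and> (\<exists>c d. a < c \<and> d < b \<and> (\<forall>x. x \<notin> {c..d} \<longrightarrow> \<theta> x = 0))"
  if "a < b" for a b :: real
proof
  assume t: "\<theta> \<in> test_functions a b"
  let ?K = "closure {x. \<theta> x \<noteq> 0}"
  have K: "compact ?K" "?K \<subseteq> {a<..<b}" using t by (auto simp: test_functions_def)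
  have 0: "x \<notin> ?K \<Longrightarrow> \<theta> x = 0" for x using closure_subset[of "{x. \<theta> x \<noteq> 0}"] by blast
  have "\<exists>c d. a < c \<and> d < b \<and> (\<forall>x. x \<notin> {c..d} \<longrightarrow> \<theta> x = 0)"
  proof (cases "?K = {}")
    case True
    then have "\<theta> x = 0" for x using 0[of x] by simp
    moreover have "a < (a + b) / 2" "(a + b) / 2 < b" using \<open>a < b\<close> by auto
    ultimately show ?thesis by blast
  next
    case False
    obtain c where c: "c \<in> ?K" "\<And>x. x \<in> ?K \<Longrightarrow> c \<le> x" using compact_attains_inf[OF K(1) False] by blast
    obtain d where d: "d \<in> ?K" "\<And>x. x \<in> ?K \<Longrightarrow> x \<le> d" using compact_attains_sup[OF K(1) False] by blast
    have "a < c" "d < b" using subsetD[OF K(2) c(1)] subsetD[OF K(2) d(1)] by (simp_all only: greaterThanLessThan_iff)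
    moreover have "\<theta> x = 0" if "x \<notin> {c..d}" for x
      using that c(2)[of x] d(2)[of x] 0[of x] by (metis atLeastAtMost_iff)
    ultimately show ?thesis by blast
  qed
  then obtain c d where cd: "a < c" "d < b" "\<And>x. x \<notin> {c..d} \<Longrightarrow> \<theta> x = 0" by blast
  then show "smooth \<theta> \<and> (\<exists>c d. a < c \<and> d < b \<and> (\<forall>x. x \<notin> {c..d} \<longrightarrow> \<theta> x = 0))"
    using t by (auto simp: test_functions_def smooth_def)
next
  assume "smooth \<theta> \<and> (\<exists>c d. a < c \<and> d < b \<and> (\<forall>x. x \<notin> {c..d} \<longrightarrow> \<theta> x = 0))"
  then obtain c d where cd: "a < c" "d < b" "\<And>x. x \<notin> {c..d} \<Longrightarrow> \<theta> x = 0" and s: "smooth \<theta>" by blast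
  have "{x. \<theta> x \<noteq> 0} \<subseteq> {c..d}" using cd(3) by blast
  then have "closure {x. \<theta> x \<noteq> 0} \<subseteq> {c..d}" by (rule closure_minimal) simp
  moreover from this have "compact (closure {x. \<theta> x \<noteq> 0})"
    using bounded_subset[OF bounded_closed_interval, of _ c d] by (auto simp: compact_eq_bounded_closed bounded_closed_interval)
  ultimately show "\<theta> \<in> test_functions a b" using s cd by (auto simp: test_functions_def smooth_def)
qed

text \<open>As \<open>flat (n x)\<close> is the \<open>n\<close>-th root of \<open>flat x\<close>, these functions tend to an indicator function.\<close>

definition bump :: "real \<Rightarrow> real \<Rightarrow> nat \<Rightarrow> real \<Rightarrow> real" where
  "bump c d n x = flat (real (Suc n) * (x - c)) * flat (real (Suc n) * (d - x))"

lemma bump_test_function: "bump c d n \<in> test_functions a b" if "a < c" "c < d" "d < b"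
proof -
  have "smooth (\<lambda>x. flat (real (Suc n) * x + (- real (Suc n) * c)) * flat (- real (Suc n) * x + real (Suc n) * d))"
    by (intro smooth_mult smooth_affine smooth_flat)
  moreover have "(\<lambda>x. flat (real (Suc n) * x + (- real (Suc n) * c)) * flat (- real (Suc n) * x + real (Suc n) * d)) = bump c d n"
    by (simp add: bump_def fun_eq_iff algebra_simps)
  ultimately have "smooth (bump c d n)" by simp
  moreover have "bump c d n x = 0" if "x \<notin> {c..d}" for x
    using that by (auto simp: bump_def flat_def zero_less_mult_iff)
  ultimately show ?thesis using that by (subst test_functions_iff) auto
qed

lemma flat_bounds: "0 \<le> flat x" "flat x \<le> 1" by (auto simp: flat_def)

lemma bump_bounds: "0 \<le> bump c d n x" "bump c d n x \<le> indicator {c<..<d} x"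
proof -
  show "0 \<le> bump c d n x" by (simp add: bump_def flat_bounds)
  have "bump c d n x \<le> 1" unfolding bump_def using flat_bounds by (intro mult_le_one) auto
  moreover have "bump c d n x = 0" if "x \<notin> {c<..<d}"
    using that by (auto simp: bump_def flat_def zero_less_mult_iff)
  ultimately show "bump c d n x \<le> indicator {c<..<d} x" by (auto simp: indicator_def)
qed

lemma bump_tendsto: "(\<lambda>n. bump c d n x) \<longlonglongrightarrow> indicator {c<..<d} x"
proof (cases "x \<in> {c<..<d}")
  case True
  have f: "(\<lambda>n. flat (real (Suc n) * y)) \<longlonglongrightarrow> 1" if "0 < y" for y
  proof -
    have "(\<lambda>n. exp (- (1 / y * (1 / real (Suc n))))) \<longlonglongrightarrow> exp (- (1 / y * 0))"
      by (intro tendsto_intros LIMSEQ_Suc[OF lim_1_over_n])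
    moreover have "exp (- (1 / y * (1 / real (Suc n)))) = flat (real (Suc n) * y)" for n
      using that by (simp add: flat_def mult.commute)
    ultimately show ?thesis by simp
  qed
  have "(\<lambda>n. bump c d n x) \<longlonglongrightarrow> 1 * 1"
    unfolding bump_def using True by (intro tendsto_mult f) auto
  then show ?thesis using True by simp
next
  case False
  then have "bump c d n x = 0" for n
    using bump_bounds[of c d n x] unfolding indicator_simps(2)[OF False] by simp
  then show ?thesis using False by simp
qed

section \<open>The fundamental lemma of the calculus of variations\<close>

lemma continuous_borel_measurable_lebesgue:
  fixes f :: "real \<Rightarrow> real"
  assumes "continuous_on UNIV f"
  shows "f \<in> borel_measurable lebesgue"
proof -
  have "f \<in> borel_measurable lborel" using borel_measurable_continuous_onI[OF assms] by simp
  then show ?thesis by (rule measurable_completion)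
qed

text \<open>The positive and negative parts of \<open>h\<close> are densities of two finite measures
  that agree on half-lines, hence on all Borel sets. For this the argument passes to
  \<open>lborel\<close> and to a Borel version \<open>h'\<close> of \<open>h\<close>.\<close>

lemma AE_zero_of_tails:
  fixes h :: "real \<Rightarrow> real"
  assumes h: "integrable lebesgue h"
    and tail: "\<And>x. (LINT y|lebesgue. indicator {x<..} y * h y) = 0"
  shows "AE x in lebesgue. h x = 0"
proof -
  have "h \<in> borel_measurable (completion lborel)" using h by simp
  then obtain h' where h': "h' \<in> borel_measurable lborel" and eq: "AE x in lborel. h x = h' x"
    using completion_ex_borel_measurable_real by blast
  note [measurable] = h'
  have eqL: "AE x in lebesgue. h x = h' x" using AE_completion[OF eq] .
  have hL: "h' \<in> borel_measurable lebesgue" using measurable_completion[OF h'] .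
  have "integrable lebesgue h'" using h eqL hL by (subst integrable_cong_AE[symmetric, of h]) auto
  then have ih': "integrable lborel h'" using integrable_completion[OF h'] by simp
  have tail': "(LINT y|lborel. indicator {x<..} y * h' y) = 0" for x
  proof -
    have "(LINT y|lborel. indicator {x<..} y * h' y) = (LINT y|lebesgue. indicator {x<..} y * h' y)"
      by (rule integral_completion[symmetric]) simp
    also have "\<dots> = (LINT y|lebesgue. indicator {x<..} y * h y)"
    proof (rule integral_cong_AE)
      show "(\<lambda>y. indicat_real {x<..} y * h y) \<in> borel_measurable lebesgue"
        using borel_measurable_integrable[OF h] by (intro borel_measurable_times borel_measurable_indicator) auto
      show "AE y in lebesgue. indicat_real {x<..} y * h' y = indicat_real {x<..} y * h y"
        using eqL by eventually_elim simp
    qed (intro borel_measurable_times borel_measurable_indicator hL; simp)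
    finally show ?thesis using tail by simp
  qed
  let ?M = "density lborel (\<lambda>x. ennreal (h' x))" and ?N = "density lborel (\<lambda>x. ennreal (- h' x))"
  have ih'x: "integrable lborel (\<lambda>y. indicator {x<..} y * h' y)" for x
    using integrable_mult_indicator[OF _ ih', of "{x<..}"] by simp
  have em: "emeasure ?M {x<..} = (\<integral>\<^sup>+ y. ennreal (indicator {x<..} y * h' y) \<partial>lborel)" for x
    by (subst emeasure_density) (auto intro!: nn_integral_cong split: split_indicator)
  have en: "emeasure ?N {x<..} = (\<integral>\<^sup>+ y. ennreal (- (indicator {x<..} y * h' y)) \<partial>lborel)" for x
    by (subst emeasure_density) (auto intro!: nn_integral_cong split: split_indicator)
  have fin: "emeasure ?M {x<..} < \<infinity>" "emeasure ?N {x<..} < \<infinity>" for x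
    using ih'x[of x] unfolding em en real_integrable_def by (simp_all add: less_top)
  have "?M = ?N"
  proof (rule measure_eqI_lessThan)
    show "emeasure ?M {x<..} = emeasure ?N {x<..}" for x
    proof -
      have "enn2real (emeasure ?M {x<..}) - enn2real (emeasure ?N {x<..}) = 0"
        using tail'[of x] real_lebesgue_integral_def[OF ih'x[of x]] unfolding em en by simp
      then show ?thesis using fin[of x] by (metis eq_iff_diff_eq_0 ennreal_enn2real infinity_ennreal_def)
    qed
  qed (use fin in auto)
  then have "AE x in lborel. ennreal (h' x) = ennreal (- h' x)"
    by (intro sigma_finite_measure.density_unique[OF sigma_finite_lborel]) auto
  then have "AE x in lborel. h x = 0" using eq
  proof eventually_elim
    case (elim x)
    then show ?case by (cases "0 < h' x"; cases "h' x < 0") (auto simp: ennreal_neg)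
  qed
  then show ?thesis by (rule AE_completion)
qed

lemma locally_integrable_Icc:
  assumes "locally_integrable a b g" "a < c" "d < b"
  shows "integrable lebesgue (\<lambda>x. indicator {c..d} x * g x)"
proof -
  have "integrable (lebesgue_on {c..d}) g"
    using assms unfolding locally_integrable_def by (elim allE[of _ "{c..d}"]) auto
  then show ?thesis by (subst (asm) integrable_restrict_space) auto
qed

lemma integral_lebesgue_on_indicator:
  fixes f :: "real \<Rightarrow> real"
  assumes "S \<in> sets lebesgue"
  shows "(LINT x|lebesgue_on S. f x) = (LINT x|lebesgue. indicator S x * f x)"
  using assms by (subst integral_restrict_space) auto

lemma integral_lebesgue_on_vanishing:
  fixes f :: "real \<Rightarrow> real"
  assumes "S \<in> sets lebesgue" "\<And>x. x \<notin> S \<Longrightarrow> f x = 0"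
  shows "(LINT x|lebesgue_on S. f x) = (LINT x|lebesgue. f x)"
  unfolding integral_lebesgue_on_indicator[OF assms(1)]
  by (intro Bochner_Integration.integral_cong) (auto simp: assms(2) indicator_def)

lemma test_function_props:
  assumes "a < b" "\<theta> \<in> test_functions a b"
  obtains c d where "smooth \<theta>" "a < c" "d < b" "\<And>x. x \<notin> {c..d} \<Longrightarrow> \<theta> x = 0" "\<And>x. x \<notin> {c..d} \<Longrightarrow> deriv \<theta> x = 0"
proof -
  obtain c d where *: "smooth \<theta>" "a < c" "d < b" "\<And>x. x \<notin> {c..d} \<Longrightarrow> \<theta> x = 0"
    using test_functions_iff[OF assms(1)] assms(2) by blast
  have "deriv \<theta> x = 0" if "x \<notin> {c..d}" for x
  proof -
    have "(\<theta> has_real_derivative 0) (at x)"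
      by (rule has_field_derivative_transform_within_open[OF DERIV_const, of "- {c..d}"])
         (use that in \<open>auto simp: *(4)\<close>)
    then show ?thesis by (rule DERIV_imp_deriv)
  qed
  with * that show ?thesis by blast
qed

lemma test_functions_deriv:
  assumes "a < b" "\<theta> \<in> test_functions a b"
  shows "deriv \<theta> \<in> test_functions a b"
  using test_function_props[OF assms] smooth_deriv unfolding test_functions_iff[OF assms(1)] by metis

lemma integrable_mult_test:
  assumes "a < b" "locally_integrable a b f" "\<theta> \<in> test_functions a b"
  shows "integrable lebesgue (\<lambda>x. f x * \<theta> x)"
proof -
  obtain c d where cd: "smooth \<theta>" "a < c" "d < b" "\<And>x. x \<notin> {c..d} \<Longrightarrow> \<theta> x = 0"
    using test_function_props[OF assms(1,3)] by metis
  have cont: "continuous_on S \<theta>" for S using smooth_continuous cd(1) .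
  have "bounded (\<theta> ` {c..d})" by (intro compact_imp_bounded compact_continuous_image cont) auto
  then obtain B where "\<forall>x\<in>{c..d}. \<bar>\<theta> x\<bar> \<le> B" by (auto simp: bounded_iff)
  then have B: "\<And>x. x \<in> {c..d} \<Longrightarrow> \<bar>\<theta> x\<bar> \<le> B" by blast
  have i: "integrable lebesgue (\<lambda>x. indicator {c..d} x * f x)"
    using locally_integrable_Icc assms(2) cd by blast
  have "integrable lebesgue (\<lambda>x. (indicator {c..d} x * f x) * \<theta> x)"
  proof (rule Bochner_Integration.integrable_bound)
    show "integrable lebesgue (\<lambda>x. (indicator {c..d} x * f x) * B)" using i by simp
    show "(\<lambda>x. (indicator {c..d} x * f x) * \<theta> x) \<in> borel_measurable lebesgue"
      using borel_measurable_integrable[OF i] continuous_borel_measurable_lebesgue[OF cont]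
      by (rule borel_measurable_times)
    show "AE x in lebesgue. norm ((indicator {c..d} x * f x) * \<theta> x) \<le> norm ((indicator {c..d} x * f x) * B)"
      using B by (intro AE_I2) (auto simp: abs_mult indicator_def intro!: mult_left_mono order_trans[OF B])
  qed
  also have "(\<lambda>x. (indicator {c..d} x * f x) * \<theta> x) = (\<lambda>x. f x * \<theta> x)"
    using cd(4) by (auto simp: fun_eq_iff indicator_def)
  finally show ?thesis .
qed

lemma integral_test:
  assumes "a < b" "\<theta> \<in> test_functions a b"
  shows "(LINT x|lebesgue_on {a<..<b}. f x * \<theta> x) = (LINT x|lebesgue. f x * \<theta> x)"
proof -
  obtain c d where "a < c" "d < b" "\<And>x. x \<notin> {c..d} \<Longrightarrow> \<theta> x = 0"
    using test_function_props[OF assms] by metis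
  then show ?thesis by (intro integral_lebesgue_on_vanishing) auto
qed

text \<open>The bumps tend boundedly to indicator functions, so \<open>g\<close> has integral 0 over
  each interval compactly contained in \<open>(a, b)\<close>, and \<open>AE_zero_of_tails\<close>
  applies there. Rational end points exhaust \<open>(a, b)\<close> at the price of countably many
  null sets.\<close>

lemma AE_zero_of_test_functions:
  assumes ab: "a < b" and loc: "locally_integrable a b g"
    and zero: "\<And>\<theta>. \<theta> \<in> test_functions a b \<Longrightarrow> (LINT x|lebesgue. g x * \<theta> x) = 0"
  shows "AE x in lebesgue_on {a<..<b}. g x = 0"
proof -
  have ig: "integrable lebesgue (\<lambda>x. indicator {c<..<d} x * g x)" if "a < c" "d < b" for c d
  proof -
    have "integrable lebesgue (\<lambda>x. indicator {c<..<d} x *\<^sub>R (indicator {c..d} x * g x))"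
      using locally_integrable_Icc[OF loc that] by (intro integrable_mult_indicator) auto
    moreover have "(\<lambda>x. indicator {c<..<d} x *\<^sub>R (indicator {c..d} x * g x)) = (\<lambda>x. indicator {c<..<d} x * g x)"
      by (auto simp: fun_eq_iff indicator_def)
    ultimately show ?thesis by simp
  qed
  have interval: "(LINT x|lebesgue. indicator {c<..<d} x * g x) = 0" if "a < c" "c < d" "d < b" for c d
  proof -
    have "(\<lambda>n. LINT x|lebesgue. g x * bump c d n x) \<longlonglongrightarrow> (LINT x|lebesgue. indicator {c<..<d} x * g x)"
    proof (rule integral_dominated_convergence)
      show "integrable lebesgue (\<lambda>x. \<bar>indicator {c<..<d} x * g x\<bar>)"
        using ig that by (intro integrable_abs) auto
      show "(\<lambda>x. indicator {c<..<d} x * g x) \<in> borel_measurable lebesgue"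
        using ig[of c d] that by auto
      show "(\<lambda>x. g x * bump c d n x) \<in> borel_measurable lebesgue" for n
        using integrable_mult_test[OF ab loc bump_test_function[OF that]] by auto
      show "AE x in lebesgue. norm (g x * bump c d n x) \<le> \<bar>indicator {c<..<d} x * g x\<bar>" for n
        using bump_bounds[of c d n] by (intro AE_I2) (auto simp: abs_mult mult.commute intro!: mult_mono)
      show "AE x in lebesgue. (\<lambda>n. g x * bump c d n x) \<longlonglongrightarrow> indicator {c<..<d} x * g x"
        by (intro AE_I2, subst mult.commute) (intro tendsto_intros bump_tendsto)
    qed
    moreover have "(LINT x|lebesgue. g x * bump c d n x) = 0" for n
      by (intro zero bump_test_function that)
    ultimately show ?thesis using LIMSEQ_unique[OF _ tendsto_const] by simp
  qed
  have local_zero: "AE x in lebesgue. x \<in> {c<..<d} \<longrightarrow> g x = 0" if "a < c" "d < b" for c d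
  proof -
    have "AE x in lebesgue. indicator {c<..<d} x * g x = 0"
    proof (rule AE_zero_of_tails[OF ig[OF that]])
      fix x
      have "(LINT y|lebesgue. indicator {x<..} y * (indicator {c<..<d} y * g y))
         = (LINT y|lebesgue. indicator {max x c<..<d} y * g y)"
        by (intro Bochner_Integration.integral_cong) (auto simp: indicator_def)
      also have "\<dots> = 0" using interval[of "max x c" d] that by (cases "max x c < d") auto
      finally show "(LINT y|lebesgue. indicator {x<..} y * (indicator {c<..<d} y * g y)) = 0" .
    qed
    then show ?thesis by eventually_elim (auto simp: indicator_def)
  qed
  have "AE x in lebesgue. \<forall>c\<in>\<rat>. \<forall>d\<in>\<rat>. a < c \<longrightarrow> d < b \<longrightarrow> x \<in> {c<..<d} \<longrightarrow> g x = 0"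
    using local_zero by (intro AE_ball_countable[THEN iffD2] ballI countable_rat) auto
  then have "AE x in lebesgue. x \<in> {a<..<b} \<longrightarrow> g x = 0"
  proof eventually_elim
    case (elim x)
    show ?case
    proof
      assume x: "x \<in> {a<..<b}"
      obtain c where "c \<in> \<rat>" "a < c" "c < x" using x Rats_dense_in_real[of a x] by auto
      moreover obtain d where "d \<in> \<rat>" "x < d" "d < b" using x Rats_dense_in_real[of x b] by auto
      ultimately show "g x = 0" using elim by auto
    qed
  qed
  then show ?thesis by (subst AE_restrict_space_iff) auto
qed

text \<open>The vanishing integral makes the primitive return to 0 beyond the support.\<close>

lemma test_function_antiderivative:
  assumes ab: "a < b" and \<phi>: "\<phi> \<in> test_functions a b" and zero: "(LINT x|lebesgue. \<phi> x) = 0"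
  obtains \<eta> where "\<eta> \<in> test_functions a b" "deriv \<eta> = \<phi>"
proof -
  obtain c d where cd: "smooth \<phi>" "a < c" "d < b" "\<And>x. x \<notin> {c..d} \<Longrightarrow> \<phi> x = 0"
    using test_function_props[OF ab \<phi>] by metis
  define \<eta> where "\<eta> x = integral {a..x} \<phi>" for x
  have left: "\<eta> x = 0" if "x < c" for x
    unfolding \<eta>_def by (intro integral_unique has_integral_is_0) (use that cd(4) in auto)
  have right: "\<eta> x = 0" if "d < x" for x
  proof -
    have "integrable (lebesgue_on {a..x}) \<phi>"
      by (intro continuous_imp_integrable_real smooth_continuous cd)
    then have "\<eta> x = (LINT y|lebesgue_on {a..x}. \<phi> y)"
      unfolding \<eta>_def by (simp add: lebesgue_integral_eq_integral)
    also have "\<dots> = (LINT y|lebesgue. \<phi> y)"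
      by (rule integral_lebesgue_on_vanishing) (use that cd in auto)
    finally show ?thesis using zero by simp
  qed
  have d: "(\<eta> has_real_derivative \<phi> x) (at x)" for x
  proof (cases "x < c")
    case True
    have "(\<eta> has_real_derivative 0) (at x)"
      by (rule has_field_derivative_transform_within_open[OF DERIV_const, of "{..<c}"]) (use True left in auto)
    then show ?thesis using cd(4)[of x] True by simp
  next
    case False
    then have "a < x" using cd by simp
    have "((\<lambda>x. integral {a..x} \<phi>) has_vector_derivative \<phi> x) (at x within {a..x+1})"
      using \<open>a < x\<close> by (intro integral_has_vector_derivative smooth_continuous cd) auto
    then show ?thesis unfolding \<eta>_def[abs_def]
      using \<open>a < x\<close> by (simp add: at_within_Icc_at has_real_derivative_iff_has_vector_derivative)
  qed
  show ?thesis
  proof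
    show "deriv \<eta> = \<phi>" using d by (intro ext DERIV_imp_deriv)
    have "smooth \<eta>" using d cd(1) by (rule smooth_antiderivative)
    then show "\<eta> \<in> test_functions a b"
      unfolding test_functions_iff[OF ab] using left right cd
      by (intro conjI exI[of _ c] exI[of _ d] allI impI) (auto simp: not_le)
  qed
qed

text \<open>Du Bois-Reymond: any test function minus a suitable multiple of a fixed
  \<open>\<theta>0\<close> has integral 0 and is thus the derivative of a test function.\<close>

lemma AE_const_of_test_functions:
  assumes ab: "a < b" and loc: "locally_integrable a b f"
    and zero: "\<And>\<theta>. \<theta> \<in> test_functions a b \<Longrightarrow> (LINT x|lebesgue. f x * deriv \<theta> x) = 0"
  shows "\<exists>C. AE x in lebesgue_on {a<..<b}. f x = C"
proof -
  have loc1: "locally_integrable a b (\<lambda>_. k)" for k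
    unfolding locally_integrable_def
    by (auto intro!: finite_measure.integrable_const finite_measure_lebesgue_on lmeasurable_compact)
  have it: "integrable lebesgue \<theta>" if "\<theta> \<in> test_functions a b" for \<theta>
    using integrable_mult_test[OF ab loc1[of 1] that] by simp
  \<comment> \<open>If all test functions had integral 0, the fundamental lemma would make the
    constant 1 vanish.\<close>
  obtain \<theta>0 where \<theta>0: "\<theta>0 \<in> test_functions a b" "(LINT x|lebesgue. \<theta>0 x) \<noteq> 0"
  proof (rule ccontr)
    assume "\<not> thesis"
    with that have "(LINT x|lebesgue. 1 * \<theta> x) = 0" if "\<theta> \<in> test_functions a b" for \<theta>
      using that by auto
    then have "AE x in lebesgue_on {a<..<b}. 1 = (0::real)"
      by (rule AE_zero_of_test_functions[OF ab loc1])
    then have "AE x in lebesgue. x \<notin> {a<..<b}" by (subst (asm) AE_restrict_space_iff) auto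
    then have "emeasure lebesgue {a<..<b} = 0" by (subst (asm) AE_iff_null_sets[symmetric]) auto
    then show False using ab by simp
  qed
  define m where "m = (LINT x|lebesgue. \<theta>0 x)"
  define C where "C = (LINT x|lebesgue. f x * \<theta>0 x) / m"
  have "AE x in lebesgue_on {a<..<b}. f x - C = 0"
  proof (rule AE_zero_of_test_functions[OF ab])
    show "locally_integrable a b (\<lambda>x. f x - C)"
      using loc loc1[of C] unfolding locally_integrable_def by (auto intro!: Bochner_Integration.integrable_diff)
    fix \<theta> assume \<theta>: "\<theta> \<in> test_functions a b"
    define r where "r = (LINT x|lebesgue. \<theta> x) / m"
    define \<phi> where "\<phi> x = 1 * \<theta> x + (- r) * \<theta>0 x" for x
    obtain c d where cd: "smooth \<theta>" "a < c" "d < b" "\<And>x. x \<notin> {c..d} \<Longrightarrow> \<theta> x = 0"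
      using test_function_props[OF ab \<theta>] by metis
    obtain c0 d0 where cd0: "smooth \<theta>0" "a < c0" "d0 < b" "\<And>x. x \<notin> {c0..d0} \<Longrightarrow> \<theta>0 x = 0"
      using test_function_props[OF ab \<theta>0(1)] by metis
    have "smooth \<phi>" unfolding \<phi>_def by (intro smooth_lincomb cd cd0)
    moreover have "\<phi> x = 0" if "x \<notin> {min c c0..max d d0}" for x
    proof -
      have "x \<notin> {c..d}" "x \<notin> {c0..d0}" using that by auto
      then show ?thesis by (simp add: \<phi>_def cd cd0)
    qed
    ultimately have \<phi>: "\<phi> \<in> test_functions a b"
      unfolding test_functions_iff[OF ab] using cd cd0
      by (intro conjI exI[of _ "min c c0"] exI[of _ "max d d0"]) auto
    have "(LINT x|lebesgue. \<phi> x) = (LINT x|lebesgue. \<theta> x) - r * m"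
      unfolding \<phi>_def using it[OF \<theta>] it[OF \<theta>0(1)] by (simp add: m_def)
    also have "\<dots> = 0" using \<theta>0(2) by (simp add: r_def m_def)
    finally obtain \<eta> where \<eta>: "\<eta> \<in> test_functions a b" "deriv \<eta> = \<phi>"
      using test_function_antiderivative[OF ab \<phi>] by metis
    have "0 = (LINT x|lebesgue. f x * \<phi> x)" using zero[OF \<eta>(1)] \<eta>(2) by simp
    also have "\<dots> = (LINT x|lebesgue. f x * \<theta> x - r * (f x * \<theta>0 x))"
      by (simp add: \<phi>_def algebra_simps)
    also have "\<dots> = (LINT x|lebesgue. f x * \<theta> x) - r * (LINT x|lebesgue. f x * \<theta>0 x)"
      using integrable_mult_test[OF ab loc \<theta>] integrable_mult_test[OF ab loc \<theta>0(1)] by simp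
    finally have "(LINT x|lebesgue. f x * \<theta> x) = C * (LINT x|lebesgue. \<theta> x)"
      by (simp add: r_def C_def)
    then show "(LINT x|lebesgue. (f x - C) * \<theta> x) = 0"
      using integrable_mult_test[OF ab loc \<theta>] it[OF \<theta>] by (simp add: left_diff_distrib)
  qed
  then show ?thesis by auto
qed

section \<open>Primitives and integration by parts\<close>

definition primitive :: "(real \<Rightarrow> real) \<Rightarrow> real \<Rightarrow> real" where
  "primitive g x = (LINT y|lebesgue. indicator {..x} y * g y)"

text \<open>Fubini on the region \<open>y \<le> x\<close>; a Borel version \<open>h\<close> of
  \<open>g\<close> makes the kernel measurable for the product of \<open>lborel\<close> with itself.
  The lower limit of \<open>primitive\<close> is minus infinity, which amounts to the left end point
  once \<open>g\<close> is cut off outside the interval.\<close>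

lemma primitive_by_parts:
  assumes g: "integrable lebesgue g" and ab: "a < b" and \<theta>: "\<theta> \<in> test_functions a b"
  shows "primitive g \<in> borel_measurable lebesgue" "\<bar>primitive g x\<bar> \<le> (LINT y|lebesgue. \<bar>g y\<bar>)"
    "(LINT x|lebesgue. primitive g x * deriv \<theta> x) = - (LINT x|lebesgue. g x * \<theta> x)"
proof -
  have gm: "g \<in> borel_measurable (completion lborel)" using g by simp
  then obtain h where h: "h \<in> borel_measurable lborel" and eq: "AE x in lborel. g x = h x"
    using completion_ex_borel_measurable_real by blast
  have h'[measurable]: "h \<in> borel_measurable borel" using h by simp
  have eqL: "AE x in lebesgue. g x = h x" using AE_completion[OF eq] .
  have hL: "h \<in> borel_measurable lebesgue" using measurable_completion[OF h] .
  have "integrable lebesgue h" using g eqL hL by (subst integrable_cong_AE[symmetric, of g]) auto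
  then have ih: "integrable lborel h" using integrable_completion[OF h] by simp
  obtain c d where cd: "smooth \<theta>" "a < c" "d < b" "\<And>x. x \<notin> {c..d} \<Longrightarrow> \<theta> x = 0"
    "\<And>x. x \<notin> {c..d} \<Longrightarrow> deriv \<theta> x = 0"
    using test_function_props[OF ab \<theta>] by metis
  have cont: "continuous_on S (deriv \<theta>)" "continuous_on S \<theta>" for S
    using smooth_continuous smooth_deriv cd(1) by blast+
  have [measurable]: "deriv \<theta> \<in> borel_measurable borel" "\<theta> \<in> borel_measurable borel"
    by (intro borel_measurable_continuous_onI cont)+
  have prim: "primitive g x = (LINT y|lborel. indicator {..x} y * h y)" for x
  proof -
    have "primitive g x = (LINT y|lebesgue. indicator {..x} y * h y)" unfolding primitive_def
    proof (rule integral_cong_AE)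
      show "(\<lambda>y. indicat_real {..x} y * g y) \<in> borel_measurable lebesgue"
        using borel_measurable_integrable[OF g] by (intro borel_measurable_times borel_measurable_indicator) auto
      show "AE y in lebesgue. indicat_real {..x} y * g y = indicat_real {..x} y * h y"
        using eqL by eventually_elim simp
    qed (intro borel_measurable_times borel_measurable_indicator hL; simp)
    also have "\<dots> = (LINT y|lborel. indicator {..x} y * h y)" by (rule integral_completion) simp
    finally show ?thesis .
  qed
  note h[measurable]
  have [measurable]: "(\<lambda>p. of_bool (snd p \<le> fst p)) \<in> borel_measurable (lborel \<Otimes>\<^sub>M (lborel :: real measure))"
    unfolding of_bool_def by measurable
  have "(\<lambda>x. LINT y|lborel. of_bool (y \<le> x) * h y) \<in> borel_measurable lborel"
    unfolding of_bool_def by measurable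
  then have pm: "primitive g \<in> borel_measurable lborel"
    unfolding prim[abs_def] by (simp add: indicator_def)
  then show "primitive g \<in> borel_measurable lebesgue" by (rule measurable_completion)
  show "\<bar>primitive g x\<bar> \<le> (LINT y|lebesgue. \<bar>g y\<bar>)"
  proof -
    have i: "integrable lebesgue (\<lambda>y. indicator {..x} y * g y)"
      using integrable_mult_indicator[OF _ g, of "{..x}"] by simp
    have "\<bar>primitive g x\<bar> \<le> (LINT y|lebesgue. \<bar>indicator {..x} y * g y\<bar>)"
      unfolding primitive_def by (rule integral_abs_bound)
    also have "\<dots> \<le> (LINT y|lebesgue. \<bar>g y\<bar>)"
      by (intro integral_mono integrable_abs i g) (auto simp: indicator_def)
    finally show ?thesis .
  qed
  have id: "integrable lborel (deriv \<theta>)"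
  proof -
    have "integrable lborel (\<lambda>x. indicator {c..d} x *\<^sub>R deriv \<theta> x)"
      by (intro borel_integrable_compact cont) simp
    moreover have "(\<lambda>x. indicator {c..d} x *\<^sub>R deriv \<theta> x) = deriv \<theta>"
      using cd(5) by (auto simp: indicator_def fun_eq_iff)
    ultimately show ?thesis by simp
  qed
  let ?k = "\<lambda>x y. of_bool (y \<le> x) * h y * deriv \<theta> x"
  have int2: "integrable (lborel \<Otimes>\<^sub>M lborel) (\<lambda>(x, y). ?k x y)"
  proof (rule lborel_pair.Fubini_integrable)
    show "(\<lambda>(x, y). ?k x y) \<in> borel_measurable (lborel \<Otimes>\<^sub>M lborel)"
      unfolding of_bool_def by measurable
    show "AE x in lborel. integrable lborel (\<lambda>y. case (x, y) of (x, y) \<Rightarrow> ?k x y)"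
    proof (rule AE_I2)
      fix x
      have "integrable lborel (\<lambda>y. indicator {..x} y *\<^sub>R h y * deriv \<theta> x)"
        using ih by (intro integrable_mult_left integrable_mult_indicator) auto
      then show "integrable lborel (\<lambda>y. case (x, y) of (x, y) \<Rightarrow> ?k x y)"
        by (simp add: indicator_def)
    qed
    show "integrable lborel (\<lambda>x. LINT y|lborel. norm (case (x, y) of (x, y) \<Rightarrow> ?k x y))"
    proof (rule Bochner_Integration.integrable_bound)
      show "integrable lborel (\<lambda>x. (LINT y|lborel. \<bar>h y\<bar>) * deriv \<theta> x)" using id by simp
      show "(\<lambda>x. LINT y|lborel. norm (case (x, y) of (x, y) \<Rightarrow> ?k x y)) \<in> borel_measurable lborel"
        unfolding of_bool_def by measurable
      show "AE x in lborel. norm (LINT y|lborel. norm (case (x, y) of (x, y) \<Rightarrow> ?k x y))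
          \<le> norm ((LINT y|lborel. \<bar>h y\<bar>) * deriv \<theta> x)"
      proof (rule AE_I2)
        fix x
        have "(LINT y|lborel. norm (?k x y)) \<le> (LINT y|lborel. \<bar>h y\<bar> * \<bar>deriv \<theta> x\<bar>)"
        proof (rule integral_mono')
          show "integrable lborel (\<lambda>y. \<bar>h y\<bar> * \<bar>deriv \<theta> x\<bar>)" using ih by simp
        qed (auto simp: abs_mult indicator_def)
        then show "norm (LINT y|lborel. norm (case (x, y) of (x, y) \<Rightarrow> ?k x y))
          \<le> norm ((LINT y|lborel. \<bar>h y\<bar>) * deriv \<theta> x)" by (simp add: abs_mult)
      qed
    qed
  qed
  have inner: "(LINT x|lborel. ?k x y) = - (h y * \<theta> y)" for y
  proof -
    \<comment> \<open>An upper limit beyond both \<open>y\<close> and the support, so that the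
      fundamental theorem leaves only \<open>- \<theta> y\<close>.\<close>
    define e where "e = max y d + 1"
    have ye: "y \<le> e" by (simp add: e_def)
    have tail: "deriv \<theta> x = 0" if "e < x" for x by (rule cd(5)) (use that in \<open>auto simp: e_def\<close>)
    have "(LINT x|lborel. ?k x y) = (LINT x|lborel. h y * (indicator {y..e} x *\<^sub>R deriv \<theta> x))"
      using tail by (intro Bochner_Integration.integral_cong) (auto simp: indicator_def not_le)
    also have "\<dots> = h y * (LINT x|lborel. indicator {y..e} x *\<^sub>R deriv \<theta> x)" by simp
    also have "(LINT x|lborel. indicator {y..e} x *\<^sub>R deriv \<theta> x) = \<theta> e - \<theta> y"
      using ye cont smooth_has_derivative[OF cd(1)]
      by (intro integral_FTC_atLeastAtMost)
         (auto simp: has_real_derivative_iff_has_vector_derivative intro: has_vector_derivative_at_within)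
    also have "\<theta> e = 0" by (rule cd(4)) (auto simp: e_def)
    finally show ?thesis by simp
  qed
  have "(LINT x|lebesgue. primitive g x * deriv \<theta> x) = (LINT x|lborel. primitive g x * deriv \<theta> x)"
    using pm by (intro integral_completion) simp
  also have "\<dots> = (LINT x|lborel. LINT y|lborel. ?k x y)"
    unfolding prim by (intro Bochner_Integration.integral_cong)
      (auto simp: indicator_def simp flip: integral_mult_left_zero intro!: Bochner_Integration.integral_cong)
  also have "\<dots> = (LINT y|lborel. LINT x|lborel. ?k x y)"
    by (rule lborel_pair.Fubini_integral[OF int2, symmetric])
  also have "\<dots> = - (LINT y|lborel. h y * \<theta> y)" unfolding inner by simp
  also have "(LINT y|lborel. h y * \<theta> y) = (LINT y|lebesgue. h y * \<theta> y)"
    by (rule integral_completion[symmetric]) simp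
  also have "\<dots> = (LINT y|lebesgue. g y * \<theta> y)"
  proof (rule integral_cong_AE)
    have t: "\<theta> \<in> borel_measurable lebesgue" by (rule continuous_borel_measurable_lebesgue[OF cont(2)])
    show "(\<lambda>y. g y * \<theta> y) \<in> borel_measurable lebesgue" "(\<lambda>y. h y * \<theta> y) \<in> borel_measurable lebesgue"
      using borel_measurable_integrable[OF g] t hL by (auto intro!: borel_measurable_times)
    show "AE y in lebesgue. h y * \<theta> y = g y * \<theta> y" using eqL by eventually_elim simp
  qed
  finally show "(LINT x|lebesgue. primitive g x * deriv \<theta> x) = - (LINT x|lebesgue. g x * \<theta> x)" .
qed

lemma primitive_locally_integrable:
  assumes "integrable lebesgue g" "a < b"
  shows "locally_integrable a b (primitive g)"
  unfolding locally_integrable_def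
proof (intro allI impI)
  fix K assume K: "compact K \<and> K \<subseteq> {a<..<b}"
  have t: "bump ((2*a+b)/3) ((a+2*b)/3) 0 \<in> test_functions a b"
    by (rule bump_test_function) (use assms(2) in \<open>auto simp: field_simps\<close>)
  have "finite_measure (lebesgue_on K)" using K by (simp add: finite_measure_lebesgue_on lmeasurable_compact)
  then show "integrable (lebesgue_on K) (primitive g)"
    by (rule finite_measure.integrable_const_bound[where B="LINT y|lebesgue. \<bar>g y\<bar>"])
       (use primitive_by_parts(1,2)[OF assms t] in \<open>auto intro: measurable_restrict_space1\<close>)
qed

lemma locally_integrable_of_integrable:
  assumes "integrable lebesgue (\<lambda>x. indicator {a<..<b} x * f x)"
  shows "locally_integrable a b f"
  unfolding locally_integrable_def
proof (intro allI impI)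
  fix K assume K: "compact K \<and> K \<subseteq> {a<..<b}"
  then have KL: "K \<in> sets lebesgue" by (auto simp: compact_imp_closed)
  have "integrable lebesgue (\<lambda>x. indicator K x *\<^sub>R (indicator {a<..<b} x * f x))"
    using assms KL by (intro integrable_mult_indicator)
  moreover have "(\<lambda>x. indicator K x *\<^sub>R (indicator {a<..<b} x * f x)) = (\<lambda>x. indicator K x *\<^sub>R f x)"
    using K by (auto simp: fun_eq_iff indicator_def)
  ultimately show "integrable (lebesgue_on K) f"
    using KL by (subst integrable_restrict_space) auto
qed

text \<open>By parts, \<open>f\<close> minus the primitive of \<open>g\<close> is orthogonal to all
  derivatives of test functions exactly if \<open>g\<close> is the weak derivative of
  \<open>f\<close>, and \<open>AE_const_of_test_functions\<close> makes it constant. Weak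
  differentiability thus becomes an explicit formula.\<close>

lemma weak_deriv_iff_primitive:
  assumes ab: "a < b" and loc: "locally_integrable a b f"
    and g: "integrable lebesgue (\<lambda>x. indicator {a<..<b} x * g x)"
  shows "weak_deriv a b f g \<longleftrightarrow>
    (\<exists>C. AE x in lebesgue_on {a<..<b}. f x = C + primitive (\<lambda>x. indicator {a<..<b} x * g x) x)"
proof -
  let ?G = "\<lambda>x. indicator {a<..<b} x * g x" and ?F = "primitive (\<lambda>x. indicator {a<..<b} x * g x)"
  have locF: "locally_integrable a b ?F" by (rule primitive_locally_integrable[OF g ab])
  have locg: "locally_integrable a b g" by (rule locally_integrable_of_integrable[OF g])
  have gG: "(LINT x|lebesgue_on {a<..<b}. g x * \<theta> x) = (LINT x|lebesgue. ?G x * \<theta> x)" for \<theta>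
    by (subst integral_lebesgue_on_indicator) (auto intro!: Bochner_Integration.integral_cong simp: mult.assoc)
  note parts = primitive_by_parts(3)[OF g ab]
  have key: "(LINT x|lebesgue_on {a<..<b}. f x * deriv \<theta> x) = - (LINT x|lebesgue_on {a<..<b}. g x * \<theta> x)
     \<longleftrightarrow> (LINT x|lebesgue. (f x - ?F x) * deriv \<theta> x) = 0" if \<theta>: "\<theta> \<in> test_functions a b" for \<theta>
  proof -
    note d = test_functions_deriv[OF ab \<theta>]
    have "(LINT x|lebesgue. (f x - ?F x) * deriv \<theta> x)
       = (LINT x|lebesgue. f x * deriv \<theta> x) - (LINT x|lebesgue. ?F x * deriv \<theta> x)"
      using integrable_mult_test[OF ab loc d] integrable_mult_test[OF ab locF d]
      by (simp add: left_diff_distrib)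
    then show ?thesis using parts[OF \<theta>] gG[of \<theta>] integral_test[OF ab d, of f] by (simp add: eq_neg_iff_add_eq_0)
  qed
  have locd: "locally_integrable a b (\<lambda>x. f x - ?F x)"
    using loc locF unfolding locally_integrable_def by (auto intro!: Bochner_Integration.integrable_diff)
  show ?thesis
  proof
    assume w: "weak_deriv a b f g"
    have "\<exists>C. AE x in lebesgue_on {a<..<b}. f x - ?F x = C"
      by (rule AE_const_of_test_functions[OF ab locd]) (use w key in \<open>auto simp: weak_deriv_def\<close>)
    then obtain C where "AE x in lebesgue_on {a<..<b}. f x - ?F x = C" ..
    then have "AE x in lebesgue_on {a<..<b}. f x = C + ?F x" by eventually_elim simp
    then show "\<exists>C. AE x in lebesgue_on {a<..<b}. f x = C + ?F x" ..
  next
    assume "\<exists>C. AE x in lebesgue_on {a<..<b}. f x = C + ?F x"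
    then obtain C where C: "AE x in lebesgue_on {a<..<b}. f x = C + ?F x" ..
    show "weak_deriv a b f g" unfolding weak_deriv_def
    proof (intro conjI loc locg ballI)
      fix \<theta> assume \<theta>: "\<theta> \<in> test_functions a b"
      note d = test_functions_deriv[OF ab \<theta>]
      obtain c e where cd: "smooth \<theta>" "a < c" "e < b" "\<And>x. x \<notin> {c..e} \<Longrightarrow> \<theta> x = 0"
        "\<And>x. x \<notin> {c..e} \<Longrightarrow> deriv \<theta> x = 0" using test_function_props[OF ab \<theta>] by metis
      have "(LINT x|lebesgue. (f x - ?F x) * deriv \<theta> x) = (LINT x|lebesgue. C * deriv \<theta> x)"
      proof (rule integral_cong_AE)
        show "(\<lambda>x. (f x - ?F x) * deriv \<theta> x) \<in> borel_measurable lebesgue"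
          using integrable_mult_test[OF ab locd d] by auto
        show "(\<lambda>x. C * deriv \<theta> x) \<in> borel_measurable lebesgue"
          using smooth_continuous[OF smooth_deriv[OF cd(1)]]
          by (intro continuous_borel_measurable_lebesgue continuous_intros)
        have "AE x in lebesgue. x \<in> {a<..<b} \<longrightarrow> f x = C + ?F x"
          using C by (subst (asm) AE_restrict_space_iff) auto
        then show "AE x in lebesgue. (f x - ?F x) * deriv \<theta> x = C * deriv \<theta> x"
        proof eventually_elim
          case (elim x)
          then show ?case using cd by (cases "x \<in> {a<..<b}") auto
        qed
      qed
      also have "\<dots> = C * (LINT x|lebesgue. deriv \<theta> x)" by simp
      also have "(LINT x|lebesgue. deriv \<theta> x) = 0"
      proof -
        have "(LINT x|lebesgue. deriv \<theta> x) = (LINT x|lebesgue_on {a..b}. deriv \<theta> x)"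
          by (rule integral_lebesgue_on_vanishing[symmetric]) (use cd in auto)
        also have "\<dots> = integral {a..b} (deriv \<theta>)"
          by (intro lebesgue_integral_eq_integral continuous_imp_integrable_real smooth_continuous smooth_deriv cd) auto
        also have "\<dots> = \<theta> b - \<theta> a"
          using ab smooth_has_derivative[OF cd(1)]
          by (intro integral_unique fundamental_theorem_of_calculus)
             (auto simp: has_real_derivative_iff_has_vector_derivative[symmetric] intro: has_field_derivative_at_within)
        also have "\<dots> = 0" using cd by auto
        finally show ?thesis .
      qed
      finally show "(LINT x|lebesgue_on {a<..<b}. f x * deriv \<theta> x) = - (LINT x|lebesgue_on {a<..<b}. g x * \<theta> x)"
        using key[OF \<theta>] by simp
    qed
  qed
qed

section \<open>The Hilbert space of square integrable functions\<close>

definition sq_int :: "(real \<Rightarrow> real) \<Rightarrow> bool" where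
  "sq_int f \<longleftrightarrow> f \<in> borel_measurable lebesgue \<and> integrable lebesgue (\<lambda>x. (f x)\<^sup>2)"

lemma sq_int_mult:
  assumes "sq_int f" "sq_int g"
  shows "integrable lebesgue (\<lambda>x. f x * g x)"
proof (rule Bochner_Integration.integrable_bound)
  show "integrable lebesgue (\<lambda>x. (f x)\<^sup>2 + (g x)\<^sup>2)"
    using assms by (simp add: sq_int_def)
  show "(\<lambda>x. f x * g x) \<in> borel_measurable lebesgue"
    using assms by (auto simp: sq_int_def)
  have "\<bar>a * b\<bar> \<le> a\<^sup>2 + b\<^sup>2" for a b :: real
  proof -
    have "2 * (\<bar>a\<bar> * \<bar>b\<bar>) \<le> a\<^sup>2 + b\<^sup>2" using sum_squares_bound[of "\<bar>a\<bar>" "\<bar>b\<bar>"] by simp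
    then show ?thesis unfolding abs_mult by (smt (verit) mult_nonneg_nonneg abs_ge_zero)
  qed
  then show "AE x in lebesgue. norm (f x * g x) \<le> norm ((f x)\<^sup>2 + (g x)\<^sup>2)" by simp
qed

lemma sq_int_zero: "sq_int (\<lambda>x. 0)" by (simp add: sq_int_def)

lemma sq_int_add:
  assumes "sq_int f" "sq_int g" shows "sq_int (\<lambda>x. f x + g x)"
proof -
  have "integrable lebesgue (\<lambda>x. (f x)\<^sup>2 + (g x)\<^sup>2 + 2 * (f x * g x))"
    using assms sq_int_mult[OF assms] by (intro Bochner_Integration.integrable_add integrable_mult_right) (auto simp: sq_int_def)
  then show ?thesis using assms
    by (auto simp: sq_int_def power2_sum algebra_simps)
qed

lemma sq_int_scale: "sq_int f \<Longrightarrow> sq_int (\<lambda>x. c * f x)"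
  by (auto simp: sq_int_def power_mult_distrib)

lemma sq_int_minus: "sq_int f \<Longrightarrow> sq_int (\<lambda>x. - f x)"
  by (simp add: sq_int_def)

lemma sq_int_diff: "sq_int f \<Longrightarrow> sq_int g \<Longrightarrow> sq_int (\<lambda>x. f x - g x)"
  using sq_int_add[OF _ sq_int_minus, of f g] by simp

definition l2rel :: "(real \<Rightarrow> real) \<Rightarrow> (real \<Rightarrow> real) \<Rightarrow> bool" where
  "l2rel f g \<longleftrightarrow> sq_int f \<and> sq_int g \<and> (AE x in lebesgue. f x = g x)"

\<comment> \<open>A type, unlike a set of functions, can carry the inner product and norm classes on
  which vector-valued calculus in time relies. The quotient is partial because \<open>l2rel\<close>
  relates square integrable functions only.\<close>
quotient_type l2 = "real \<Rightarrow> real" / partial: l2rel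
proof (rule part_equivpI)
  show "\<exists>x. l2rel x x" using sq_int_zero by (auto simp: l2rel_def)
  show "symp l2rel" by (auto simp: symp_def l2rel_def)
  show "transp l2rel" unfolding transp_def l2rel_def by (auto elim: AE_mp)
qed

instantiation l2 :: real_vector
begin

lift_definition zero_l2 :: l2 is "\<lambda>x. 0" by (simp add: l2rel_def sq_int_zero)
lift_definition plus_l2 :: "l2 \<Rightarrow> l2 \<Rightarrow> l2" is "\<lambda>f g x. f x + g x"
  by (auto simp: l2rel_def sq_int_add elim!: AE_mp)
lift_definition minus_l2 :: "l2 \<Rightarrow> l2 \<Rightarrow> l2" is "\<lambda>f g x. f x - g x"
  by (auto simp: l2rel_def sq_int_diff elim!: AE_mp)
lift_definition uminus_l2 :: "l2 \<Rightarrow> l2" is "\<lambda>f x. - f x"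
  by (auto simp: l2rel_def sq_int_minus elim!: AE_mp)
lift_definition scaleR_l2 :: "real \<Rightarrow> l2 \<Rightarrow> l2" is "\<lambda>c f x. c * f x"
  by (auto simp: l2rel_def sq_int_scale elim!: AE_mp)

instance
proof
  fix x y z :: l2 and a b :: real
  show "x + y + z = x + (y + z)" by transfer (auto simp: l2rel_def algebra_simps sq_int_add)
  show "x + y = y + x" by transfer (auto simp: l2rel_def algebra_simps sq_int_add)
  show "0 + x = x" by transfer (auto simp: l2rel_def)
  show "- x + x = 0" by transfer (auto simp: l2rel_def sq_int_zero)
  show "x - y = x + - y" by transfer (auto simp: l2rel_def sq_int_diff)
  show "a *\<^sub>R (x + y) = a *\<^sub>R x + a *\<^sub>R y"
    by transfer (auto simp: l2rel_def algebra_simps intro!: sq_int_add sq_int_scale)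
  show "(a + b) *\<^sub>R x = a *\<^sub>R x + b *\<^sub>R x"
    by transfer (auto simp: l2rel_def algebra_simps intro!: sq_int_add sq_int_scale)
  show "a *\<^sub>R b *\<^sub>R x = (a * b) *\<^sub>R x"
    by transfer (auto simp: l2rel_def algebra_simps intro!: sq_int_scale)
  show "1 *\<^sub>R x = x" by transfer (auto simp: l2rel_def)
qed

end

instantiation l2 :: real_inner
begin

lift_definition inner_l2 :: "l2 \<Rightarrow> l2 \<Rightarrow> real" is "\<lambda>f g. LINT x|lebesgue. f x * g x"
proof -
  fix f f' g g' assume a: "l2rel f f'" "l2rel g g'"
  then have "AE x in lebesgue. f x * g x = f' x * g' x"
    unfolding l2rel_def by auto
  then show "(LINT x|lebesgue. f x * g x) = (LINT x|lebesgue. f' x * g' x)"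
    using a by (intro integral_cong_AE) (auto simp: l2rel_def sq_int_def)
qed

definition "norm_l2 x = sqrt (x \<bullet> x)" for x :: l2
definition "sgn_l2 x = x /\<^sub>R norm x" for x :: l2
definition "dist_l2 x y = norm (x - y)" for x y :: l2
definition "(uniformity :: (l2 \<times> l2) filter) = (INF e\<in>{0<..}. principal {(x, y). dist x y < e})"
definition "open_l2 S = (\<forall>x\<in>S. \<forall>\<^sub>F (x', y) in uniformity. x' = x \<longrightarrow> y \<in> S)" for S :: "l2 set"

instance
proof
  fix x y z :: l2 and a b :: real
  show "sgn x = x /\<^sub>R norm x" by (rule sgn_l2_def)
  show "dist x y = norm (x - y)" by (rule dist_l2_def)
  show "(uniformity :: (l2 \<times> l2) filter) = (INF e\<in>{0<..}. principal {(x, y). dist x y < e})"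
    by (rule uniformity_l2_def)
  show "open S = (\<forall>x\<in>S. \<forall>\<^sub>F (x', y) in uniformity. x' = x \<longrightarrow> y \<in> S)" for S :: "l2 set"
    by (rule open_l2_def)
  show "x \<bullet> y = y \<bullet> x" by transfer (simp add: mult.commute)
  show "(x + y) \<bullet> z = x \<bullet> z + y \<bullet> z"
    by transfer (simp add: l2rel_def distrib_right sq_int_mult)
  show "a *\<^sub>R x \<bullet> y = a * (x \<bullet> y)" by transfer (simp add: mult.assoc)
  show "0 \<le> x \<bullet> x" by transfer simp
  show "x \<bullet> x = 0 \<longleftrightarrow> x = 0"
  proof transfer
    fix f assume "l2rel f f"
    then show "(LINT x|lebesgue. f x * f x) = 0 \<longleftrightarrow> l2rel f (\<lambda>x. 0)"
      using integral_nonneg_eq_0_iff_AE[of lebesgue "\<lambda>x. f x * f x"]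
      by (auto simp: l2rel_def sq_int_zero sq_int_mult)
  qed
  show "norm x = sqrt (x \<bullet> x)" by (rule norm_l2_def)
qed

end

lemma abs_l2_eq_iff:
  "sq_int f \<Longrightarrow> sq_int g \<Longrightarrow> abs_l2 f = abs_l2 g \<longleftrightarrow> (AE x in lebesgue. f x = g x)"
  using Quotient_rel_abs2[OF Quotient_l2] Quotient_rel[OF Quotient_l2, of f g] by (auto simp: l2rel_def)

lemma abs_l2_cases:
  obtains f where "sq_int f" "X = abs_l2 f"
  using l2.abs_induct[of "\<lambda>X. \<exists>f. sq_int f \<and> X = abs_l2 f" X] by (auto simp: l2rel_def)

lemma
  assumes "sq_int f" "sq_int g"
  shows abs_l2_add: "abs_l2 f + abs_l2 g = abs_l2 (\<lambda>x. f x + g x)"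
    and abs_l2_diff: "abs_l2 f - abs_l2 g = abs_l2 (\<lambda>x. f x - g x)"
    and inner_abs_l2: "abs_l2 f \<bullet> abs_l2 g = (LINT x|lebesgue. f x * g x)"
    and abs_l2_scaleR: "c *\<^sub>R abs_l2 f = abs_l2 (\<lambda>x. c * f x)"
  using assms by (auto simp: plus_l2.abs_eq minus_l2.abs_eq inner_l2.abs_eq scaleR_l2.abs_eq l2rel_def)

lemma nn_integral_norm_abs_l2:
  assumes "sq_int f"
  shows "(\<integral>\<^sup>+ x. ennreal ((f x)\<^sup>2) \<partial>lebesgue) = ennreal ((norm (abs_l2 f))\<^sup>2)"
proof -
  have "(\<integral>\<^sup>+ x. ennreal ((f x)\<^sup>2) \<partial>lebesgue) = ennreal (LINT x|lebesgue. (f x)\<^sup>2)"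
    using assms by (intro nn_integral_eq_integral) (auto simp: sq_int_def)
  also have "(LINT x|lebesgue. (f x)\<^sup>2) = (norm (abs_l2 f))\<^sup>2"
    by (simp add: power2_norm_eq_inner inner_abs_l2[OF assms assms] power2_eq_square[of "f _"])
  finally show ?thesis .
qed

text \<open>The weights 4^k leave a summable series against squared norms of size 8^-k, and
  finiteness of the weighted series at a point forces the increments there to decay like
  2^-k.\<close>

lemma AE_convergent_of_summable_increments:
  assumes f: "\<And>k. sq_int (f k)"
    and le: "\<And>k. (norm (abs_l2 (\<lambda>x. f (Suc k) x - f k x)))\<^sup>2 \<le> (1/8) ^ k"
  shows "AE x in lebesgue. convergent (\<lambda>k. f k x)"
proof -
  define h where "h k x = f (Suc k) x - f k x" for k x
  have sh: "sq_int (h k)" for k unfolding h_def by (intro sq_int_diff f)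
  then have [measurable]: "h k \<in> borel_measurable lebesgue" for k by (simp add: sq_int_def)
  have "(\<integral>\<^sup>+ x. (\<Sum>k. ennreal (4 ^ k * (h k x)\<^sup>2)) \<partial>lebesgue) = (\<Sum>k. \<integral>\<^sup>+ x. ennreal (4 ^ k * (h k x)\<^sup>2) \<partial>lebesgue)"
    by (intro nn_integral_suminf) measurable
  also have "\<dots> \<le> (\<Sum>k. ennreal ((1/2) ^ k))"
  proof (intro suminf_le)
    fix k
    have "(\<integral>\<^sup>+ x. ennreal (4 ^ k * (h k x)\<^sup>2) \<partial>lebesgue) = ennreal (4 ^ k) * (\<integral>\<^sup>+ x. ennreal ((h k x)\<^sup>2) \<partial>lebesgue)"
      using sh[of k] by (subst nn_integral_cmult[symmetric]) (auto simp: sq_int_def ennreal_mult')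
    also have "\<dots> = ennreal (4 ^ k * (norm (abs_l2 (h k)))\<^sup>2)"
      by (simp add: nn_integral_norm_abs_l2[OF sh] ennreal_mult')
    also have "\<dots> \<le> ennreal (4 ^ k * (1/8) ^ k)"
      using le[of k] by (intro ennreal_leI mult_left_mono) (auto simp: h_def[abs_def])
    also have "4 ^ k * (1/8) ^ k = ((1/2) ^ k :: real)" by (simp add: power_mult_distrib[symmetric])
    finally show "(\<integral>\<^sup>+ x. ennreal (4 ^ k * (h k x)\<^sup>2) \<partial>lebesgue) \<le> ennreal ((1/2) ^ k)" .
  qed auto
  also have "\<dots> < \<infinity>" by (subst suminf_ennreal2) auto
  finally have "(\<integral>\<^sup>+ x. (\<Sum>k. ennreal (4 ^ k * (h k x)\<^sup>2)) \<partial>lebesgue) \<noteq> \<infinity>" by simp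
  then have "AE x in lebesgue. (\<Sum>k. ennreal (4 ^ k * (h k x)\<^sup>2)) \<noteq> \<infinity>"
    by (intro nn_integral_PInf_AE) measurable
  then show ?thesis
  proof eventually_elim
    fix x assume fin: "(\<Sum>k. ennreal (4 ^ k * (h k x)\<^sup>2)) \<noteq> \<infinity>"
    have "s \<noteq> \<infinity> \<Longrightarrow> \<exists>c. s = ennreal c \<and> 0 \<le> c" for s by (cases s) auto
    from this[OF fin] obtain c where c: "(\<Sum>k. ennreal (4 ^ k * (h k x)\<^sup>2)) = ennreal c" "0 \<le> c" by blast
    have "\<bar>h k x\<bar> \<le> sqrt c * (1/2) ^ k" for k
    proof -
      have "g k \<le> suminf g" for g :: "nat \<Rightarrow> ennreal"
        using sum_le_suminf[of g "{k}"] by simp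
      from this[of "\<lambda>k. ennreal (4 ^ k * (h k x)\<^sup>2)"] have "4 ^ k * (h k x)\<^sup>2 \<le> c"
        unfolding c(1) using c(2) by (simp only: ennreal_le_iff)
      moreover have "(2 ^ k * \<bar>h k x\<bar>)\<^sup>2 = 4 ^ k * (h k x)\<^sup>2"
        by (simp add: power_mult_distrib) (simp add: power2_eq_square power_mult_distrib[symmetric])
      ultimately have "(2 ^ k * \<bar>h k x\<bar>)\<^sup>2 \<le> c" by simp
      then have "2 ^ k * \<bar>h k x\<bar> \<le> sqrt c" by (rule real_le_rsqrt)
      then show ?thesis by (simp add: power_divide field_simps)
    qed
    then have "summable (\<lambda>k. h k x)"
      by (intro summable_comparison_test'[OF summable_mult[OF summable_geometric[of "1/2"]]]) auto
    then have "convergent (\<lambda>n. \<Sum>k<n. h k x)" by (simp add: summable_iff_convergent)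
    moreover have "(\<Sum>k<n. h k x) = f n x - f 0 x" for n
      unfolding h_def by (rule sum_lessThan_telescope)
    ultimately have "convergent (\<lambda>n. f n x - f 0 x)" by simp
    from convergent_add[OF this convergent_const[of "f 0 x"]]
    show "convergent (\<lambda>k. f k x)" by simp
  qed
qed

text \<open>Riesz-Fischer: a fast subsequence converges almost everywhere, and Fatou's lemma shows
  that its pointwise limit is also the limit in norm.\<close>

instance l2 :: banach
proof
  fix X :: "nat \<Rightarrow> l2" assume X: "Cauchy X"
  have "\<exists>N. \<forall>m\<ge>N. \<forall>n\<ge>N. norm (X m - X n) < (1/8) ^ k" for k :: nat
    using CauchyD[OF X, of "(1/8) ^ k"] by simp
  then obtain N where N: "\<And>k m n. N k \<le> m \<Longrightarrow> N k \<le> n \<Longrightarrow> norm (X m - X n) < (1/8) ^ k"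
    by metis
  \<comment> \<open>Adding up all \<open>N j\<close> with \<open>j\<close> up to \<open>k\<close>,
    and \<open>k\<close> itself, makes \<open>r\<close> strictly increasing and at least
    \<open>N k\<close> from index \<open>k\<close> on.\<close>
  define r where "r k = (\<Sum>j\<le>k. N j) + k" for k
  have r: "strict_mono r" by (rule strict_monoI_Suc) (simp add: r_def)
  have Nr: "N k \<le> r m" if "k \<le> m" for k m
    using member_le_sum[of k "{..m}" N] that by (auto simp: r_def)
  have "\<exists>f. sq_int f \<and> X (r k) = abs_l2 f" for k using abs_l2_cases by metis
  then obtain f where f: "\<And>k. sq_int (f k)" "\<And>k. X (r k) = abs_l2 (f k)" by metis
  have [measurable]: "f k \<in> borel_measurable lebesgue" for k using f(1)[of k] by (simp add: sq_int_def)
  have diff: "abs_l2 (\<lambda>x. f m x - f k x) = X (r m) - X (r k)" for m k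
    by (simp add: f abs_l2_diff)
  have small: "(norm (X (r m) - X (r k)))\<^sup>2 \<le> (1/8) ^ k" if "k \<le> m" for k m
  proof -
    have "norm (X (r m) - X (r k)) < (1/8) ^ k" using that by (intro N Nr) auto
    then have "(norm (X (r m) - X (r k)))\<^sup>2 \<le> ((1/8) ^ k)\<^sup>2" by (intro power_mono) auto
    also have "\<dots> \<le> (1/8 :: real) ^ k"
      unfolding power_mult[symmetric] by (rule power_decreasing) auto
    finally show ?thesis .
  qed
  have conv: "AE x in lebesgue. convergent (\<lambda>k. f k x)"
    by (rule AE_convergent_of_summable_increments) (simp_all only: f(1) diff small le_SucI order_refl)
  define g where "g x = lim (\<lambda>k. f k x)" for x
  have gm: "g \<in> borel_measurable lebesgue"
    unfolding g_def using f(1) by (intro borel_measurable_lim_metric) (auto simp: sq_int_def)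
  have le: "(\<integral>\<^sup>+ x. ennreal ((g x - f k x)\<^sup>2) \<partial>lebesgue) \<le> ennreal ((1/8) ^ k)" for k
  proof -
    have "(\<integral>\<^sup>+ x. ennreal ((g x - f k x)\<^sup>2) \<partial>lebesgue)
       = (\<integral>\<^sup>+ x. liminf (\<lambda>m. ennreal ((f m x - f k x)\<^sup>2)) \<partial>lebesgue)"
    proof (rule nn_integral_cong_AE, use conv in eventually_elim)
      fix x assume "convergent (\<lambda>k. f k x)"
      then have "(\<lambda>m. f m x) \<longlonglongrightarrow> g x" unfolding g_def by (simp add: convergent_LIMSEQ_iff)
      then have "(\<lambda>m. ennreal ((f m x - f k x)\<^sup>2)) \<longlonglongrightarrow> ennreal ((g x - f k x)\<^sup>2)"
        by (intro tendsto_intros)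
      then show "ennreal ((g x - f k x)\<^sup>2) = liminf (\<lambda>m. ennreal ((f m x - f k x)\<^sup>2))"
        by (rule lim_imp_Liminf[OF sequentially_bot, symmetric])
    qed
    also have "\<dots> \<le> liminf (\<lambda>m. \<integral>\<^sup>+ x. ennreal ((f m x - f k x)\<^sup>2) \<partial>lebesgue)"
      by (intro nn_integral_liminf) measurable
    also have "\<dots> \<le> ennreal ((1/8) ^ k)"
    proof (rule Liminf_le)
      have "(\<integral>\<^sup>+ x. ennreal ((f m x - f k x)\<^sup>2) \<partial>lebesgue) \<le> ennreal ((1/8) ^ k)" if "k \<le> m" for m
        using nn_integral_norm_abs_l2[OF sq_int_diff[OF f(1)[of m] f(1)[of k]]] small[OF that]
        by (simp add: diff ennreal_leI)
      then show "\<forall>\<^sub>F m in sequentially. (\<integral>\<^sup>+ x. ennreal ((f m x - f k x)\<^sup>2) \<partial>lebesgue) \<le> ennreal ((1/8) ^ k)"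
        by (auto simp: eventually_sequentially)
    qed simp
    finally show ?thesis .
  qed
  have gf: "sq_int (\<lambda>x. g x - f k x)" for k
    unfolding sq_int_def
  proof
    show m: "(\<lambda>x. g x - f k x) \<in> borel_measurable lebesgue"
      using gm f(1)[of k] by (auto simp: sq_int_def)
    show "integrable lebesgue (\<lambda>x. (g x - f k x)\<^sup>2)"
      using m le_less_trans[OF le[of k] ennreal_less_top] by (intro integrableI_nonneg) auto
  qed
  then have g: "sq_int g" using sq_int_add[OF gf[of 0] f(1)[of 0]] by simp
  have "(norm (abs_l2 g - X (r k)))\<^sup>2 \<le> (1/8) ^ k" for k
    using le[of k] nn_integral_norm_abs_l2[OF gf[of k]] by (simp add: f abs_l2_diff g)
  then have "(\<lambda>k. (norm (abs_l2 g - X (r k)))\<^sup>2) \<longlonglongrightarrow> 0"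
    by (intro tendsto_sandwich[OF always_eventually always_eventually tendsto_const
          LIMSEQ_power_zero[of "1/8"]]) auto
  then have "(\<lambda>k. sqrt ((norm (abs_l2 g - X (r k)))\<^sup>2)) \<longlonglongrightarrow> sqrt 0"
    by (rule tendsto_real_sqrt)
  then have "(\<lambda>k. X (r k)) \<longlonglongrightarrow> abs_l2 g"
    by (subst tendsto_dist_iff) (simp add: dist_norm norm_minus_commute)
  then have "X \<longlonglongrightarrow> abs_l2 g"
    using Cauchy_converges_subseq[OF X r, of "abs_l2 g"] by (simp add: o_def)
  then show "convergent X" by (auto simp: convergent_def)
qed

section \<open>Functions on (0,L) inside the space on the line\<close>

lemma borel_measurable_lebesgue_cong_AE:
  fixes f g :: "real \<Rightarrow> real"
  assumes f: "f \<in> borel_measurable lebesgue" and eq: "AE x in lebesgue. f x = g x"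
  shows "g \<in> borel_measurable lebesgue"
proof (rule measurableI)
  fix A :: "real set" assume A: "A \<in> sets borel"
  obtain N where N: "{x \<in> space lebesgue. \<not> f x = g x} \<subseteq> N" "N \<in> null_sets lebesgue"
    using eq unfolding eventually_ae_filter by blast
  have "f -` A \<in> sets lebesgue" using measurable_sets[OF f A] by simp
  moreover have "(f -` A - g -` A) \<in> null_sets lebesgue" "(g -` A - f -` A) \<in> null_sets lebesgue"
    using N(1) by (auto intro!: completion.complete2[OF _ N(2)])
  ultimately have "(f -` A - (f -` A - g -` A)) \<union> (g -` A - f -` A) \<in> sets lebesgue"
    using sets.Un[OF sets.Diff] null_setsD2 by meson
  also have "(f -` A - (f -` A - g -` A)) \<union> (g -` A - f -` A) = g -` A" by auto
  finally show "g -` A \<inter> space lebesgue \<in> sets lebesgue" by simp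
qed simp

text \<open>Extension by \<open>0\<close> lets the single type \<open>l2\<close> of functions on the line serve all lengths \<open>L\<close>.\<close>

definition ext :: "real \<Rightarrow> (real \<Rightarrow> real) \<Rightarrow> real \<Rightarrow> real" where
  "ext L f x = indicator {0<..<L} x * f x"

definition emb :: "real \<Rightarrow> (real \<Rightarrow> real) \<Rightarrow> l2" where
  "emb L f = abs_l2 (ext L f)"

lemma L2_iff_sq_int: "f \<in> L2 L \<longleftrightarrow> sq_int (ext L f)"
proof -
  have "f \<in> borel_measurable (lebesgue_on {0<..<L}) \<longleftrightarrow> ext L f \<in> borel_measurable lebesgue"
    by (subst borel_measurable_restrict_space_iff) (auto simp: ext_def[abs_def])
  moreover have "integrable (lebesgue_on {0<..<L}) (\<lambda>x. (f x)\<^sup>2) \<longleftrightarrow> integrable lebesgue (\<lambda>x. (ext L f x)\<^sup>2)"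
  proof -
    have "(\<lambda>x. (ext L f x)\<^sup>2) = (\<lambda>x. indicator {0<..<L} x *\<^sub>R (f x)\<^sup>2)"
      by (auto simp: ext_def indicator_def)
    then show ?thesis by (subst integrable_restrict_space) auto
  qed
  ultimately show ?thesis by (simp add: L2_def sq_int_def)
qed

lemma AE_on_iff_ext: "(AE x in lebesgue_on {0<..<L}. f x = g x) \<longleftrightarrow> (AE x in lebesgue. ext L f x = ext L g x)"
  by (subst AE_restrict_space_iff) (auto simp: ext_def indicator_def)

lemma emb_eq_iff: "f \<in> L2 L \<Longrightarrow> g \<in> L2 L \<Longrightarrow> emb L f = emb L g \<longleftrightarrow> (AE x in lebesgue_on {0<..<L}. f x = g x)"
  unfolding emb_def AE_on_iff_ext by (intro abs_l2_eq_iff) (simp_all add: L2_iff_sq_int)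

lemma L2_cong_AE:
  assumes "f \<in> L2 L" "AE x in lebesgue_on {0<..<L}. f x = g x"
  shows "g \<in> L2 L"
proof -
  have eq: "AE x in lebesgue. ext L f x = ext L g x" using assms(2) by (simp add: AE_on_iff_ext)
  have f: "ext L f \<in> borel_measurable lebesgue" "integrable lebesgue (\<lambda>x. (ext L f x)\<^sup>2)"
    using assms(1) by (auto simp: L2_iff_sq_int sq_int_def)
  note g = borel_measurable_lebesgue_cong_AE[OF f(1) eq]
  have "AE x in lebesgue. (ext L f x)\<^sup>2 = (ext L g x)\<^sup>2" using eq by eventually_elim simp
  then have "integrable lebesgue (\<lambda>x. (ext L g x)\<^sup>2)"
    using f g by (subst integrable_cong_AE[symmetric, of "\<lambda>x. (ext L f x)\<^sup>2"]) auto
  then show ?thesis using g by (simp add: L2_iff_sq_int sq_int_def)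
qed

lemma emb_cong_AE:
  "f \<in> L2 L \<Longrightarrow> AE x in lebesgue_on {0<..<L}. f x = g x \<Longrightarrow> emb L g = emb L f"
  using emb_eq_iff L2_cong_AE by metis

lemma
  assumes "f \<in> L2 L" "g \<in> L2 L"
  shows L2_add: "(\<lambda>x. f x + g x) \<in> L2 L" and emb_add: "emb L (\<lambda>x. f x + g x) = emb L f + emb L g"
    and L2_diff: "(\<lambda>x. f x - g x) \<in> L2 L" and emb_diff: "emb L (\<lambda>x. f x - g x) = emb L f - emb L g"
    and L2_inner_emb: "L2_inner L f g = emb L f \<bullet> emb L g"
proof -
  have f: "sq_int (ext L f)" and g: "sq_int (ext L g)" using assms by (auto simp: L2_iff_sq_int)
  have e: "ext L (\<lambda>x. f x + g x) = (\<lambda>x. ext L f x + ext L g x)"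
    "ext L (\<lambda>x. f x - g x) = (\<lambda>x. ext L f x - ext L g x)"
    by (auto simp: ext_def algebra_simps)
  show "(\<lambda>x. f x + g x) \<in> L2 L" "(\<lambda>x. f x - g x) \<in> L2 L"
    unfolding L2_iff_sq_int e using f g by (auto intro: sq_int_add sq_int_diff)
  show "emb L (\<lambda>x. f x + g x) = emb L f + emb L g" "emb L (\<lambda>x. f x - g x) = emb L f - emb L g"
    unfolding emb_def e using f g by (simp_all add: abs_l2_add abs_l2_diff)
  show "L2_inner L f g = emb L f \<bullet> emb L g"
    unfolding emb_def inner_abs_l2[OF f g] L2_inner_def
    by (subst integral_lebesgue_on_indicator)
       (auto intro!: Bochner_Integration.integral_cong simp: ext_def indicator_def)
qed

lemma
  assumes "f \<in> L2 L"
  shows L2_scale: "(\<lambda>x. c * f x) \<in> L2 L" and emb_scale: "emb L (\<lambda>x. c * f x) = c *\<^sub>R emb L f"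
proof -
  have f: "sq_int (ext L f)" using assms by (simp add: L2_iff_sq_int)
  have e: "ext L (\<lambda>x. c * f x) = (\<lambda>x. c * ext L f x)" by (auto simp: ext_def)
  show "(\<lambda>x. c * f x) \<in> L2 L" unfolding L2_iff_sq_int e using f by (rule sq_int_scale)
  show "emb L (\<lambda>x. c * f x) = c *\<^sub>R emb L f" unfolding emb_def e using f f by (rule abs_l2_scaleR[symmetric])
qed

lemma L2_norm_emb: "f \<in> L2 L \<Longrightarrow> L2_norm L f = norm (emb L f)"
  by (simp add: L2_norm_def L2_inner_emb norm_eq_sqrt_inner)

lemma sq_int_ext: "sq_int f \<Longrightarrow> sq_int (ext L f)"
proof -
  assume f: "sq_int f"
  then have "integrable lebesgue (\<lambda>x. indicator {0<..<L} x *\<^sub>R (f x)\<^sup>2)"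
    by (intro integrable_mult_indicator) (auto simp: sq_int_def)
  also have "(\<lambda>x. indicator {0<..<L} x *\<^sub>R (f x)\<^sup>2) = (\<lambda>x. (ext L f x)\<^sup>2)"
    by (auto simp: ext_def indicator_def)
  finally show ?thesis using f
    by (auto simp: sq_int_def ext_def[abs_def] intro!: borel_measurable_times borel_measurable_indicator)
qed

text \<open>The orthogonal projection onto the image of \<open>L2 L\<close>. Membership in that
  image becomes the closed linear condition \<open>restrict_l2 L \<Phi> = \<Phi>\<close>, which
  passes to limits and derivatives.\<close>

lift_definition restrict_l2 :: "real \<Rightarrow> l2 \<Rightarrow> l2" is ext
by (auto simp: l2rel_def ext_def sq_int_ext elim!: AE_mp)

lemma restrict_l2_cases: obtains f where "f \<in> L2 L" "restrict_l2 L \<Phi> = emb L f"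
proof -
  obtain f where f: "sq_int f" "\<Phi> = abs_l2 f" by (rule abs_l2_cases)
  have "l2rel f f" using f by (simp add: l2rel_def)
  then have "restrict_l2 L \<Phi> = emb L f" unfolding f(2) emb_def by (simp add: restrict_l2.abs_eq)
  moreover have "f \<in> L2 L" using f by (simp add: L2_iff_sq_int sq_int_ext)
  ultimately show ?thesis using that by blast
qed

lemma restrict_emb: "f \<in> L2 L \<Longrightarrow> restrict_l2 L (emb L f) = emb L f"
proof -
  assume "f \<in> L2 L"
  then have "l2rel (ext L f) (ext L f)" by (simp add: L2_iff_sq_int l2rel_def)
  moreover have "ext L (ext L f) = ext L f" by (auto simp: ext_def fun_eq_iff indicator_def)
  ultimately show ?thesis unfolding emb_def by (simp add: restrict_l2.abs_eq)
qed

lemma restrict_fixed_iff: "restrict_l2 L \<Phi> = \<Phi> \<longleftrightarrow> \<Phi> \<in> emb L ` L2 L"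
proof
  assume "restrict_l2 L \<Phi> = \<Phi>"
  with restrict_l2_cases[of L \<Phi>] show "\<Phi> \<in> emb L ` L2 L" by force
qed (auto simp: restrict_emb)

lemma restrict_symmetric: "restrict_l2 L x \<bullet> y = x \<bullet> restrict_l2 L y"
  by transfer (simp add: ext_def mult_ac)

lemma restrict_idem: "restrict_l2 L (restrict_l2 L x) = restrict_l2 L x"
  by (rule restrict_l2_cases[of L x]) (simp add: restrict_emb)

lemma bounded_linear_restrict: "bounded_linear (restrict_l2 L)"
proof (rule bounded_linear_intro[of _ 1])
  show "restrict_l2 L (x + y) = restrict_l2 L x + restrict_l2 L y" for x y
  proof transfer
    fix L f g assume "l2rel f f" "l2rel g g"
    then show "l2rel (ext L (\<lambda>x. f x + g x)) (\<lambda>x. ext L f x + ext L g x)"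
      using sq_int_ext[of "\<lambda>x. f x + g x" L] by (simp add: l2rel_def ext_def[abs_def] distrib_left sq_int_add)
  qed
  show "restrict_l2 L (r *\<^sub>R x) = r *\<^sub>R restrict_l2 L x" for r x
  proof transfer
    fix L r f assume "l2rel f f"
    then show "l2rel (ext L (\<lambda>x. r * f x)) (\<lambda>x. r * ext L f x)"
      using sq_int_ext[of "\<lambda>x. r * f x" L] by (simp add: l2rel_def ext_def[abs_def] mult.left_commute sq_int_scale)
  qed
  show "norm (restrict_l2 L x) \<le> norm x * 1" for x
  proof -
    have "norm (restrict_l2 L x) * norm (restrict_l2 L x) = x \<bullet> restrict_l2 L x"
      using restrict_symmetric[of L x "restrict_l2 L x"] restrict_idem[of L x]
      by (metis power2_eq_square power2_norm_eq_inner)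
    also have "\<dots> \<le> norm x * norm (restrict_l2 L x)" by (rule norm_cauchy_schwarz)
    finally show ?thesis by (cases "norm (restrict_l2 L x) = 0") auto
  qed
qed

section \<open>Integration from the clamped end\<close>

lemma continuous_integrable_Ioo:
  fixes f :: "real \<Rightarrow> real"
  assumes "continuous_on {a..b} f"
  shows "integrable lebesgue (\<lambda>x. indicator {a<..<b} x * f x)"
proof -
  have "integrable lebesgue (\<lambda>x. indicator {a..b} x *\<^sub>R f x)"
    using continuous_imp_integrable_real[OF assms] by (subst (asm) integrable_restrict_space) auto
  then have "integrable lebesgue (\<lambda>x. indicator {a<..<b} x *\<^sub>R (indicator {a..b} x *\<^sub>R f x))"
    by (rule integrable_mult_indicator[rotated]) auto
  also have "(\<lambda>x. indicator {a<..<b} x *\<^sub>R (indicator {a..b} x *\<^sub>R f x)) = (\<lambda>x. indicator {a<..<b} x * f x)"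
    by (auto simp: indicator_def)
  finally show ?thesis .
qed

lemma continuous_in_L2:
  assumes "continuous_on UNIV f"
  shows "f \<in> L2 L"
  unfolding L2_def
proof (intro CollectI conjI)
  show "f \<in> borel_measurable (lebesgue_on {0<..<L})"
    using continuous_borel_measurable_lebesgue[OF assms] by (rule measurable_restrict_space1)
  have "integrable lebesgue (\<lambda>x. indicator {0<..<L} x *\<^sub>R (f x)\<^sup>2)"
    using continuous_integrable_Ioo[of 0 L "\<lambda>x. (f x)\<^sup>2"] continuous_on_subset[OF assms]
    by (auto intro: continuous_intros)
  then show "integrable (lebesgue_on {0<..<L}) (\<lambda>x. (f x)\<^sup>2)"
    by (subst integrable_restrict_space) auto
qed

lemma indicator_in_L2: "(indicator {..x} :: real \<Rightarrow> real) \<in> L2 L"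
  unfolding L2_iff_sq_int sq_int_def
proof
  have e: "ext L (indicator {..x}) = indicator ({0<..<L} \<inter> {..x})"
    by (auto simp: ext_def indicator_def)
  show "ext L (indicator {..x}) \<in> borel_measurable lebesgue" unfolding e by (intro borel_measurable_indicator) auto
  have "(\<lambda>y. (indicator ({0<..<L} \<inter> {..x}) y)\<^sup>2 :: real) = indicator ({0<..<L} \<inter> {..x})"
    by (auto simp: indicator_def)
  moreover have "emeasure lebesgue ({0<..<L} \<inter> {..x}) \<le> emeasure lebesgue {0<..<L}"
    by (intro emeasure_mono) auto
  then have "emeasure lebesgue ({0<..<L} \<inter> {..x}) < \<infinity>"
    by (rule le_less_trans) (cases "0 \<le> L"; simp)
  ultimately show "integrable lebesgue (\<lambda>y. (ext L (indicator {..x}) y)\<^sup>2)"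
    unfolding e by (simp add: less_top)
qed

lemma norm_emb_le:
  assumes "f \<in> L2 L" "0 \<le> L" "0 \<le> B" "\<And>x. x \<in> {0<..<L} \<Longrightarrow> \<bar>f x\<bar> \<le> B"
  shows "norm (emb L f) \<le> sqrt L * B"
proof -
  have "(norm (emb L f))\<^sup>2 = (LINT x|lebesgue. ext L f x * ext L f x)"
    using assms(1) unfolding power2_norm_eq_inner emb_def by (intro inner_abs_l2) (auto simp: L2_iff_sq_int)
  also have "\<dots> \<le> (LINT x|lebesgue. indicator {0<..<L} x * B\<^sup>2)"
  proof (rule integral_mono)
    show "integrable lebesgue (\<lambda>x. ext L f x * ext L f x)"
      using assms(1) by (auto simp: L2_iff_sq_int intro: sq_int_mult)
    show "integrable lebesgue (\<lambda>x. indicator {0<..<L} x * B\<^sup>2)"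
      using assms(2) by (intro integrable_mult_left) simp
    show "ext L f x * ext L f x \<le> indicator {0<..<L} x * B\<^sup>2" for x
      using assms(4)[of x] by (auto simp: ext_def indicator_def power2_eq_square[symmetric] abs_le_square_iff[symmetric] assms(3))
  qed
  also have "\<dots> = L * B\<^sup>2" using assms(2) by simp
  finally have "norm (emb L f) \<le> sqrt (L * B\<^sup>2)" by (rule real_le_rsqrt)
  then show ?thesis using assms(3) by (simp add: real_sqrt_mult)
qed

text \<open>
  The primitive \<open>\<integral>\<^sub>0\<^sup>x \<Phi>\<close> is written as an inner product with an indicator function, which makes its
  Hoelder continuity an instance of the Cauchy-Schwarz inequality.
\<close>

definition cut :: "real \<Rightarrow> real \<Rightarrow> l2" where "cut L x = emb L (indicator {..x})"

lemma cut_inner: "cut L x \<bullet> cut L y = measure lebesgue ({0<..<L} \<inter> {..min x y})"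
proof -
  have "cut L x \<bullet> cut L y = (LINT z|lebesgue. ext L (indicator {..x}) z * ext L (indicator {..y}) z)"
    unfolding cut_def emb_def by (intro inner_abs_l2) (simp_all flip: L2_iff_sq_int add: indicator_in_L2)
  also have "\<dots> = (LINT z|lebesgue. indicator ({0<..<L} \<inter> {..min x y}) z)"
    by (intro Bochner_Integration.integral_cong) (auto simp: ext_def indicator_def)
  finally show ?thesis by simp
qed

text \<open>The difference is the indicator of an interval no longer than the distance of
  \<open>x\<close> and \<open>y\<close>.\<close>

lemma norm_cut_diff: "norm (cut L x - cut L y) \<le> sqrt \<bar>x - y\<bar>"
proof -
  have *: "norm (cut L x - cut L y) \<le> sqrt (y - x)" if "x \<le> y" for x y
  proof (rule real_le_rsqrt)
    have S: "{0<..<L} \<inter> {..z} \<in> lmeasurable" for z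
      by (rule bounded_set_imp_lmeasurable) (auto intro: bounded_subset[of "{0<..<L}"])
    have "(norm (cut L x - cut L y))\<^sup>2 = measure lebesgue ({0<..<L} \<inter> {..y}) - measure lebesgue ({0<..<L} \<inter> {..x})"
      using that by (simp add: power2_norm_eq_inner inner_diff_left inner_diff_right cut_inner min_def)
    also have "\<dots> = measure lebesgue (({0<..<L} \<inter> {..y}) - ({0<..<L} \<inter> {..x}))"
      using that by (intro measurable_measure_Diff[symmetric] S) (auto simp: fmeasurableD[OF S])
    also have "\<dots> \<le> measure lebesgue {x..y}"
      using fmeasurableD[OF S] by (intro measure_mono_fmeasurable) auto
    finally show "(norm (cut L x - cut L y))\<^sup>2 \<le> y - x" using that by simp
  qed
  show ?thesis
    using *[of x y] *[of y x] by (cases "x \<le> y") (auto simp: norm_minus_commute)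
qed

lemma cut_zero: "cut L 0 = 0"
proof -
  have "{0<..<L} \<inter> {..0} = {}" by auto
  then have "cut L 0 \<bullet> cut L 0 = 0" by (simp add: cut_inner)
  then show ?thesis by simp
qed

definition prim :: "real \<Rightarrow> l2 \<Rightarrow> real \<Rightarrow> real" where "prim L \<Phi> x = \<Phi> \<bullet> cut L x"

lemma prim_holder: "\<bar>prim L \<Phi> x - prim L \<Phi> y\<bar> \<le> norm \<Phi> * sqrt \<bar>x - y\<bar>"
proof -
  have "\<bar>prim L \<Phi> x - prim L \<Phi> y\<bar> \<le> norm \<Phi> * norm (cut L x - cut L y)"
    unfolding prim_def inner_diff_right[symmetric] by (rule Cauchy_Schwarz_ineq2)
  also have "\<dots> \<le> norm \<Phi> * sqrt \<bar>x - y\<bar>" by (intro mult_left_mono norm_cut_diff) simp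
  finally show ?thesis .
qed

lemma prim_0: "prim L \<Phi> 0 = 0" by (simp add: prim_def cut_zero)

lemma prim_bound: "x \<in> {0..L} \<Longrightarrow> \<bar>prim L \<Phi> x\<bar> \<le> norm \<Phi> * sqrt L"
  using prim_holder[of L \<Phi> x 0] mult_left_mono[of "sqrt \<bar>x\<bar>" "sqrt L" "norm \<Phi>"] by (auto simp: prim_0)

lemma prim_continuous: "continuous_on S (prim L \<Phi>)"
proof -
  have "((\<lambda>y. prim L \<Phi> y) \<longlongrightarrow> prim L \<Phi> x) (at x)" for x
  proof (rule LIM_zero_cancel)
    show "((\<lambda>y. prim L \<Phi> y - prim L \<Phi> x) \<longlongrightarrow> 0) (at x)"
    proof (rule Lim_null_comparison)
      show "\<forall>\<^sub>F y in at x. norm (prim L \<Phi> y - prim L \<Phi> x) \<le> norm \<Phi> * sqrt \<bar>y - x\<bar>"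
        by (simp add: prim_holder)
      have "((\<lambda>y. norm \<Phi> * sqrt \<bar>y - x\<bar>) \<longlongrightarrow> norm \<Phi> * sqrt \<bar>x - x\<bar>) (at x)" by (intro tendsto_intros)
      then show "((\<lambda>y. norm \<Phi> * sqrt \<bar>y - x\<bar>) \<longlongrightarrow> 0) (at x)" by simp
    qed
  qed
  then show ?thesis by (simp add: continuous_on_eq_continuous_at continuous_at_imp_continuous_on isCont_def)
qed

lemma prim_in_L2: "prim L \<Phi> \<in> L2 L" by (intro continuous_in_L2 prim_continuous)

text \<open>The operator \<open>J\<close> of the beam; its values are again supported in
  (0,L).\<close>

definition volterra :: "real \<Rightarrow> l2 \<Rightarrow> l2" where "volterra L \<Phi> = emb L (prim L \<Phi>)"

lemma prim_linear: "prim L (x + y) = (\<lambda>s. prim L x s + prim L y s)" "prim L (c *\<^sub>R x) = (\<lambda>s. c * prim L x s)"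
  "prim L (x - y) = (\<lambda>s. prim L x s - prim L y s)"
  by (auto simp: prim_def inner_add_left inner_diff_left)

lemma bounded_linear_volterra: "0 < L \<Longrightarrow> bounded_linear (volterra L)"
proof (rule bounded_linear_intro[of _ L])
  assume L: "0 < L"
  show "norm (volterra L x) \<le> norm x * L" for x
  proof -
    have "norm (volterra L x) \<le> sqrt L * (norm x * sqrt L)"
      unfolding volterra_def using L prim_bound[of _ L x] by (intro norm_emb_le prim_in_L2) auto
    also have "\<dots> = norm x * (sqrt L * sqrt L)" by simp
    finally show ?thesis using L by simp
  qed
qed (simp_all add: volterra_def prim_linear emb_add emb_scale prim_in_L2)

lemma restrict_cut: "restrict_l2 L (cut L x) = cut L x"
  unfolding cut_def by (intro restrict_emb indicator_in_L2)

lemma prim_restrict: "prim L (restrict_l2 L \<Phi>) = prim L \<Phi>"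
  by (simp add: prim_def fun_eq_iff restrict_symmetric restrict_cut)

lemma volterra_restrict: "volterra L (restrict_l2 L \<Phi>) = volterra L \<Phi>"
  by (simp add: volterra_def prim_restrict)

lemma restrict_volterra: "restrict_l2 L (volterra L \<Phi>) = volterra L \<Phi>"
  by (simp add: volterra_def restrict_emb prim_in_L2)

text \<open>Primitives of functions in a ball share a Hoelder bound with exponent 1/2, so they are
  determined up to \<open>3 * \<delta>\<close> by their values at finitely many nodes, rounded to
  multiples of \<open>\<delta>\<close>. Only finitely many rounded lists occur, and a uniform bound
  on (0,L) implies one in L^2.\<close>

lemma volterra_compact:
  assumes "0 < L" "0 < e"
  shows "\<exists>\<U>. finite \<U> \<and> cball 0 R \<subseteq> \<Union>\<U> \<and>
      (\<forall>V\<in>\<U>. \<forall>f\<in>V. \<forall>g\<in>V. norm (volterra L f - volterra L g) \<le> e)"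
proof (cases "0 \<le> R")
  case False
  then show ?thesis by (intro exI[of _ "{}"]) auto
next
  case True
  \<comment> \<open>A uniform distance of \<open>3 * \<delta>\<close> costs
    \<open>sqrt L * (3 * \<delta>)\<close> in L^2, which is at most \<open>e\<close>.\<close>
  define \<delta> where "\<delta> = e / (4 * sqrt L)"
  have \<delta>: "0 < \<delta>" using assms by (simp add: \<delta>_def)
  obtain N :: nat where "R\<^sup>2 * L / \<delta>\<^sup>2 < real N" using reals_Archimedean2 by blast
  moreover have "0 \<le> R\<^sup>2 * L / \<delta>\<^sup>2" using assms by simp
  ultimately have N: "R\<^sup>2 * L / \<delta>\<^sup>2 < real N" "0 < real N" by linarith+
  have mesh: "R * sqrt (L / real N) \<le> \<delta>"
  proof -
    have "(R * sqrt (L / real N))\<^sup>2 \<le> \<delta>\<^sup>2"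
      using N \<delta> assms(1) by (simp add: power_mult_distrib field_simps)
    then show ?thesis using \<delta> by (simp add: power2_le_iff_abs_le abs_le_iff)
  qed
  define node where "node j = L * real j / real N" for j
  define code where "code f = map (\<lambda>j. \<lfloor>prim L f (node j) / \<delta>\<rfloor>) [0..<Suc N]" for f
  define Z where "Z = {- \<lceil>R * sqrt L / \<delta>\<rceil> - 1..\<lceil>R * sqrt L / \<delta>\<rceil>}"
  have node: "node j \<in> {0..L}" if "j < Suc N" for j
    using that assms(1) N(2) by (auto simp: node_def field_simps)
  have codeZ: "code f \<in> {xs. set xs \<subseteq> Z \<and> length xs = Suc N}" if f: "f \<in> cball 0 R" for f
  proof -
    have "\<lfloor>prim L f (node j) / \<delta>\<rfloor> \<in> Z" if "j < Suc N" for j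
    proof -
      have "\<bar>prim L f (node j)\<bar> \<le> norm f * sqrt L" by (rule prim_bound[OF node[OF that]])
      also have "\<dots> \<le> R * sqrt L" using f assms by (intro mult_right_mono) auto
      finally have "\<bar>prim L f (node j) / \<delta>\<bar> \<le> R * sqrt L / \<delta>" using \<delta> by (simp add: divide_right_mono)
      then show ?thesis unfolding Z_def atLeastAtMost_iff by linarith
    qed
    then show ?thesis unfolding code_def by auto
  qed
  define \<U> where "\<U> = (\<lambda>xs. {f \<in> cball 0 R. code f = xs}) ` {xs. set xs \<subseteq> Z \<and> length xs = Suc N}"
  have "finite \<U>" unfolding \<U>_def by (intro finite_imageI finite_lists_length_eq) (simp add: Z_def)
  moreover have "cball 0 R \<subseteq> \<Union>\<U>"
  proof
    fix f :: l2 assume f: "f \<in> cball 0 R"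
    then show "f \<in> \<Union>\<U>" unfolding \<U>_def by (intro UnionI[OF imageI[OF codeZ[OF f]]]) simp
  qed
  moreover have "norm (volterra L f - volterra L g) \<le> e"
    if fg: "f \<in> cball 0 R" "g \<in> cball 0 R" "code f = code g" for f g
  proof -
    have close: "\<bar>prim L f x - prim L g x\<bar> \<le> 3 * \<delta>" if x: "x \<in> {0<..<L}" for x
    proof -
      define j where "j = nat \<lfloor>x * real N / L\<rfloor>"
      have xN: "0 \<le> x * real N / L" using x N by simp
      have j1: "real j \<le> x * real N / L" "x * real N / L < real j + 1"
        using xN unfolding j_def by linarith+
      have "x < L * (real j + 1) / real N" "node j \<le> x"
        using j1 assms(1) N unfolding node_def by (simp_all add: field_simps)
      then have jx: "node j \<le> x" "x - node j \<le> L / real N"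
        unfolding node_def distrib_left add_divide_distrib by simp_all
      have "x * real N / L < real N" using x N by (simp add: field_simps)
      then have jN: "j < Suc N" using j1(1) by linarith
      have H: "\<bar>prim L h x - prim L h (node j)\<bar> \<le> \<delta>" if "h \<in> cball 0 R" for h
      proof -
        have "\<bar>prim L h x - prim L h (node j)\<bar> \<le> norm h * sqrt \<bar>x - node j\<bar>" by (rule prim_holder)
        also have "\<dots> \<le> R * sqrt (L / real N)"
          using that jx True by (intro mult_mono) auto
        finally show ?thesis using mesh by simp
      qed
      have "code f ! j = code g ! j" using fg(3) by simp
      then have "\<lfloor>prim L f (node j) / \<delta>\<rfloor> = \<lfloor>prim L g (node j) / \<delta>\<rfloor>"
        using jN unfolding code_def by (simp del: upt_Suc)
      then have "\<bar>prim L f (node j) / \<delta> - prim L g (node j) / \<delta>\<bar> \<le> 1" by linarith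
      then have "\<bar>prim L f (node j) - prim L g (node j)\<bar> \<le> \<delta>"
        using \<delta> by (simp add: diff_divide_distrib[symmetric] abs_divide)
      then show ?thesis using H[OF fg(1)] H[OF fg(2)] by linarith
    qed
    have "volterra L f - volterra L g = emb L (\<lambda>x. prim L f x - prim L g x)"
      by (simp add: volterra_def emb_diff prim_in_L2)
    also have "norm \<dots> \<le> sqrt L * (3 * \<delta>)"
      using assms(1) \<delta> close by (intro norm_emb_le L2_diff prim_in_L2) auto
    also have "\<dots> \<le> e" using assms by (simp add: \<delta>_def)
    finally show ?thesis .
  qed
  ultimately show ?thesis by (intro exI[of _ \<U>]) (auto simp: \<U>_def)
qed

section \<open>Sobolev spaces\<close>

lemma L2_integrable:
  assumes "f \<in> L2 L"
  shows "integrable lebesgue (ext L f)"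
proof -
  have "(\<lambda>_. 1) \<in> L2 L" by (intro continuous_in_L2 continuous_intros)
  then have "integrable lebesgue (\<lambda>x. ext L f x * ext L (\<lambda>_. 1) x)"
    using assms by (intro sq_int_mult) (simp_all add: L2_iff_sq_int)
  also have "(\<lambda>x. ext L f x * ext L (\<lambda>_. 1) x) = ext L f" by (auto simp: ext_def indicator_def)
  finally show ?thesis .
qed

lemma L2_locally_integrable: "f \<in> L2 L \<Longrightarrow> locally_integrable 0 L f"
  using L2_integrable by (intro locally_integrable_of_integrable) (simp add: ext_def[abs_def])

lemma primitive_eq_prim:
  assumes "g \<in> L2 L"
  shows "primitive (\<lambda>x. indicator {0<..<L} x * g x) x = prim L (emb L g) x"
proof -
  have "prim L (emb L g) x = (LINT y|lebesgue. ext L g y * ext L (indicator {..x}) y)"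
    unfolding prim_def cut_def emb_def using assms indicator_in_L2
    by (intro inner_abs_l2) (simp_all add: L2_iff_sq_int)
  also have "\<dots> = primitive (\<lambda>x. indicator {0<..<L} x * g x) x"
    unfolding primitive_def by (intro Bochner_Integration.integral_cong) (auto simp: ext_def indicator_def)
  finally show ?thesis by simp
qed

lemma weak_deriv_iff_prim:
  assumes "0 < L" "f \<in> L2 L" "g \<in> L2 L"
  shows "weak_deriv 0 L f g \<longleftrightarrow> (\<exists>C. AE x in lebesgue_on {0<..<L}. f x = C + prim L (emb L g) x)"
  using weak_deriv_iff_primitive[OF assms(1) L2_locally_integrable[OF assms(2)], of g] L2_integrable[OF assms(3)]
  by (simp add: ext_def[abs_def] primitive_eq_prim[OF assms(3)])

lemma weak_deriv_unique:
  assumes ab: "a < b" and g: "weak_deriv a b f g" and h: "weak_deriv a b f h"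
  shows "AE x in lebesgue_on {a<..<b}. g x = h x"
proof -
  have loc: "locally_integrable a b g" "locally_integrable a b h" using g h by (auto simp: weak_deriv_def)
  have "AE x in lebesgue_on {a<..<b}. g x - h x = 0"
  proof (rule AE_zero_of_test_functions[OF ab])
    show "locally_integrable a b (\<lambda>x. g x - h x)"
      using loc unfolding locally_integrable_def by (auto intro!: Bochner_Integration.integrable_diff)
    fix \<theta> assume \<theta>: "\<theta> \<in> test_functions a b"
    have "(LINT x|lebesgue. (g x - h x) * \<theta> x) = (LINT x|lebesgue. g x * \<theta> x) - (LINT x|lebesgue. h x * \<theta> x)"
      using integrable_mult_test[OF ab loc(1) \<theta>] integrable_mult_test[OF ab loc(2) \<theta>] by (simp add: left_diff_distrib)
    also have "\<dots> = 0" using g h \<theta> integral_test[OF ab \<theta>, of g] integral_test[OF ab \<theta>, of h] by (simp add: weak_deriv_def)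
    finally show "(LINT x|lebesgue. (g x - h x) * \<theta> x) = 0" .
  qed
  then show ?thesis by eventually_elim simp
qed

lemma weak_deriv_dx: "weak_deriv 0 L f g \<Longrightarrow> weak_deriv 0 L f (dx L f)"
  unfolding dx_def by (rule someI[of "weak_deriv 0 L f"])

text \<open>Whatever representative the choice in \<open>dx\<close> returns, it agrees almost
  everywhere with a known derivative and inherits its integrability.\<close>

lemma dx_eq:
  assumes "0 < L" "g \<in> L2 L" "weak_deriv 0 L f g"
  shows "AE x in lebesgue_on {0<..<L}. g x = dx L f x" "dx L f \<in> L2 L" "emb L (dx L f) = emb L g"
proof -
  show *: "AE x in lebesgue_on {0<..<L}. g x = dx L f x"
    using weak_deriv_unique[OF assms(1,3) weak_deriv_dx[OF assms(3)]] .
  show "dx L f \<in> L2 L" "emb L (dx L f) = emb L g"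
    using L2_cong_AE[OF assms(2) *] emb_cong_AE[OF assms(2) *] by auto
qed

text \<open>Measurability can stay open: Lebesgue measure is complete, so both integrands are
  measurable or neither is, and in the latter case both integrals have the default value 0.\<close>

lemma LINT_on_cong_AE:
  fixes f g :: "real \<Rightarrow> real"
  assumes "AE x in lebesgue_on {0<..<L}. f x = g x"
  shows "(LINT x|lebesgue_on {0<..<L}. f x) = (LINT x|lebesgue_on {0<..<L}. g x)"
proof -
  have *: "(LINT x|lebesgue_on {0<..<L}. h x) = (LINT x|lebesgue. ext L h x)" for h :: "real \<Rightarrow> real"
    by (simp add: integral_lebesgue_on_indicator ext_def)
  have eq: "AE x in lebesgue. ext L f x = ext L g x" using assms by (simp add: AE_on_iff_ext)
  show ?thesis unfolding *
  proof (cases "ext L f \<in> borel_measurable lebesgue")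
    case True
    then show "(LINT x|lebesgue. ext L f x) = (LINT x|lebesgue. ext L g x)"
      using borel_measurable_lebesgue_cong_AE[OF True eq] eq by (intro integral_cong_AE) auto
  next
    case False
    moreover have "ext L g \<notin> borel_measurable lebesgue"
    proof
      assume "ext L g \<in> borel_measurable lebesgue"
      moreover have "AE x in lebesgue. ext L g x = ext L f x" using eq by eventually_elim simp
      ultimately show False using False borel_measurable_lebesgue_cong_AE by blast
    qed
    ultimately have "\<not> integrable lebesgue (ext L f)" "\<not> integrable lebesgue (ext L g)"
      using borel_measurable_integrable by blast+
    then show "(LINT x|lebesgue. ext L f x) = (LINT x|lebesgue. ext L g x)"
      by (simp add: not_integrable_integral_eq)
  qed
qed

lemma weak_deriv_cong:
  assumes w: "weak_deriv 0 L f g" and eq: "AE x in lebesgue_on {0<..<L}. f x = f' x"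
  shows "weak_deriv 0 L f' g"
proof -
  have loc: "locally_integrable 0 L f'"
    unfolding locally_integrable_def
  proof (intro allI impI)
    fix K assume K: "compact K \<and> K \<subseteq> {0<..<L}"
    have KL: "K \<in> sets lebesgue" using K by (auto simp: compact_imp_closed)
    have "integrable (lebesgue_on K) f" using w K by (simp add: weak_deriv_def locally_integrable_def)
    then have i: "integrable lebesgue (\<lambda>x. indicator K x *\<^sub>R f x)"
      using KL by (subst (asm) integrable_restrict_space) auto
    have "AE x in lebesgue. x \<in> {0<..<L} \<longrightarrow> f x = f' x" using eq by (subst (asm) AE_restrict_space_iff) auto
    then have e: "AE x in lebesgue. indicator K x *\<^sub>R f x = indicator K x *\<^sub>R f' x"
      by eventually_elim (use K in \<open>auto simp: indicator_def\<close>)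
    have "integrable lebesgue (\<lambda>x. indicator K x *\<^sub>R f' x)"
      using i e borel_measurable_lebesgue_cong_AE[OF borel_measurable_integrable[OF i] e]
      by (subst integrable_cong_AE[symmetric]) auto
    then show "integrable (lebesgue_on K) f'" using KL by (subst integrable_restrict_space) auto
  qed
  show ?thesis unfolding weak_deriv_def
  proof (intro conjI loc ballI)
    show "locally_integrable 0 L g" using w by (simp add: weak_deriv_def)
    fix \<theta> assume \<theta>: "\<theta> \<in> test_functions 0 L"
    have "(LINT x|lebesgue_on {0<..<L}. f' x * deriv \<theta> x) = (LINT x|lebesgue_on {0<..<L}. f x * deriv \<theta> x)"
      by (rule LINT_on_cong_AE) (use eq in eventually_elim, simp)
    then show "(LINT x|lebesgue_on {0<..<L}. f' x * deriv \<theta> x) = - (LINT x|lebesgue_on {0<..<L}. g x * \<theta> x)"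
      using w \<theta> by (simp add: weak_deriv_def)
  qed
qed

text \<open>The set where they differ is open and null, hence empty.\<close>

lemma continuous_AE_eq:
  fixes f g :: "real \<Rightarrow> real"
  assumes "continuous_on {a<..<b} f" "continuous_on {a<..<b} g"
    and eq: "AE x in lebesgue_on {a<..<b}. f x = g x" and x: "x \<in> {a<..<b}"
  shows "f x = g x"
proof -
  let ?S = "{x \<in> {a<..<b}. f x - g x \<noteq> 0}"
  have "open ({a<..<b} \<inter> (\<lambda>x. f x - g x) -` (- {0}))"
    by (intro continuous_open_preimage continuous_intros assms)
  also have "{a<..<b} \<inter> (\<lambda>x. f x - g x) -` (- {0}) = ?S" by auto
  finally have op: "open ?S" .
  have "AE x in lebesgue. x \<in> {a<..<b} \<longrightarrow> f x = g x"
    using eq by (subst (asm) AE_restrict_space_iff) auto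
  then have "AE x in lebesgue. x \<notin> ?S" by eventually_elim auto
  then have "negligible ?S"
    using op by (subst (asm) AE_iff_null_sets[symmetric]) (auto simp: negligible_iff_null_sets)
  then have "?S = {}" using op open_not_negligible by blast
  then show ?thesis using x by auto
qed

text \<open>Justifies the definite description: two candidates agree on (0,L), hence by continuity
  at the end points, and both are 0 elsewhere.\<close>

lemma cont_rep_eqI:
  assumes L: "0 < L" and h: "continuous_on {0..L} h" "\<And>x. x \<notin> {0..L} \<Longrightarrow> h x = 0"
    "AE x in lebesgue_on {0<..<L}. f x = h x"
  shows "cont_rep L f = h"
  unfolding cont_rep_def
proof (rule the_equality)
  show "continuous_on {0..L} h \<and> (\<forall>x. x \<notin> {0..L} \<longrightarrow> h x = 0) \<and> (AE x in lebesgue_on {0<..<L}. f x = h x)"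
    using h by blast
  fix g assume g: "continuous_on {0..L} g \<and> (\<forall>x. x \<notin> {0..L} \<longrightarrow> g x = 0) \<and> (AE x in lebesgue_on {0<..<L}. f x = g x)"
  have "AE x in lebesgue_on {0<..<L}. g x = h x" using g h(3) by (auto elim: AE_mp)
  then have eq: "g x - h x = 0" if "x \<in> {0<..<L}" for x
  proof -
    have "{0<..<L} \<subseteq> {0..L}" by auto
    then have "continuous_on {0<..<L} g" "continuous_on {0<..<L} h"
      using g h(1) continuous_on_subset by blast+
    from continuous_AE_eq[OF this \<open>AE x in lebesgue_on {0<..<L}. g x = h x\<close> that] show ?thesis by simp
  qed
  have "g x - h x = 0" if "x \<in> {0..L}" for x
  proof (rule continuous_constant_on_closure[of "{0<..<L}" "\<lambda>x. g x - h x"])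
    show "continuous_on (closure {0<..<L}) (\<lambda>x. g x - h x)"
      using L g h(1) by (auto intro!: continuous_intros)
    show "x \<in> closure {0<..<L}" using that L by simp
  qed (rule eq)
  then show "g = h" using g h(2) by (intro ext) (metis eq_iff_diff_eq_0)
qed

text \<open>The primitive in the normal form of \<open>cont_rep\<close>; elements of
  \<open>H1_star\<close> and \<open>H2_star\<close> are literally equal to such functions.\<close>

definition primr :: "real \<Rightarrow> l2 \<Rightarrow> real \<Rightarrow> real" where
  "primr L \<Phi> x = (if x \<in> {0..L} then prim L \<Phi> x else 0)"

lemma AE_primr: "AE x in lebesgue_on {0<..<L}. prim L \<Phi> x = primr L \<Phi> x"
  by (subst AE_restrict_space_iff) (auto simp: primr_def)

lemma primr_L2: "primr L \<Phi> \<in> L2 L" "emb L (primr L \<Phi>) = volterra L \<Phi>"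
  using L2_cong_AE[OF prim_in_L2 AE_primr] emb_cong_AE[OF prim_in_L2 AE_primr] by (auto simp: volterra_def)

lemma primr_continuous: "continuous_on {0..L} (primr L \<Phi>)"
  using prim_continuous[of "{0..L}" L \<Phi>] by (rule continuous_on_eq) (simp add: primr_def)

lemma primr_zero: "0 \<le> L \<Longrightarrow> primr L \<Phi> 0 = 0" by (simp add: primr_def prim_0)

lemma cont_rep_primr: "0 < L \<Longrightarrow> cont_rep L (primr L \<Phi>) = primr L \<Phi>"
  by (intro cont_rep_eqI primr_continuous) (auto simp: primr_def)

lemma primr_weak_deriv:
  assumes "0 < L" "g \<in> L2 L"
  shows "weak_deriv 0 L (primr L (emb L g)) g"
  unfolding weak_deriv_iff_prim[OF assms(1) primr_L2(1) assms(2)]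
  using AE_primr[of L "emb L g"] by (intro exI[of _ 0]) (auto elim: AE_mp)

text \<open>The constant of integration is the value of the continuous representative at 0.\<close>

lemma H1_regular_representative:
  assumes L: "0 < L" and f: "f \<in> L2 L" and g: "g \<in> L2 L" and w: "weak_deriv 0 L f g"
    and zero: "cont_rep L f 0 = 0"
  shows "cont_rep L f = primr L (emb L g)" "emb L f = volterra L (emb L g)"
proof -
  obtain C where C: "AE x in lebesgue_on {0<..<L}. f x = C + prim L (emb L g) x"
    using w weak_deriv_iff_prim[OF L f g] by blast
  have rep: "cont_rep L f = (\<lambda>x. if x \<in> {0..L} then C + prim L (emb L g) x else 0)"
  proof (rule cont_rep_eqI[OF L])
    have "continuous_on {0..L} (\<lambda>x. C + prim L (emb L g) x)" by (intro continuous_intros prim_continuous)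
    then show "continuous_on {0..L} (\<lambda>x. if x \<in> {0..L} then C + prim L (emb L g) x else 0)"
      by (rule continuous_on_eq) simp
    have "AE x in lebesgue_on {0<..<L}. x \<in> {0<..<L}" by (subst AE_restrict_space_iff) auto
    with C show "AE x in lebesgue_on {0<..<L}. f x = (if x \<in> {0..L} then C + prim L (emb L g) x else 0)"
      by eventually_elim auto
  qed auto
  have "C = 0" using zero L by (simp add: rep prim_0)
  then show "cont_rep L f = primr L (emb L g)" unfolding rep by (auto simp: primr_def)
  have "AE x in lebesgue_on {0<..<L}. prim L (emb L g) x = f x" using C \<open>C = 0\<close> by (auto elim: AE_mp)
  then show "emb L f = volterra L (emb L g)" using emb_cong_AE[OF prim_in_L2] by (simp add: volterra_def)
qed

text \<open>Together with \<open>H1_starI\<close> this makes the class of \<open>dx L v\<close> a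
  coordinate on \<open>H1_star\<close>: it determines \<open>v\<close> and may be any class from
  \<open>L2 L\<close>.\<close>

lemma H1_starD:
  assumes L: "0 < L" and v: "v \<in> H1_star L"
  shows "v \<in> L2 L" "dx L v \<in> L2 L" "v = primr L (emb L (dx L v))" "emb L v = volterra L (emb L (dx L v))"
proof -
  obtain g where v': "v \<in> L2 L" "cont_rep L v = v" "v 0 = 0" and g: "g \<in> L2 L" "weak_deriv 0 L v g"
    using v by (auto simp: H1_star_def)
  have zero: "cont_rep L v 0 = 0" using v' by simp
  show "v \<in> L2 L" "dx L v \<in> L2 L" using v' dx_eq[OF L g] by auto
  show "v = primr L (emb L (dx L v))" "emb L v = volterra L (emb L (dx L v))"
    using H1_regular_representative[OF L v'(1) g zero] v'(2) dx_eq(3)[OF L g] by auto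
qed

lemma H1_starI:
  assumes L: "0 < L" and g: "g \<in> L2 L"
  shows "primr L (emb L g) \<in> H1_star L" "emb L (dx L (primr L (emb L g))) = emb L g"
  using primr_weak_deriv[OF L g] primr_L2(1)[of L "emb L g"] cont_rep_primr[OF L, of "emb L g"]
    primr_zero[of L "emb L g"] dx_eq(3)[OF L g] g L
  by (auto simp: H1_star_def)

text \<open>The two boundary conditions at 0 fix both constants of integration, so the second
  derivative is a coordinate on \<open>H2_star\<close>.\<close>

lemma H2_starD:
  assumes L: "0 < L" and v: "v \<in> H2_star L"
  shows "v \<in> L2 L" "dx L v \<in> L2 L" "dx L (dx L v) \<in> L2 L"
    "v = primr L (volterra L (emb L (dx L (dx L v))))"
    "emb L (dx L v) = volterra L (emb L (dx L (dx L v)))"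
    "emb L v = volterra L (volterra L (emb L (dx L (dx L v))))"
proof -
  obtain h g where v': "v \<in> L2 L" "cont_rep L v = v" "v 0 = 0" and h: "h \<in> L2 L" "weak_deriv 0 L v h"
    and g: "g \<in> L2 L" "weak_deriv 0 L h g" and zero': "cont_rep L (dx L v) 0 = 0"
    using v by (auto simp: H2_star_def numeral_2_eq_2)
  note dv = dx_eq[OF L h]
  \<comment> \<open>\<open>dx L v\<close> may be another representative of \<open>h\<close>; weak
    derivatives do not see the difference.\<close>
  have w: "weak_deriv 0 L (dx L v) g" by (rule weak_deriv_cong[OF g(2) dv(1)])
  note ddv = dx_eq[OF L g(1) w]
  have zero: "cont_rep L v 0 = 0" using v' by simp
  show "v \<in> L2 L" "dx L v \<in> L2 L" "dx L (dx L v) \<in> L2 L" using v'(1) dv(2) ddv(2) by auto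
  show e: "emb L (dx L v) = volterra L (emb L (dx L (dx L v)))"
    using H1_regular_representative(2)[OF L dv(2) g(1) w zero'] ddv(3) by simp
  show "v = primr L (volterra L (emb L (dx L (dx L v))))"
    "emb L v = volterra L (volterra L (emb L (dx L (dx L v))))"
    using H1_regular_representative[OF L v'(1) h zero] v'(2) dv(3) e by auto
qed

lemma H2_starI:
  assumes L: "0 < L" and g: "g \<in> L2 L"
  defines "v \<equiv> primr L (volterra L (emb L g))"
  shows "v \<in> H2_star L" "emb L (dx L (dx L v)) = emb L g"
proof -
  let ?h = "primr L (emb L g)"
  have v: "v = primr L (emb L ?h)" by (simp add: v_def primr_L2)
  note w = primr_weak_deriv[OF L primr_L2(1)[of L "emb L g"], folded v]
  note dv = dx_eq[OF L primr_L2(1) w]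
  have w': "weak_deriv 0 L (dx L v) g"
    by (rule weak_deriv_cong[OF primr_weak_deriv[OF L g] dv(1)])
  have "cont_rep L (dx L v) = ?h"
    by (rule cont_rep_eqI[OF L primr_continuous]) (use dv(1) in \<open>auto simp: primr_def elim: AE_mp\<close>)
  then have "cont_rep L (dx L v) 0 = 0" using L by (simp add: primr_zero)
  moreover have "v \<in> sobolev_H L 2"
    using w primr_weak_deriv[OF L g] primr_L2(1) g unfolding numeral_2_eq_2 sobolev_H.simps v_def by blast
  ultimately show "v \<in> H2_star L"
    using cont_rep_primr[OF L] L by (auto simp: H2_star_def v_def primr_zero)
  show "emb L (dx L (dx L v)) = emb L g" by (rule dx_eq(3)[OF L g w'])
qed

text \<open>\<open>r\<close> is the weak derivative of its primitive, and weak derivatives are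
  unique.\<close>

lemma volterra_injective:
  assumes L: "0 < L" and r: "restrict_l2 L r = r" and zero: "volterra L r = 0"
  shows "r = 0"
proof -
  obtain f where f: "f \<in> L2 L" "r = emb L f" using r restrict_fixed_iff by blast
  have z: "(\<lambda>_. 0) \<in> L2 L" by (intro continuous_in_L2 continuous_intros)
  have ez: "emb L (\<lambda>_. 0) = 0" using emb_diff[OF z z] by simp
  then have "AE x in lebesgue_on {0<..<L}. 0 = prim L r x"
    using zero emb_eq_iff[OF z prim_in_L2, of r] by (simp add: volterra_def)
  then have "weak_deriv 0 L (\<lambda>_. 0) f"
    unfolding weak_deriv_iff_prim[OF L z f(1)] by (intro exI[of _ 0]) (simp add: f(2))
  moreover have "weak_deriv 0 L (\<lambda>_. 0) (\<lambda>_. 0)"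
    unfolding weak_deriv_iff_prim[OF L z z] by (intro exI[of _ 0]) (simp add: ez prim_def)
  ultimately have "AE x in lebesgue_on {0<..<L}. f x = 0" by (rule weak_deriv_unique[OF L])
  then have "emb L f = emb L (\<lambda>_. 0)" using emb_eq_iff[OF f(1) z] by simp
  then show ?thesis using f ez by simp
qed

text \<open>The choice inside \<open>dx\<close> spoils linearity for functions but not for
  classes.\<close>

lemma H1_star_diff:
  assumes L: "0 < L" and "v \<in> H1_star L" "w \<in> H1_star L"
  shows "(\<lambda>x. v x - w x) \<in> H1_star L"
    "emb L (dx L (\<lambda>x. v x - w x)) = emb L (dx L v) - emb L (dx L w)"
proof -
  note v = H1_starD[OF L assms(2)] and w = H1_starD[OF L assms(3)]
  let ?g = "\<lambda>x. dx L v x - dx L w x"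
  have g: "?g \<in> L2 L" "emb L ?g = emb L (dx L v) - emb L (dx L w)"
    using v(2) w(2) by (auto intro: L2_diff emb_diff)
  have "(\<lambda>x. v x - w x) = (\<lambda>x. primr L (emb L (dx L v)) x - primr L (emb L (dx L w)) x)"
    using v(3) w(3) by metis
  also have "\<dots> = primr L (emb L ?g)" unfolding g(2) by (auto simp: primr_def prim_linear)
  finally have e: "(\<lambda>x. v x - w x) = primr L (emb L ?g)" .
  show "(\<lambda>x. v x - w x) \<in> H1_star L" "emb L (dx L (\<lambda>x. v x - w x)) = emb L (dx L v) - emb L (dx L w)"
    unfolding e using H1_starI[OF L g(1)] g(2) by auto
qed

lemma H2_star_diff:
  assumes L: "0 < L" and "v \<in> H2_star L" "w \<in> H2_star L"
  shows "(\<lambda>x. v x - w x) \<in> H2_star L"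
    "emb L (dx L (dx L (\<lambda>x. v x - w x))) = emb L (dx L (dx L v)) - emb L (dx L (dx L w))"
proof -
  note v = H2_starD[OF L assms(2)] and w = H2_starD[OF L assms(3)]
  interpret V: bounded_linear "volterra L" by (rule bounded_linear_volterra[OF L])
  let ?g = "\<lambda>x. dx L (dx L v) x - dx L (dx L w) x"
  have g: "?g \<in> L2 L" "emb L ?g = emb L (dx L (dx L v)) - emb L (dx L (dx L w))"
    using v(3) w(3) by (auto intro: L2_diff emb_diff)
  have "(\<lambda>x. v x - w x) = (\<lambda>x. primr L (volterra L (emb L (dx L (dx L v)))) x - primr L (volterra L (emb L (dx L (dx L w)))) x)"
    using v(4) w(4) by metis
  also have "\<dots> = primr L (volterra L (emb L ?g))" unfolding g(2) V.diff by (auto simp: primr_def prim_linear)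
  finally have e: "(\<lambda>x. v x - w x) = primr L (volterra L (emb L ?g))" .
  show "(\<lambda>x. v x - w x) \<in> H2_star L"
    "emb L (dx L (dx L (\<lambda>x. v x - w x))) = emb L (dx L (dx L v)) - emb L (dx L (dx L w))"
    unfolding e using H2_starI[OF L g(1)] g(2) by auto
qed

section \<open>Weak derivatives in time\<close>

text \<open>\<open>f\<close> equals a constant plus the integral of \<open>g\<close>, first almost
  everywhere and then, by continuity, at every point.\<close>

lemma weak_deriv_imp_has_derivative:
  assumes w: "weak_deriv 0 T f g" and f: "continuous_on {0..T} f" and g: "continuous_on {0..T} g"
    and t: "t \<in> {0<..<T}"
  shows "(f has_real_derivative g t) (at t)"
proof -
  have T: "0 < T" using t by auto
  note ig = continuous_integrable_Ioo[OF g]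
  have loc: "locally_integrable 0 T f" using w by (simp add: weak_deriv_def)
  obtain C where C: "AE x in lebesgue_on {0<..<T}. f x = C + primitive (\<lambda>x. indicator {0<..<T} x * g x) x"
    using weak_deriv_iff_primitive[OF T loc ig] w by blast
  have prim: "primitive (\<lambda>x. indicator {0<..<T} x * g x) x = integral {0..x} g" if x: "x \<in> {0<..<T}" for x
  proof -
    have "primitive (\<lambda>x. indicator {0<..<T} x * g x) x = (LINT y|lebesgue. indicator {0<..x} y * g y)"
      unfolding primitive_def using x by (intro Bochner_Integration.integral_cong) (auto simp: indicator_def)
    also have "\<dots> = (LINT y|lebesgue_on {0<..x}. g y)"
      by (rule integral_lebesgue_on_indicator[symmetric]) simp
    also have "\<dots> = integral {0<..x} g"
    proof (rule lebesgue_integral_eq_integral)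
      have "integrable lebesgue (\<lambda>y. indicator {0<..x} y *\<^sub>R (indicator {0<..<T} y * g y))"
        by (rule integrable_mult_indicator[OF _ ig]) simp
      also have "(\<lambda>y. indicator {0<..x} y *\<^sub>R (indicator {0<..<T} y * g y)) = (\<lambda>y. indicator {0<..x} y *\<^sub>R g y)"
        using x by (auto simp: indicator_def)
      finally show "integrable (lebesgue_on {0<..x}) g" by (subst integrable_restrict_space) auto
    qed simp
    also have "\<dots> = integral {0..x} g"
      by (rule integral_spike_set; rule negligible_subset[of "{0}"]) auto
    finally show ?thesis .
  qed
  have deriv: "((\<lambda>x. C + integral {0..x} g) has_real_derivative g x) (at x)" if x: "x \<in> {0<..<T}" for x
  proof -
    have "((\<lambda>x. integral {0..x} g) has_vector_derivative g x) (at x within {0..T})"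
      using x by (intro integral_has_vector_derivative g) auto
    then have "((\<lambda>x. integral {0..x} g) has_real_derivative g x) (at x)"
      using x by (simp add: at_within_Icc_at has_real_derivative_iff_has_vector_derivative)
    then show ?thesis using DERIV_add[OF DERIV_const] by force
  qed
  have "AE x in lebesgue_on {0<..<T}. x \<in> {0<..<T}" by (subst AE_restrict_space_iff) auto
  with C have "AE x in lebesgue_on {0<..<T}. f x = C + integral {0..x} g"
    by eventually_elim (simp add: prim)
  moreover have "continuous_on {0<..<T} (\<lambda>x. C + integral {0..x} g)"
    by (rule DERIV_continuous_on, rule has_field_derivative_at_within, rule deriv)
  moreover have "continuous_on {0<..<T} f"
    by (rule continuous_on_subset[OF f]) auto
  ultimately have eq: "f x = C + integral {0..x} g" if "x \<in> {0<..<T}" for x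
    using continuous_AE_eq that by blast
  show ?thesis
    by (rule has_field_derivative_transform_within_open[OF deriv[OF t], of "{0<..<T}"]) (use t in \<open>auto simp: eq\<close>)
qed

lemma emb_sum:
  assumes "finite A" "\<And>y. y \<in> A \<Longrightarrow> f y \<in> L2 L"
  shows "(\<lambda>x. \<Sum>y\<in>A. c y * f y x) \<in> L2 L \<and> emb L (\<lambda>x. \<Sum>y\<in>A. c y * f y x) = (\<Sum>y\<in>A. c y *\<^sub>R emb L (f y))"
  using assms
proof (induction A)
  case empty
  have z: "(\<lambda>_. 0) \<in> L2 L" by (intro continuous_in_L2 continuous_intros)
  then show ?case using emb_diff[OF z z] by simp
next
  case (insert y A)
  then show ?case by (simp add: L2_add L2_scale emb_add emb_scale)
qed

lemma abs_L2_inner_le: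
  assumes "f \<in> L2 L" "\<xi> \<in> L2 L" "L2_norm L \<xi> \<le> 1"
  shows "\<bar>L2_inner L f \<xi>\<bar> \<le> L2_norm L f"
proof -
  have "\<bar>L2_inner L f \<xi>\<bar> \<le> L2_norm L f * L2_norm L \<xi>"
    using assms by (simp add: L2_inner_emb L2_norm_emb Cauchy_Schwarz_ineq2)
  also have "\<dots> \<le> L2_norm L f * 1" using assms by (intro mult_left_mono) (auto simp: L2_norm_emb)
  finally show ?thesis by simp
qed

lemma simple_integral_inner:
  assumes s: "simple_fun T (L2 L) s" and \<xi>: "\<xi> \<in> L2 L"
  shows "integrable (lebesgue_on {0<..<T}) (\<lambda>t. L2_inner L (s t) \<xi>)"
    "simple_integral T s \<in> L2 L"
    "(LINT t|lebesgue_on {0<..<T}. L2_inner L (s t) \<xi>) = L2_inner L (simple_integral T s) \<xi>"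
proof -
  let ?\<Omega> = "{0<..<T}" and ?M = "lebesgue_on {0<..<T}"
  have sf: "simple_function ?M s" and sX: "s ` ?\<Omega> \<subseteq> L2 L" using s by (auto simp: simple_fun_def)
  have fin: "finite (s ` ?\<Omega>)" using simple_functionD(1)[OF sf] by simp
  define E where "E y = {t \<in> ?\<Omega>. s t = y}" for y
  have E: "E y \<in> sets ?M" for y
  proof -
    have "s -` {y} \<inter> space ?M \<in> sets ?M" using simple_functionD(2)[OF sf] by blast
    also have "s -` {y} \<inter> space ?M = E y" by (auto simp: E_def)
    finally show ?thesis .
  qed
  interpret finite_measure ?M by (rule finite_measure_lebesgue_on) (simp add: lmeasurable_interval)
  have eq: "L2_inner L (s t) \<xi> = (\<Sum>y\<in>s ` ?\<Omega>. L2_inner L y \<xi> * indicator (E y) t)" if "t \<in> ?\<Omega>" for t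
  proof -
    have "(\<Sum>y\<in>s ` ?\<Omega>. L2_inner L y \<xi> * indicator (E y) t) = (\<Sum>y\<in>s ` ?\<Omega>. if y = s t then L2_inner L y \<xi> else 0)"
      using that by (intro sum.cong) (auto simp: E_def indicator_def)
    also have "\<dots> = L2_inner L (s t) \<xi>" using fin that by simp
    finally show ?thesis by simp
  qed
  have int: "integrable ?M (\<lambda>t. \<Sum>y\<in>s ` ?\<Omega>. L2_inner L y \<xi> * indicator (E y) t)"
    by (intro Bochner_Integration.integrable_sum integrable_mult_right integrable_real_indicator E)
       (simp add: less_top[symmetric])
  show "integrable ?M (\<lambda>t. L2_inner L (s t) \<xi>)"
    using int by (rule Bochner_Integration.integrable_cong[THEN iffD1, rotated 2]) (auto simp: eq)
  have sy: "y \<in> L2 L" if "y \<in> s ` ?\<Omega>" for y using sX that by blast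
  note es = emb_sum[OF fin, of "\<lambda>y. y" L "\<lambda>y. measure lebesgue (E y)", OF sy]
  have si: "simple_integral T s = (\<lambda>x. \<Sum>y\<in>s ` ?\<Omega>. measure lebesgue (E y) * y x)"
    by (simp add: simple_integral_def E_def)
  show siL: "simple_integral T s \<in> L2 L" unfolding si using es by blast
  have "(LINT t|?M. L2_inner L (s t) \<xi>) = (LINT t|?M. (\<Sum>y\<in>s ` ?\<Omega>. L2_inner L y \<xi> * indicator (E y) t))"
    by (intro Bochner_Integration.integral_cong) (auto simp: eq)
  also have "\<dots> = (\<Sum>y\<in>s ` ?\<Omega>. (LINT t|?M. L2_inner L y \<xi> * indicator (E y) t))"
    by (intro Bochner_Integration.integral_sum integrable_mult_right integrable_real_indicator E)
       (simp add: less_top[symmetric])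
  also have "\<dots> = (\<Sum>y\<in>s ` ?\<Omega>. L2_inner L y \<xi> * measure lebesgue (E y))"
  proof (intro sum.cong refl)
    fix y
    have "E y \<subseteq> ?\<Omega>" by (auto simp: E_def)
    then show "(LINT t|?M. L2_inner L y \<xi> * indicator (E y) t) = L2_inner L y \<xi> * measure lebesgue (E y)"
      using E[of y] by (simp add: measure_restrict_space Int_absorb2)
  qed
  also have "\<dots> = L2_inner L (simple_integral T s) \<xi>"
  proof -
    have "L2_inner L (simple_integral T s) \<xi> = (\<Sum>y\<in>s ` ?\<Omega>. measure lebesgue (E y) *\<^sub>R emb L y) \<bullet> emb L \<xi>"
      using es L2_inner_emb[OF siL \<xi>] unfolding si by simp
    also have "\<dots> = (\<Sum>y\<in>s ` ?\<Omega>. L2_inner L y \<xi> * measure lebesgue (E y))"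
      unfolding inner_sum_left by (intro sum.cong) (auto simp: L2_inner_emb[OF sy \<xi>])
    finally show ?thesis by simp
  qed
  finally show "(LINT t|?M. L2_inner L (s t) \<xi>) = L2_inner L (simple_integral T s) \<xi>" .
qed

text \<open>
  With \<open>L2_norm L \<xi> \<le> 1\<close> no constant has to be moved out of the integral of \<open>L2_norm L (u - s)\<close>, whose
  integrand need not be measurable.
\<close>

lemma bochner_integral_inner:
  assumes b: "bochner_integral_is T (L2 L) (L2_norm L) u I"
    and u: "\<And>t. t \<in> {0<..<T} \<Longrightarrow> u t \<in> L2 L" and \<xi>: "\<xi> \<in> L2 L" "L2_norm L \<xi> \<le> 1"
    and int: "integrable (lebesgue_on {0<..<T}) (\<lambda>t. L2_inner L (u t) \<xi>)"
  shows "(LINT t|lebesgue_on {0<..<T}. L2_inner L (u t) \<xi>) = L2_inner L I \<xi>"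
proof -
  let ?M = "lebesgue_on {0<..<T}"
  obtain s where s: "\<And>n. simple_fun T (L2 L) (s n)" and I: "I \<in> L2 L"
    and lim1: "(\<lambda>n. \<integral>\<^sup>+ t. ennreal (L2_norm L (\<lambda>x. u t x - s n t x)) \<partial>?M) \<longlonglongrightarrow> 0"
    and lim2: "(\<lambda>n. L2_norm L (\<lambda>x. simple_integral T (s n) x - I x)) \<longlonglongrightarrow> 0"
    using b unfolding bochner_integral_is_def by blast
  note si = simple_integral_inner[OF s \<xi>(1)]
  have sL: "s n t \<in> L2 L" if "t \<in> {0<..<T}" for n t using s[of n] that by (auto simp: simple_fun_def)
  have diff: "L2_inner L f \<xi> - L2_inner L g \<xi> = L2_inner L (\<lambda>x. f x - g x) \<xi>" if "f \<in> L2 L" "g \<in> L2 L" for f g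
    using that \<xi>(1) by (simp add: L2_inner_emb L2_diff emb_diff inner_diff_left)
  have "(\<lambda>n. ennreal (norm ((LINT t|?M. L2_inner L (u t) \<xi>) - (LINT t|?M. L2_inner L (s n t) \<xi>)))) \<longlonglongrightarrow> 0"
  proof (rule tendsto_sandwich[OF always_eventually always_eventually tendsto_const lim1]; intro allI)
    fix n
    have "(LINT t|?M. L2_inner L (u t) \<xi>) - (LINT t|?M. L2_inner L (s n t) \<xi>) = (LINT t|?M. L2_inner L (u t) \<xi> - L2_inner L (s n t) \<xi>)"
      using int si(1) by simp
    then have "ennreal (norm ((LINT t|?M. L2_inner L (u t) \<xi>) - (LINT t|?M. L2_inner L (s n t) \<xi>)))
       \<le> (\<integral>\<^sup>+ t. ennreal (norm (L2_inner L (u t) \<xi> - L2_inner L (s n t) \<xi>)) \<partial>?M)"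
      using int si(1) by (simp only:) (intro integral_norm_bound_ennreal Bochner_Integration.integrable_diff)
    also have "\<dots> \<le> (\<integral>\<^sup>+ t. ennreal (L2_norm L (\<lambda>x. u t x - s n t x)) \<partial>?M)"
    proof (intro nn_integral_mono ennreal_leI)
      fix t assume "t \<in> space ?M"
      then have t: "t \<in> {0<..<T}" by simp
      show "norm (L2_inner L (u t) \<xi> - L2_inner L (s n t) \<xi>) \<le> L2_norm L (\<lambda>x. u t x - s n t x)"
        unfolding diff[OF u[OF t] sL[OF t]] real_norm_def
        by (intro abs_L2_inner_le L2_diff u sL t \<xi>)
    qed
    finally show "ennreal (norm ((LINT t|?M. L2_inner L (u t) \<xi>) - (LINT t|?M. L2_inner L (s n t) \<xi>)))
       \<le> (\<integral>\<^sup>+ t. ennreal (L2_norm L (\<lambda>x. u t x - s n t x)) \<partial>?M)" .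
  qed simp
  then have "(\<lambda>n. norm ((LINT t|?M. L2_inner L (u t) \<xi>) - (LINT t|?M. L2_inner L (s n t) \<xi>))) \<longlonglongrightarrow> 0"
    by (subst (asm) ennreal_0[symmetric], subst (asm) tendsto_ennreal_iff) auto
  then have 1: "(\<lambda>n. L2_inner L (simple_integral T (s n)) \<xi>) \<longlonglongrightarrow> (LINT t|?M. L2_inner L (u t) \<xi>)"
    unfolding si(3) by (subst tendsto_dist_iff) (simp add: dist_norm abs_minus_commute)
  have "(\<lambda>n. L2_inner L (simple_integral T (s n)) \<xi> - L2_inner L I \<xi>) \<longlonglongrightarrow> 0"
  proof (rule Lim_null_comparison[OF _ lim2], intro always_eventually allI)
    show "norm (L2_inner L (simple_integral T (s n)) \<xi> - L2_inner L I \<xi>) \<le> L2_norm L (\<lambda>x. simple_integral T (s n) x - I x)" for n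
      unfolding diff[OF si(2) I] real_norm_def by (intro abs_L2_inner_le L2_diff si(2) I \<xi>)
  qed
  then have "(\<lambda>n. L2_inner L (simple_integral T (s n)) \<xi>) \<longlonglongrightarrow> L2_inner L I \<xi>" by (rule LIM_zero_cancel)
  with 1 show ?thesis by (rule LIMSEQ_unique)
qed

text \<open>The two Bochner integrals in the definition have the same value \<open>I\<close>;
  pairing it with \<open>\<xi>\<close> turns the vector identity into a scalar one.\<close>

lemma H1_in_imp_weak_deriv:
  assumes T: "0 < T" and H: "H1_in_with_deriv T (L2 L) (L2_norm L) w v"
    and w: "\<And>t. t \<in> {0..T} \<Longrightarrow> w t \<in> L2 L" and v: "\<And>t. t \<in> {0..T} \<Longrightarrow> v t \<in> L2 L"
    and \<xi>: "\<xi> \<in> L2 L" "L2_norm L \<xi> \<le> 1"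
    and cw: "continuous_on {0..T} (\<lambda>t. L2_inner L (w t) \<xi>)" and cv: "continuous_on {0..T} (\<lambda>t. L2_inner L (v t) \<xi>)"
  shows "weak_deriv 0 T (\<lambda>t. L2_inner L (w t) \<xi>) (\<lambda>t. L2_inner L (v t) \<xi>)"
proof -
  note loc = locally_integrable_of_integrable[OF continuous_integrable_Ioo]
  show ?thesis unfolding weak_deriv_def
  proof (intro conjI loc cw cv ballI)
    fix \<theta> assume \<theta>: "\<theta> \<in> test_functions 0 T"
    obtain I where I: "bochner_integral_is T (L2 L) (L2_norm L) (\<lambda>t x. deriv \<theta> t * w t x) I"
      "bochner_integral_is T (L2 L) (L2_norm L) (\<lambda>t x. - (\<theta> t * v t x)) I"
      using H \<theta> unfolding H1_in_with_deriv_def by blast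
    have sc: "L2_inner L (\<lambda>x. c * f x) \<xi> = c * L2_inner L f \<xi>" if "f \<in> L2 L" for c f
      using that \<xi>(1) by (simp add: L2_inner_emb L2_scale emb_scale)
    have int: "integrable (lebesgue_on {0<..<T}) (\<lambda>t. f t * \<phi> t)"
      if "continuous_on {0..T} f" "\<phi> \<in> test_functions 0 T" for f \<phi>
    proof -
      have "integrable lebesgue (\<lambda>x. indicator {0<..<T} x *\<^sub>R (f x * \<phi> x))"
        by (intro integrable_mult_indicator integrable_mult_test[OF T loc] that) simp
      then show ?thesis by (subst integrable_restrict_space) auto
    qed
    note d = test_functions_deriv[OF T \<theta>]
    have e1: "L2_inner L (\<lambda>x. deriv \<theta> t * w t x) \<xi> = L2_inner L (w t) \<xi> * deriv \<theta> t" if "t \<in> {0<..<T}" for t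
      using sc[OF w[of t]] that by simp
    have e2: "L2_inner L (\<lambda>x. - (\<theta> t * v t x)) \<xi> = - (L2_inner L (v t) \<xi> * \<theta> t)" if "t \<in> {0<..<T}" for t
      using sc[OF v[of t], of "- \<theta> t"] that by simp
    have "(LINT t|lebesgue_on {0<..<T}. L2_inner L (\<lambda>x. deriv \<theta> t * w t x) \<xi>) = L2_inner L I \<xi>"
    proof (rule bochner_integral_inner[OF I(1) _ \<xi>])
      show "integrable (lebesgue_on {0<..<T}) (\<lambda>t. L2_inner L (\<lambda>x. deriv \<theta> t * w t x) \<xi>)"
        using int[OF cw d] by (rule Bochner_Integration.integrable_cong[THEN iffD1, rotated 2]) (auto simp: e1)
    qed (use w in \<open>auto intro: L2_scale\<close>)
    moreover have "(LINT t|lebesgue_on {0<..<T}. L2_inner L (\<lambda>x. - (\<theta> t * v t x)) \<xi>) = L2_inner L I \<xi>"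
    proof (rule bochner_integral_inner[OF I(2) _ \<xi>])
      show "integrable (lebesgue_on {0<..<T}) (\<lambda>t. L2_inner L (\<lambda>x. - (\<theta> t * v t x)) \<xi>)"
        using int[OF cv \<theta>, THEN Bochner_Integration.integrable_minus]
        by (rule Bochner_Integration.integrable_cong[THEN iffD1, rotated 2]) (auto simp: e2)
      show "(\<lambda>x. - (\<theta> t * v t x)) \<in> L2 L" if "t \<in> {0<..<T}" for t
        using L2_scale[OF v[of t], of "- \<theta> t"] that by simp
    qed
    moreover have "(LINT t|lebesgue_on {0<..<T}. L2_inner L (\<lambda>x. deriv \<theta> t * w t x) \<xi>)
       = (LINT t|lebesgue_on {0<..<T}. L2_inner L (w t) \<xi> * deriv \<theta> t)"
      by (intro Bochner_Integration.integral_cong) (auto simp: e1)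
    moreover have "(LINT t|lebesgue_on {0<..<T}. L2_inner L (\<lambda>x. - (\<theta> t * v t x)) \<xi>)
       = (LINT t|lebesgue_on {0<..<T}. - (L2_inner L (v t) \<xi> * \<theta> t))"
      by (intro Bochner_Integration.integral_cong) (auto simp: e2)
    ultimately show "(LINT x|lebesgue_on {0<..<T}. L2_inner L (w x) \<xi> * deriv \<theta> x) =
       - (LINT x|lebesgue_on {0<..<T}. L2_inner L (v x) \<xi> * \<theta> x)" by simp
  qed
qed

section \<open>The phase space and the beam semigroup\<close>

lemma weak_deriv_minus: "weak_deriv a b f g \<Longrightarrow> weak_deriv a b (\<lambda>x. - f x) (\<lambda>x. - g x)"
  by (simp add: weak_deriv_def locally_integrable_def)

definition reflected :: "real \<Rightarrow> (real \<Rightarrow> real) \<Rightarrow> (real \<Rightarrow> real) \<Rightarrow> bool" where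
  "reflected L f g \<longleftrightarrow> f = g \<or> (AE x in lebesgue_on {0<..<L}. - f x = g x)"

text \<open>
  \<open>Metric_space\<close> demands symmetry of \<open>phase_dist\<close> also outside the phase space. If neither function has a
  weak derivative, the choice in \<open>dx\<close> returns the same junk for both.
\<close>

lemma reflected_dx:
  assumes L: "0 < L" and r: "reflected L f g"
  shows "reflected L (dx L f) (dx L g)"
proof (cases "f = g")
  case False
  then have eq: "AE x in lebesgue_on {0<..<L}. - f x = g x" using r by (simp add: reflected_def)
  have fg: "weak_deriv 0 L g (\<lambda>x. - h x)" if "weak_deriv 0 L f h" for h
    using weak_deriv_cong[OF weak_deriv_minus[OF that] eq] .
  have gf: "\<exists>h. weak_deriv 0 L f h" if "weak_deriv 0 L g h" for h
  proof -
    have "AE x in lebesgue_on {0<..<L}. - g x = f x" using eq by eventually_elim simp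
    from weak_deriv_cong[OF weak_deriv_minus[OF that] this] show ?thesis by blast
  qed
  show ?thesis
  proof (cases "\<exists>h. weak_deriv 0 L f h")
    case True
    then have f: "weak_deriv 0 L f (dx L f)" using weak_deriv_dx by blast
    have "AE x in lebesgue_on {0<..<L}. - dx L f x = dx L g x"
      by (rule weak_deriv_unique[OF L fg[OF f] weak_deriv_dx[OF fg[OF f]]])
    then show ?thesis by (simp add: reflected_def)
  next
    case False
    then have "weak_deriv 0 L f = (\<lambda>_. False)" "weak_deriv 0 L g = (\<lambda>_. False)"
      using gf by (auto simp: fun_eq_iff)
    then show ?thesis by (simp add: reflected_def dx_def)
  qed
qed (simp add: reflected_def)

lemma reflected_norm: "reflected L f g \<Longrightarrow> L2_norm L f = L2_norm L g"
  unfolding reflected_def L2_norm_def L2_inner_def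
proof (elim disjE)
  assume "AE x in lebesgue_on {0<..<L}. - f x = g x"
  then have "AE x in lebesgue_on {0<..<L}. f x * f x = g x * g x"
    by eventually_elim (metis minus_mult_minus)
  from LINT_on_cong_AE[OF this]
  show "sqrt (LINT x|lebesgue_on {0<..<L}. f x * f x) = sqrt (LINT x|lebesgue_on {0<..<L}. g x * g x)" by simp
qed simp

lemma phase_dist_commute: "0 < L \<Longrightarrow> phase_dist L D \<alpha> y z = phase_dist L D \<alpha> z y"
proof -
  assume L: "0 < L"
  have "reflected L (\<lambda>x. f x - g x) (\<lambda>x. g x - f x)" for f g :: "real \<Rightarrow> real" by (simp add: reflected_def)
  note r = this reflected_dx[OF L this] reflected_dx[OF L reflected_dx[OF L this]]
  note n = r[THEN reflected_norm]
  show ?thesis unfolding phase_dist_def phase_norm_def fst_conv snd_conv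
    by (simp only: n(3)[of "fst y" "fst z"] n(2)[of "snd y" "snd z"] n(1)[of "snd y" "snd z"])
qed

context beam_operator
begin

text \<open>With these weights the energy norm is the norm of a product of Hilbert spaces; the third
  component carries the L^2 part of the velocity norm.\<close>

definition state_vec :: "'a \<Rightarrow> 'a \<Rightarrow> 'a \<times> 'a \<times> 'a" where
  "state_vec p q = (sqrt D *\<^sub>R p, sqrt \<alpha> *\<^sub>R q, J q)"

lemma sqrt_en: "sqrt (en p q) = norm (state_vec p q)"
  using pos by (simp add: state_vec_def norm_Pair en_def kin_def power_mult_distrib power2_norm_eq_inner add_ac)

lemma state_vec_linear: "state_vec (p - p') (q - q') = state_vec p q - state_vec p' q'"
  by (simp add: state_vec_def J.diff scaleR_diff_right)

lemma norm_le_sqrt_en: "norm p \<le> sqrt (en p q) / sqrt D" "norm q \<le> sqrt (en p q) / sqrt \<alpha>"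
  using norm_le_en[of p q "en p q"] by (simp_all add: real_sqrt_divide)

end

section \<open>The phase space in coordinates\<close>

locale beam_problem =
  fixes L D b1 b2 U \<beta> \<alpha> k0 :: real and p0 :: "real \<Rightarrow> real" and S :: "real \<Rightarrow> state \<Rightarrow> state"
  assumes params: "0 < L" "0 < D" "0 < b2" "p0 \<in> L2 L" "0 \<le> \<beta>" "0 < \<alpha>" "0 < k0"
    and sys: "beam_dynamical_system L D b1 b2 p0 U \<beta> \<alpha> k0 S"
begin

sublocale op: beam_operator "volterra L" D b1 b2 \<beta> U \<alpha> k0 "emb L p0"
  by (rule beam_operator.intro) (use params bounded_linear_volterra[OF params(1)] in auto)

definition pc :: "state \<Rightarrow> l2" where "pc y = emb L (dx L (dx L (fst y)))"
definition qc :: "state \<Rightarrow> l2" where "qc y = emb L (dx L (snd y))"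

abbreviation "M \<equiv> phase_space L"
abbreviation "d \<equiv> phase_dist L D \<alpha>"

lemma fst_snd: "y \<in> M \<Longrightarrow> fst y \<in> H2_star L" "y \<in> M \<Longrightarrow> snd y \<in> H1_star L"
  by (auto simp: phase_space_def)

lemma d_eq:
  assumes "y \<in> M" "z \<in> M"
  shows "d y z = sqrt (op.en (pc y - pc z) (qc y - qc z))"
proof -
  let ?w = "\<lambda>x. fst y x - fst z x" and ?v = "\<lambda>x. snd y x - snd z x"
  note w = H2_star_diff[OF params(1) fst_snd(1)[OF assms(1)] fst_snd(1)[OF assms(2)]]
  note v = H1_star_diff[OF params(1) fst_snd(2)[OF assms(1)] fst_snd(2)[OF assms(2)]]
  note W = H2_starD[OF params(1) w(1)] and V = H1_starD[OF params(1) v(1)]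
  show ?thesis
    unfolding phase_dist_def phase_norm_def fst_conv snd_conv op.en_def op.kin_def pc_def qc_def
      L2_norm_emb[OF W(3)] L2_norm_emb[OF V(2)] L2_norm_emb[OF V(1)] w(2) V(4) v(2) power2_norm_eq_inner
    by (simp add: add_ac)
qed

lemma d_vec: "y \<in> M \<Longrightarrow> z \<in> M \<Longrightarrow> d y z = norm (op.state_vec (pc y) (qc y) - op.state_vec (pc z) (qc z))"
  by (simp add: d_eq op.sqrt_en op.state_vec_linear)

lemma state_eqI:
  assumes "y \<in> M" "z \<in> M" "pc y = pc z" "qc y = qc z"
  shows "y = z"
  using H2_starD(4)[OF params(1) fst_snd(1)] H1_starD(3)[OF params(1) fst_snd(2)] assms
  unfolding pc_def qc_def by (metis prod.collapse)

lemma phase_metric: "Metric_space M d"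
proof
  show "0 \<le> d x y" for x y
    unfolding phase_dist_def phase_norm_def using params by simp
  show "d x y = d y x" for x y by (rule phase_dist_commute[OF params(1)])
  show "d x y = 0 \<longleftrightarrow> x = y" if "x \<in> M" "y \<in> M" for x y
  proof
    assume "d x y = 0"
    then have "sqrt (op.en (pc x - pc y) (qc x - qc y)) = 0" using d_eq that by simp
    then have "norm (pc x - pc y) \<le> 0" "norm (qc x - qc y) \<le> 0"
      using op.norm_le_sqrt_en[where p = "pc x - pc y" and q = "qc x - qc y"] by simp_all
    then show "x = y" using state_eqI that by simp
  qed (use d_vec that in simp)
  show "d x z \<le> d x y + d y z" if "x \<in> M" "y \<in> M" "z \<in> M" for x y z
    using that by (simp add: d_vec norm_diff_triangle_ineq[of _ _ _ 0, simplified] norm_triangle_sub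
      dist_norm[symmetric] dist_triangle)
qed

sublocale Metric_space M d by (rule phase_metric)

definition code :: "state \<Rightarrow> l2 \<times> l2 \<times> l2" where "code y = op.state_vec (pc y) (qc y)"

lemma dist_code: "y \<in> M \<Longrightarrow> z \<in> M \<Longrightarrow> dist (code y) (code z) = d y z"
  by (simp add: code_def d_vec dist_norm)

lemma pc_qc_code: "pc y = fst (code y) /\<^sub>R sqrt D" "qc y = fst (snd (code y)) /\<^sub>R sqrt \<alpha>"
  using params by (simp_all add: code_def op.state_vec_def)

lemma restrict_codes: "y \<in> M \<Longrightarrow> restrict_l2 L (pc y) = pc y" "y \<in> M \<Longrightarrow> restrict_l2 L (qc y) = qc y"
  using H2_starD(3)[OF params(1) fst_snd(1)] H1_starD(2)[OF params(1) fst_snd(2)]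
  by (auto simp: pc_def qc_def restrict_emb)

text \<open>The converse of \<open>restrict_codes\<close>: integrating the coordinates rebuilds a
  state.\<close>

lemma decode:
  assumes "restrict_l2 L p = p" "restrict_l2 L q = q"
  obtains y where "y \<in> M" "pc y = p" "qc y = q"
proof -
  obtain g h where g: "g \<in> L2 L" "p = emb L g" and h: "h \<in> L2 L" "q = emb L h"
    using assms restrict_fixed_iff by (metis image_iff)
  show ?thesis
    by (rule that[of "(primr L (volterra L (emb L g)), primr L (emb L h))"])
       (use H2_starI[OF params(1) g(1)] H1_starI[OF params(1) h(1)] g h in \<open>auto simp: phase_space_def pc_def qc_def\<close>)
qed

text \<open>\<open>code\<close> is an isometry into a complete space, and its image is closed
  because the coordinates of a limit stay fixed under the continuous projection
  \<open>restrict_l2\<close>.\<close>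

lemma phase_complete: mcomplete
  unfolding mcomplete_def
proof (intro allI impI)
  fix \<sigma> assume \<sigma>: "MCauchy \<sigma>"
  then have \<sigma>M: "\<sigma> n \<in> M" for n by (auto simp: MCauchy_def)
  have C: "\<exists>N. \<forall>m\<ge>N. \<forall>n\<ge>N. d (\<sigma> m) (\<sigma> n) < e" if "0 < e" for e
    using \<sigma> that by (simp add: MCauchy_def)
  have "Cauchy (\<lambda>n. code (\<sigma> n))"
    unfolding Cauchy_def dist_code[OF \<sigma>M \<sigma>M] using C by blast
  then obtain x where x: "(\<lambda>n. code (\<sigma> n)) \<longlonglongrightarrow> x"
    using Cauchy_convergent convergent_def by blast
  define p where "p = fst x /\<^sub>R sqrt D"
  define q where "q = fst (snd x) /\<^sub>R sqrt \<alpha>"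
  have p: "(\<lambda>n. pc (\<sigma> n)) \<longlonglongrightarrow> p" and q: "(\<lambda>n. qc (\<sigma> n)) \<longlonglongrightarrow> q"
    unfolding pc_qc_code p_def q_def by (intro tendsto_intros x)+
  interpret R: bounded_linear "restrict_l2 L" by (rule bounded_linear_restrict)
  have "restrict_l2 L p = p"
    using LIMSEQ_unique[OF R.tendsto[OF p]] p restrict_codes(1)[OF \<sigma>M] by simp
  moreover have "restrict_l2 L q = q"
    using LIMSEQ_unique[OF R.tendsto[OF q]] q restrict_codes(2)[OF \<sigma>M] by simp
  ultimately obtain y where y: "y \<in> M" "pc y = p" "qc y = q" by (rule decode)
  have "(\<lambda>n. op.state_vec (pc (\<sigma> n)) (qc (\<sigma> n)) - op.state_vec p q) \<longlonglongrightarrow> op.state_vec p q - op.state_vec p q"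
    unfolding op.state_vec_def by (intro tendsto_intros op.J.tendsto p q)
  then have "(\<lambda>n. d (\<sigma> n) y) \<longlonglongrightarrow> 0"
    using tendsto_norm by (fastforce simp: d_vec[OF \<sigma>M y(1)] y)
  then have "limitin mtopology \<sigma> y sequentially"
    using y \<sigma>M by (simp add: limitin_metric_dist_null)
  then show "\<exists>x. limitin mtopology \<sigma> x sequentially" ..
qed

section \<open>Orbits of the semigroup as trajectories\<close>

lemma
  shows S_semigroup: "semigroup_on M S"
    and S_gen: "\<And>T y. 0 < T \<Longrightarrow> y \<in> M \<Longrightarrow> generalized_solution L D b1 b2 p0 U \<beta> \<alpha> k0 T y (\<lambda>t. S t y)"
    and S_eps: "\<And>T y e. 0 < T \<Longrightarrow> y \<in> M \<Longrightarrow> 0 < e \<Longrightarrow> \<exists>\<delta>>0. \<forall>z\<in>M. d y z < \<delta> \<longrightarrow> (\<forall>t\<in>{0..T}. d (S t y) (S t z) < e)"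
  using sys unfolding beam_dynamical_system_def by blast+

lemma S_mem: "0 \<le> t \<Longrightarrow> y \<in> M \<Longrightarrow> S t y \<in> M"
  using S_semigroup unfolding semigroup_on_def by blast

lemma S_zero: "y \<in> M \<Longrightarrow> S 0 y = y"
  using S_semigroup unfolding semigroup_on_def by blast

lemma S_continuous: "0 \<le> t \<Longrightarrow> continuous_map mtopology mtopology (S t)"
proof -
  assume t: "0 \<le> t"
  show ?thesis
    unfolding metric_continuous_map[OF phase_metric]
  proof (intro conjI ballI allI impI)
    show "S t ` M \<subseteq> M" using S_mem[OF t] by blast
    fix a and e :: real assume "a \<in> M" "0 < e"
    \<comment> \<open>The horizon \<open>t + 1\<close> is positive even for
      \<open>t = 0\<close>.\<close>
    then obtain \<delta> where "\<delta> > 0" "\<And>z. z \<in> M \<Longrightarrow> d a z < \<delta> \<Longrightarrow> d (S t a) (S t z) < e"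
      using S_eps[of "t + 1" a e] t by auto
    then show "\<exists>\<delta>>0. \<forall>x. x \<in> M \<and> d a x < \<delta> \<longrightarrow> d (S t a) (S t x) < e" by blast
  qed
qed

lemma S_continuous_in_time:
  assumes y: "y \<in> M"
  shows "continuous_on {0..} (\<lambda>t. pc (S t y))" "continuous_on {0..} (\<lambda>t. qc (S t y))"
proof -
  have *: "\<exists>\<delta>>0. \<forall>s\<ge>0. \<bar>s - t\<bar> < \<delta> \<longrightarrow> d (S s y) (S t y) < e" if t: "0 \<le> t" and e: "0 < e" for t e
  proof -
    have cm: "continuous_map (top_of_set {0..t+1}) mtopology (\<lambda>t. S t y)"
      using S_gen[of "t+1" y] t y unfolding generalized_solution_def continuous_in_phase_space_def by auto
    have "openin (top_of_set {0..t+1}) {s \<in> {0..t+1}. S s y \<in> mball (S t y) e}"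
      using openin_continuous_map_preimage[OF cm openin_mball] by simp
    then obtain V where V: "open V" "{s \<in> {0..t+1}. S s y \<in> mball (S t y) e} = {0..t+1} \<inter> V"
      unfolding openin_open by blast
    have "S t y \<in> mball (S t y) e" using centre_in_mball_iff S_mem[OF t y] e by blast
    then have "t \<in> {0..t+1} \<inter> V" unfolding V(2)[symmetric] using t e by simp
    then have "t \<in> V" by simp
    then obtain \<delta> where \<delta>: "\<delta> > 0" "\<And>s. \<bar>s - t\<bar> < \<delta> \<Longrightarrow> s \<in> V"
      using V(1) by (auto simp: open_dist dist_real_def)
    \<comment> \<open>The radius 1 keeps \<open>s\<close> below the horizon
      \<open>t + 1\<close>.\<close>
    have "d (S s y) (S t y) < e" if "0 \<le> s" "\<bar>s - t\<bar> < min \<delta> 1" for s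
    proof -
      have "s \<in> {0..t+1} \<inter> V" using that \<delta>(2) by auto
      then have "S s y \<in> mball (S t y) e" using V(2) by blast
      then show ?thesis by (simp add: commute)
    qed
    then show ?thesis using \<delta>(1) by (intro exI[of _ "min \<delta> 1"]) auto
  qed
  have "continuous_on {0..} (\<lambda>t. code (S t y))"
    unfolding continuous_on_iff
  proof (intro ballI allI impI)
    fix t e :: real assume t: "t \<in> {0..}" and e: "0 < e"
    obtain \<delta> where "\<delta> > 0" "\<And>s. 0 \<le> s \<Longrightarrow> \<bar>s - t\<bar> < \<delta> \<Longrightarrow> d (S s y) (S t y) < e"
      using *[of t e] t e by auto
    then show "\<exists>\<delta>>0. \<forall>s\<in>{0..}. dist s t < \<delta> \<longrightarrow> dist (code (S s y)) (code (S t y)) < e"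
      using t S_mem y by (intro exI[of _ \<delta>]) (auto simp: dist_code dist_real_def)
  qed
  then show "continuous_on {0..} (\<lambda>t. pc (S t y))" "continuous_on {0..} (\<lambda>t. qc (S t y))"
    unfolding pc_qc_code by (intro continuous_intros; assumption)+
qed

text \<open>All terms of the variational identity are continuous in time, so its weak time
  derivative is classical. The harder point is the velocity: the solution concept gives w_t = v only
  after pairing in L^2, whereas w_x has to be differentiable in norm with derivative v_x. Therefore
  \<open>J p\<close> is compared with an antiderivative of \<open>q\<close>.\<close>

lemma S_trajectory:
  assumes y: "y \<in> M"
  shows "op.trajectory (\<lambda>t. pc (S t y)) (\<lambda>t. qc (S t y))"
proof -
  let ?J = "volterra L"
  define p where "p t = pc (S t y)" for t
  define q where "q t = qc (S t y)" for t
  define w where "w t = fst (S t y)" for t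
  define v where "v t = snd (S t y)" for t
  have cp: "continuous_on {0..} p" and cq: "continuous_on {0..} q"
    unfolding p_def q_def using S_continuous_in_time[OF y] by auto
  have cpT: "continuous_on {0..T} p" and cqT: "continuous_on {0..T} q" for T :: real
    by (rule continuous_on_subset[OF cp], simp, rule continuous_on_subset[OF cq], simp)
  have wH: "w t \<in> H2_star L" and vH: "v t \<in> H1_star L" if "0 \<le> t" for t
    using fst_snd[OF S_mem[OF that y]] by (auto simp: w_def v_def)
  have ew: "w t \<in> L2 L" "dx L (w t) \<in> L2 L" "dx L (dx L (w t)) \<in> L2 L"
    "emb L (dx L (dx L (w t))) = p t" "emb L (dx L (w t)) = ?J (p t)" "emb L (w t) = ?J (?J (p t))" if "0 \<le> t" for t
    using H2_starD[OF params(1) wH[OF that]] by (simp_all add: p_def pc_def w_def)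
  have ev: "v t \<in> L2 L" "dx L (v t) \<in> L2 L" "emb L (dx L (v t)) = q t" "emb L (v t) = ?J (q t)" if "0 \<le> t" for t
    using H1_starD[OF params(1) vH[OF that]] by (simp_all add: q_def qc_def v_def)
  have rp: "restrict_l2 L (p t) = p t" and rq: "restrict_l2 L (q t) = q t" if "0 \<le> t" for t
    using restrict_codes[OF S_mem[OF that y]] by (simp_all add: p_def q_def)
  have ws: "weak_solution L D b1 b2 p0 U \<beta> \<alpha> k0 T y w v" if "0 < T" for T
    using S_gen[OF that y] unfolding generalized_solution_def w_def v_def by blast
  have variational: "((\<lambda>t. ?J (q t) \<bullet> ?J (?J \<phi>) + \<alpha> * (q t \<bullet> ?J \<phi>)) has_real_derivative
        (emb L p0 \<bullet> ?J (?J \<phi>) - \<beta> * (?J (q t) \<bullet> ?J (?J \<phi>)) - \<beta> * U * (?J (p t) \<bullet> ?J (?J \<phi>)))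
        - (D * (p t \<bullet> \<phi>) + (b2 * (norm (?J (p t)))\<^sup>2 - b1) * (?J (p t) \<bullet> ?J \<phi>)
           + k0 * (?J (q t) \<bullet> ?J (?J \<phi>)) + \<alpha> * k0 * (q t \<bullet> ?J \<phi>))) (at t)" if t: "0 < t" for t \<phi>
  proof -
    define T where "T = t + 1"
    have T: "0 < T" "t \<in> {0<..<T}" using t by (auto simp: T_def)
    \<comment> \<open>\<open>volterra\<close> and \<open>p\<close> see only the part of
      \<open>\<phi>\<close> on (0,L), and that part is the second derivative of an admissible test
      function \<open>f\<close>.\<close>
    obtain g where g: "g \<in> L2 L" "restrict_l2 L \<phi> = emb L g" by (rule restrict_l2_cases)
    define f where "f = primr L (?J (emb L g))"
    have fH: "f \<in> H2_star L" and fdd: "emb L (dx L (dx L f)) = emb L g"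
      unfolding f_def using H2_starI[OF params(1) g(1)] by auto
    note fD = H2_starD[OF params(1) fH]
    have Jg: "?J (emb L g) = ?J \<phi>" by (simp add: g(2)[symmetric] volterra_restrict)
    have pg: "p s \<bullet> emb L g = p s \<bullet> \<phi>" if "0 \<le> s" for s
      using restrict_symmetric[of L "p s" \<phi>] rp[OF that] g(2) by simp
    let ?Y = "\<lambda>t. ?J (q t) \<bullet> ?J (?J \<phi>) + \<alpha> * (q t \<bullet> ?J \<phi>)"
    let ?R = "\<lambda>t. (emb L p0 \<bullet> ?J (?J \<phi>) - \<beta> * (?J (q t) \<bullet> ?J (?J \<phi>)) - \<beta> * U * (?J (p t) \<bullet> ?J (?J \<phi>)))
        - (D * (p t \<bullet> \<phi>) + (b2 * (norm (?J (p t)))\<^sup>2 - b1) * (?J (p t) \<bullet> ?J \<phi>)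
           + k0 * (?J (q t) \<bullet> ?J (?J \<phi>)) + \<alpha> * k0 * (q t \<bullet> ?J \<phi>))"
    have Y: "L2_inner L (v s) f + \<alpha> * L2_inner L (dx L (v s)) (dx L f) = ?Y s" if "0 \<le> s" for s
      using ev[OF that] fD fdd Jg by (simp add: L2_inner_emb)
    have R: "(L2_inner L p0 f - \<beta> * L2_inner L (v s) f - \<beta> * U * L2_inner L (dx L (w s)) f)
               - (H2_star_inner L D (w s) f
                  + (b2 * (L2_norm L (dx L (w s)))\<^sup>2 - b1) * L2_inner L (dx L (w s)) (dx L f)
                  + k0 * L2_inner L (v s) f
                  + \<alpha> * k0 * L2_inner L (dx L (v s)) (dx L f)) = ?R s" if "0 \<le> s" for s
      using ev[OF that] ew[OF that] fD fdd Jg pg[OF that] params(4)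
      by (simp add: L2_inner_emb L2_norm_emb H2_star_inner_def)
    let ?Ya = "\<lambda>s. L2_inner L (v s) f + \<alpha> * L2_inner L (dx L (v s)) (dx L f)"
    let ?Ra = "\<lambda>s. (L2_inner L p0 f - \<beta> * L2_inner L (v s) f - \<beta> * U * L2_inner L (dx L (w s)) f)
               - (H2_star_inner L D (w s) f
                  + (b2 * (L2_norm L (dx L (w s)))\<^sup>2 - b1) * L2_inner L (dx L (w s)) (dx L f)
                  + k0 * L2_inner L (v s) f
                  + \<alpha> * k0 * L2_inner L (dx L (v s)) (dx L f))"
    have wd: "weak_deriv 0 T ?Ya ?Ra"
      using ws[OF T(1)] fH unfolding weak_solution_def by blast
    have cY: "continuous_on {0..T} ?Y"
      by (intro continuous_intros op.J.continuous_on cpT cqT)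
    have cR: "continuous_on {0..T} ?R"
      by (intro continuous_intros op.J.continuous_on cpT cqT)
    have "(?Ya has_real_derivative ?Ra t) (at t)"
    proof (rule weak_deriv_imp_has_derivative[OF wd _ _ T(2)])
      show "continuous_on {0..T} ?Ya" by (rule continuous_on_eq[OF cY]) (simp add: Y)
      show "continuous_on {0..T} ?Ra" by (rule continuous_on_eq[OF cR]) (simp add: R)
    qed
    then have "(?Y has_real_derivative ?Ra t) (at t)"
      by (rule has_field_derivative_transform_within_open[of _ _ _ "{0<..}"]) (use t in \<open>auto simp: Y\<close>)
    then show ?thesis using R[of t] t by simp
  qed
  have velocity: "((\<lambda>t. ?J (p t)) has_vector_derivative q t) (at t)" if t: "0 < t" for t
  proof -
    define c where "c = t / 2"
    have c: "0 < c" "c < t" using t by (auto simp: c_def)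
    have "continuous_on {0<..} q" by (rule continuous_on_subset[OF cq]) auto
    then obtain Q0 where Q0: "\<And>s. c < s \<Longrightarrow> (Q0 has_vector_derivative q s) (at s)"
      using antiderivative_open_interval[OF _ c(1)] by blast
    interpret R: bounded_linear "restrict_l2 L" by (rule bounded_linear_restrict)
    \<comment> \<open>The projection keeps the difference from \<open>?J (p s)\<close> in the
      subspace on which \<open>volterra\<close> is injective.\<close>
    define Q where "Q s = restrict_l2 L (Q0 s)" for s
    have Q: "(Q has_vector_derivative q s) (at s)" if "c < s" for s
      using R.has_vector_derivative[OF Q0[OF that]] rq[of s] that c unfolding Q_def[abs_def] by simp
    have pair: "((\<lambda>s. ?J (?J (p s)) \<bullet> emb L \<psi>) has_real_derivative ?J (q s) \<bullet> emb L \<psi>) (at s)"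
      if \<psi>: "\<psi> \<in> L2 L" "norm (emb L \<psi>) \<le> 1" and s: "c < s" for \<psi> s
    proof -
      define T where "T = s + 1"
      have T: "0 < T" "s \<in> {0<..<T}" using s c by (auto simp: T_def)
      have W: "L2_inner L (w r) \<psi> = ?J (?J (p r)) \<bullet> emb L \<psi>" and V: "L2_inner L (v r) \<psi> = ?J (q r) \<bullet> emb L \<psi>" if "0 \<le> r" for r
        using ew[OF that] ev[OF that] \<psi>(1) by (simp_all add: L2_inner_emb)
      have cw: "continuous_on {0..T} (\<lambda>r. L2_inner L (w r) \<psi>)"
        by (rule continuous_on_eq[of _ "\<lambda>r. ?J (?J (p r)) \<bullet> emb L \<psi>"])
           (auto simp: W intro!: continuous_intros op.J.continuous_on cpT)
      have cv: "continuous_on {0..T} (\<lambda>r. L2_inner L (v r) \<psi>)"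
        by (rule continuous_on_eq[of _ "\<lambda>r. ?J (q r) \<bullet> emb L \<psi>"])
           (auto simp: V intro!: continuous_intros op.J.continuous_on cqT)
      have "H1_in_with_deriv T (L2 L) (L2_norm L) w v"
        using ws[OF T(1)] unfolding weak_solution_def by blast
      then have "weak_deriv 0 T (\<lambda>r. L2_inner L (w r) \<psi>) (\<lambda>r. L2_inner L (v r) \<psi>)"
        using \<psi> by (intro H1_in_imp_weak_deriv[OF T(1)] cw cv) (auto simp: ew ev L2_norm_emb)
      from weak_deriv_imp_has_derivative[OF this cw cv T(2)]
      have "((\<lambda>r. L2_inner L (w r) \<psi>) has_real_derivative ?J (q s) \<bullet> emb L \<psi>) (at s)"
        using V[of s] T by simp
      then show ?thesis
        by (rule has_field_derivative_transform_within_open[of _ _ _ "{0<..}"]) (use s c in \<open>auto simp: W\<close>)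
    qed
    have const: "?J (p r) - Q r = ?J (p t) - Q t" if r: "c < r" for r
    proof -
      define z where "z = (?J (p r) - Q r) - (?J (p t) - Q t)"
      have rz: "restrict_l2 L z = z"
        unfolding z_def Q_def R.diff by (simp add: restrict_volterra restrict_idem)
      have "?J z = 0"
      proof -
        \<comment> \<open>The direction of \<open>?J z\<close>, so that pairing with it gives the
          norm of \<open>?J z\<close>; it is normalised as \<open>H1_in_imp_weak_deriv\<close>
          demands. For \<open>?J z = 0\<close> the inverse is 0 and the bound still holds.\<close>
        define \<psi> where "\<psi> = (\<lambda>x. inverse (norm (?J z)) * prim L z x)"
        have \<psi>: "\<psi> \<in> L2 L" "emb L \<psi> = inverse (norm (?J z)) *\<^sub>R ?J z"
          unfolding \<psi>_def by (auto simp: L2_scale emb_scale prim_in_L2 volterra_def)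
        have n: "norm (emb L \<psi>) \<le> 1" unfolding \<psi>(2) by (cases "?J z = 0") auto
        let ?h = "\<lambda>s. ?J (?J (p s)) \<bullet> emb L \<psi> - ?J (Q s) \<bullet> emb L \<psi>"
        have "(?h has_real_derivative 0) (at s)" if "c < s" for s
        proof -
          have "((\<lambda>s. ?J (Q s) \<bullet> emb L \<psi>) has_real_derivative ?J (q s) \<bullet> emb L \<psi>) (at s)"
            using bounded_linear.has_vector_derivative[OF bounded_linear_inner_left op.J.has_vector_derivative[OF Q[OF that]]]
            by (simp add: has_real_derivative_iff_has_vector_derivative)
          from DERIV_diff[OF pair[OF \<psi>(1) n that] this] show ?thesis by simp
        qed
        then have "\<exists>k. \<forall>s\<in>{c<..}. ?h s = k"
          by (intro has_field_derivative_zero_constant) (auto intro: has_field_derivative_at_within)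
        then have "?h r = ?h t" using r c by auto
        then have "?J z \<bullet> emb L \<psi> = 0"
          by (simp add: z_def op.J.diff inner_diff_left)
        then show ?thesis unfolding \<psi>(2) by simp
      qed
      then have "z = 0" by (rule volterra_injective[OF params(1) rz])
      then show ?thesis by (simp add: z_def)
    qed
    have "((\<lambda>s. (?J (p t) - Q t) + Q s) has_vector_derivative q t) (at t)"
      using has_vector_derivative_add[OF has_vector_derivative_const Q[OF c(2)]] by simp
    then show ?thesis
    proof (rule has_vector_derivative_transform_within_open[of _ _ _ "{c<..}"])
      show "(?J (p t) - Q t) + Q s = ?J (p s)" if "s \<in> {c<..}" for s
        using const[of s] that by (simp add: algebra_simps)
    qed (use c in auto)
  qed
  show ?thesis
    using cp cq velocity variational unfolding op.trajectory_def p_def[symmetric] q_def[symmetric] by blast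
qed

lemma compact_attractor: "\<exists>A. global_attractor M d S A \<and> compactin mtopology A"
proof -
  define P where "P y t = pc (S t y)" for y t
  define Q where "Q y t = qc (S t y)" for y t
  have tr: "op.trajectory (P y) (Q y)" if "y \<in> M" for y
    using S_trajectory[OF that] unfolding P_def[abs_def] Q_def[abs_def] .
  define E where "E y = op.en (pc y) (qc y)" for y
  obtain \<gamma> K where \<gamma>: "0 < \<gamma>" and diss:
    "\<And>R. \<exists>C. \<forall>p q. op.trajectory p q \<and> op.en (p 0) (q 0) \<le> R \<longrightarrow>
         (\<forall>t\<ge>0. op.en (p t) (q t) \<le> C * exp (- \<gamma> * t) + K)"
    using op.dissipative by metis
  have decay: "\<exists>C. \<forall>y\<in>M. E y \<le> R \<longrightarrow> (\<forall>t\<ge>0. E (S t y) \<le> C * exp (- \<gamma> * t) + K)" for R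
  proof -
    obtain C where C: "\<And>p q t. op.trajectory p q \<Longrightarrow> op.en (p 0) (q 0) \<le> R \<Longrightarrow> 0 \<le> t \<Longrightarrow>
         op.en (p t) (q t) \<le> C * exp (- \<gamma> * t) + K" using diss[of R] by blast
    have "E (S t y) \<le> C * exp (- \<gamma> * t) + K" if "y \<in> M" "E y \<le> R" "0 \<le> t" for y t
      using C[OF tr[OF that(1)] _ that(3)] that(2) S_zero[OF that(1)] by (simp add: P_def Q_def E_def)
    then show ?thesis by blast
  qed
  \<comment> \<open>The 1 is what the decaying term may still contribute after a long time.\<close>
  define B0 where "B0 = {y \<in> M. E y \<le> K + 1}"
  have dE: "d y z \<le> sqrt (E y) + sqrt (E z)" if "y \<in> M" "z \<in> M" for y z
    unfolding d_vec[OF that] E_def op.sqrt_en by (rule norm_triangle_ineq4)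
  show ?thesis
  proof (rule finite_small_cover_imp_compact_attractor[OF phase_complete S_semigroup S_continuous])
    show "B0 \<subseteq> M" by (auto simp: B0_def)
    have "d y z \<le> 2 * sqrt (K + 1)" if "y \<in> B0" "z \<in> B0" for y z
    proof -
      have "y \<in> M" "z \<in> M" "sqrt (E y) \<le> sqrt (K + 1)" "sqrt (E z) \<le> sqrt (K + 1)"
        using that by (auto simp: B0_def)
      then show ?thesis using dE[of y z] by linarith
    qed
    then have "\<exists>b. \<forall>y\<in>B0. \<forall>z\<in>B0. d y z \<le> b" by blast
    then show "mbounded B0" unfolding mbounded_alt by (simp add: B0_def)
    show "\<exists>T\<ge>0. \<forall>t\<ge>T. S t ` B \<subseteq> B0" if B: "mbounded B" for B
    proof -
      obtain c b where cb: "B \<subseteq> mcball c b" using B unfolding mbounded_def by blast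
      \<comment> \<open>In the norm \<open>sqrt (E y)\<close> the ball around \<open>c\<close> lies
        in the ball of radius \<open>sqrt (E c) + b\<close> around the origin.\<close>
      define R where "R = (sqrt (E c) + b)\<^sup>2"
      have R: "E y \<le> R" if "y \<in> B" for y
      proof -
        have y: "c \<in> M" "y \<in> M" "d c y \<le> b" using cb that by auto
        have "sqrt (E y) \<le> sqrt (E c) + d c y"
          unfolding d_vec[OF y(1,2)] E_def op.sqrt_en
          using norm_triangle_ineq2[of "op.state_vec (pc y) (qc y)" "op.state_vec (pc c) (qc c)"]
          by (simp add: norm_minus_commute)
        then have "sqrt (E y) \<le> sqrt (E c) + b" using y(3) by simp
        then show ?thesis unfolding R_def by (rule sqrt_le_D)
      qed
      obtain C where C: "\<And>y t. y \<in> M \<Longrightarrow> E y \<le> R \<Longrightarrow> 0 \<le> t \<Longrightarrow> E (S t y) \<le> C * exp (- \<gamma> * t) + K"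
        using decay[of R] by blast
      have "((\<lambda>t. C * exp (- \<gamma> * t)) \<longlongrightarrow> C * 0) at_top"
        by (intro tendsto_intros filterlim_compose[OF exp_at_bot]
              filterlim_tendsto_neg_mult_at_bot[OF tendsto_const _ filterlim_ident])
           (use \<gamma> in auto)
      then have "\<forall>\<^sub>F t in at_top. C * exp (- \<gamma> * t) < 1" by (rule order_tendstoD) simp
      then obtain T where T: "\<And>t. T \<le> t \<Longrightarrow> C * exp (- \<gamma> * t) < 1"
        by (auto simp: eventually_at_top_linorder)
      have "S t y \<in> B0" if "max 0 T \<le> t" "y \<in> B" for t y
      proof -
        have y: "y \<in> M" using B that(2) mbounded_subset_mspace by blast
        have "0 \<le> t" "T \<le> t" using that(1) by auto
        then have "E (S t y) \<le> K + 1" using C[OF y R[OF that(2)], of t] T[of t] by linarith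
        then show ?thesis using S_mem[OF \<open>0 \<le> t\<close> y] by (simp add: B0_def)
      qed
      then show ?thesis by (intro exI[of _ "max 0 T"]) auto
    qed
    show "\<exists>T\<ge>0. \<exists>\<U>. finite \<U> \<and> S T ` B0 \<subseteq> \<Union>\<U> \<and> (\<forall>V\<in>\<U>. \<forall>x\<in>V. \<forall>y\<in>V. d x y \<le> e)" if e: "0 < e" for e
    proof -
      obtain C where C: "\<And>y t. y \<in> M \<Longrightarrow> E y \<le> K + 1 \<Longrightarrow> 0 \<le> t \<Longrightarrow> E (S t y) \<le> C * exp (- \<gamma> * t) + K"
        using decay[of "K + 1"] by blast
      have bound: "op.en (P y t) (Q y t) \<le> \<bar>C\<bar> + K" if "y \<in> B0" "0 \<le> t" for y t
      proof -
        have "C * exp (- \<gamma> * t) \<le> \<bar>C\<bar> * 1"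
          using that(2) \<gamma> by (intro mult_mono) auto
        then show ?thesis using C[of y t] that by (simp add: B0_def P_def Q_def E_def)
      qed
      \<comment> \<open>Squared, because \<open>op.en\<close> is the square of the distance.\<close>
      have "0 < e\<^sup>2" using e by simp
      obtain T \<V> where T: "0 \<le> T" and \<V>: "finite \<V>"
        "\<And>p q. op.trajectory p q \<Longrightarrow> (\<And>t. 0 \<le> t \<Longrightarrow> op.en (p t) (q t) \<le> \<bar>C\<bar> + K) \<Longrightarrow> (p, q) \<in> \<Union>\<V>"
        "\<And>V p1 q1 p2 q2. V \<in> \<V> \<Longrightarrow> (p1, q1) \<in> V \<Longrightarrow> (p2, q2) \<in> V \<Longrightarrow> op.en (p1 T - p2 T) (q1 T - q2 T) \<le> e\<^sup>2"
        by (rule op.finite_trajectory_classes[OF volterra_compact[OF params(1)] \<open>0 < e\<^sup>2\<close>, where R = "\<bar>C\<bar> + K"]) blast+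
      \<comment> \<open>Each class of trajectories is cut down to orbits from \<open>B0\<close> and
        evaluated at time \<open>T\<close>.\<close>
      define \<U> where "\<U> = (\<lambda>V. {S T y |y. y \<in> B0 \<and> (P y, Q y) \<in> V}) ` \<V>"
      have fin: "finite \<U>" unfolding \<U>_def using \<V>(1) by simp
      have cov: "S T ` B0 \<subseteq> \<Union>\<U>"
      proof (rule image_subsetI)
        fix y assume y: "y \<in> B0"
        then have "(P y, Q y) \<in> \<Union>\<V>" by (intro \<V>(2) tr bound) (auto simp: B0_def)
        then show "S T y \<in> \<Union>\<U>" using y unfolding \<U>_def by blast
      qed
      have small: "d x y \<le> e" if "V \<in> \<U>" "x \<in> V" "y \<in> V" for V x y
      proof -
        obtain V' y1 y2 where V': "V' \<in> \<V>" "(P y1, Q y1) \<in> V'" "(P y2, Q y2) \<in> V'"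
          and xy: "x = S T y1" "y = S T y2" "y1 \<in> M" "y2 \<in> M"
          using \<open>V \<in> \<U>\<close> \<open>x \<in> V\<close> \<open>y \<in> V\<close> unfolding \<U>_def B0_def by blast
        have "d x y = sqrt (op.en (P y1 T - P y2 T) (Q y1 T - Q y2 T))"
          using d_eq[OF S_mem[OF T xy(3)] S_mem[OF T xy(4)]] by (simp add: xy P_def Q_def)
        also have "\<dots> \<le> sqrt (e\<^sup>2)" using \<V>(3)[OF V'] by (rule real_sqrt_le_mono)
        finally show ?thesis using e by simp
      qed
      show ?thesis by (intro exI[of _ T] exI[of _ \<U>] conjI ballI T fin cov small)
    qed
  qed
qed

end

theorem theorem2p3:
  fixes L D b1 b2 U \<beta> \<alpha> k0 :: real
    and p0 :: "real \<Rightarrow> real"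
    and S :: "real \<Rightarrow> state \<Rightarrow> state"
  assumes "L > 0" and "D > 0" and "b2 > 0"
    and "p0 \<in> L2 L"
    and "U \<ge> 0" and "\<beta> \<ge> 0"
    and "\<alpha> > 0" and "k0 > 0"
    and "beam_dynamical_system L D b1 b2 p0 U \<beta> \<alpha> k0 S"
  shows "\<exists>A. global_attractor (phase_space L) (phase_dist L D \<alpha>) S A \<and>
             compactin (Metric_space.mtopology (phase_space L) (phase_dist L D \<alpha>)) A"
proof -
  interpret beam_problem L D b1 b2 U \<beta> \<alpha> k0 p0 S
    by (rule beam_problem.intro) (use assms in auto)
  show ?thesis by (rule compact_attractor)
qed

end
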